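(* Let $k\in\{1,-1\}$, let $h\in C([0,\infty);\mathbb{R})$ be fixed, let $z_0=(u_0,\rho_0)\in H^2\times H^1$, and let $T$ be the maximal existence time of the corresponding solution $z=(u,\rho)$ to the system (HS) with initial data $z_0$. Then the solution blows up in finite time if and only if $$\liminf_{t\rightarrow T}\ \inf_{x\in\mathbb{S}}u_x(t,x)=-\infty .$$
   Context: Notation: $\mathbb{S}=\mathbb{R}/\mathbb{Z}$, $H^r=H^r(\mathbb{S})$; functions on $\mathbb{S}$ are identified with 1-periodic functions on $\mathbb{R}$; $\partial_x^{-1}g(x)=\int_0^x g(y)\,dy$. For $k\in\{1,-1\}$, a given $h\in C([0,\infty);\mathbb{R})$ and initial data $(u_0,\rho_0)$, the system (HS) is $$\begin{cases} u_t+uu_x=\partial_x^{-1}\left(\frac k2\rho^2+\frac12u_x^2+a\right)+h(t), & t>0,\ x\in\mathbb{R},\\ \rho_t+(\rho u)_x=0, & t>0,\ x\in\mathbb{R},\\ u(0,x)=u_0(x),\ \rho(0,x)=\rho_0(x), & x\in\mathbb{R},\\ u(t,x+1)=u(t,x),\ \rho(t,x+1)=\rho(t,x), & t\ge0,\ x\in\mathbb{R},\end{cases}$$ where $a=-\frac12\int_{\mathbb{S}}(k\rho_0^2+u_{0,x}^2)\,dx$. Known local well-posedness (used to define $T$): for $h\in C([0,\infty);\mathbb{R})$ and $z_0=(u_0,\rho_0)\in H^s\times H^{s-1}$ with $s\ge2$, there exist a maximal existence time $T\in(0,\infty]$ and a unique solution $z=(u,\rho)$ of (HS) with $z\in C([0,T);H^s\times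 H^{s-1})\cap C^1([0,T);H^{s-1}\times H^{s-2})$. Here this is applied with $s=2$. The solution is said to blow up in finite time if $T<\infty$. *)

theory Defs
  imports "HOL-Analysis.Analysis" "HOL-Library.Periodic_Fun"
begin

text \<open>
  Functions on the circle \<open>\<real>/\<int>\<close> are 1-periodic functions on \<open>\<real>\<close>
  (\<^const>\<open>periodic_fun_simple'\<close>), and integrals over the circle are integrals over \<open>[0,1]\<close>.
\<close>

definition square_integrable :: "(real \<Rightarrow> real) \<Rightarrow> bool" where
  "square_integrable f \<longleftrightarrow>
     periodic_fun_simple' f \<and> f \<in> borel_measurable borel \<and>
     set_integrable lborel {0..1} (\<lambda>x. (f x)\<^sup>2)"

definition test_function :: "(real \<Rightarrow> real) \<Rightarrow> bool" where
  "test_function \<phi> \<longleftrightarrow>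
     periodic_fun_simple' \<phi> \<and> (\<forall>n x. (deriv ^^ n) \<phi> differentiable (at x))"

definition has_weak_deriv :: "nat \<Rightarrow> (real \<Rightarrow> real) \<Rightarrow> (real \<Rightarrow> real) \<Rightarrow> bool" where
  "has_weak_deriv j f g \<longleftrightarrow>
     square_integrable g \<and>
     (\<forall>\<phi>. test_function \<phi> \<longrightarrow>
        (LBINT x:{0..1}. f x * (deriv ^^ j) \<phi> x) = (-1) ^ j * (LBINT x:{0..1}. g x * \<phi> x))"

text \<open>A representative of the weak derivative, which is unique up to null sets.\<close>

definition weak_deriv :: "nat \<Rightarrow> (real \<Rightarrow> real) \<Rightarrow> (real \<Rightarrow> real)" where
  "weak_deriv j f = (SOME g. has_weak_deriv j f g)"

text \<open>
  The space \<open>H\<^sup>m\<close> of the circle, for natural \<open>m\<close>. Elements of \<open>H\<^sup>0 = L\<^sup>2\<close> are arbitrary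
  representatives of their class modulo null sets. For \<open>m \<ge> 1\<close> every class contains exactly one
  continuous function, and it is this function that is taken as the element of \<open>H\<^sup>m\<close>; hence
  elements of \<open>H\<^sup>1\<close> have values at points, and elements of \<open>H\<^sup>2\<close> are of class \<open>C\<^sup>1\<close>, so that
  \<^const>\<open>deriv\<close> gives the continuous representative of their weak derivative.
\<close>

definition sobolev :: "nat \<Rightarrow> (real \<Rightarrow> real) set" where
  "sobolev m = {f. square_integrable f \<and> (m \<ge> 1 \<longrightarrow> continuous_on UNIV f) \<and>
                   (\<forall>j\<le>m. \<exists>g. has_weak_deriv j f g)}"

definition sobolev_norm :: "nat \<Rightarrow> (real \<Rightarrow> real) \<Rightarrow> real" where
  "sobolev_norm m f = sqrt (\<Sum>j\<le>m. LBINT x:{0..1}. (weak_deriv j f x)\<^sup>2)"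

text \<open>The interval \<open>[0,T)\<close> for \<open>T \<in> (0,\<infinity>]\<close>.\<close>

definition time_interval :: "ereal \<Rightarrow> real set" where
  "time_interval T = {t. 0 \<le> t \<and> ereal t < T}"

text \<open>The space \<open>C([0,T);H\<^sup>m)\<close>.\<close>

definition C0_sobolev :: "ereal \<Rightarrow> nat \<Rightarrow> (real \<Rightarrow> real \<Rightarrow> real) set" where
  "C0_sobolev T m =
     {w. (\<forall>t\<in>time_interval T. w t \<in> sobolev m) \<and>
         (\<forall>t\<in>time_interval T.
            ((\<lambda>s. sobolev_norm m (\<lambda>x. w s x - w t x)) \<longlongrightarrow> 0) (at t within time_interval T))}"

text \<open>
  \<open>w \<in> C\<^sup>1([0,T);H\<^sup>m)\<close> with \<open>w\<^sub>t = w'\<close>, the time derivative being the limit of the difference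
  quotients in the norm of \<open>H\<^sup>m\<close> (one-sided at \<open>t = 0\<close>).
\<close>

definition C1_sobolev_deriv ::
    "ereal \<Rightarrow> nat \<Rightarrow> (real \<Rightarrow> real \<Rightarrow> real) \<Rightarrow> (real \<Rightarrow> real \<Rightarrow> real) \<Rightarrow> bool" where
  "C1_sobolev_deriv T m w w' \<longleftrightarrow>
     w \<in> C0_sobolev T m \<and> w' \<in> C0_sobolev T m \<and>
     (\<forall>t\<in>time_interval T.
        ((\<lambda>s. sobolev_norm m (\<lambda>x. (w s x - w t x) / (s - t) - w' t x)) \<longlongrightarrow> 0)
          (at t within time_interval T))"

definition inv_dx :: "(real \<Rightarrow> real) \<Rightarrow> real \<Rightarrow> real" where
  "inv_dx g x = (LBINT y=ereal 0..ereal x. g y)"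

definition HS_const :: "real \<Rightarrow> (real \<Rightarrow> real) \<Rightarrow> (real \<Rightarrow> real) \<Rightarrow> real" where
  "HS_const k u0 \<rho>0 = - (1/2) * (LBINT x:{0..1}. k * (\<rho>0 x)\<^sup>2 + (deriv u0 x)\<^sup>2)"

text \<open>
  \<open>(u,\<rho>)\<close> is a solution on \<open>[0,T)\<close> in
  \<open>C([0,T);H\<^sup>2 \<times> H\<^sup>1) \<inter> C\<^sup>1([0,T);H\<^sup>1 \<times> H\<^sup>0)\<close>. The first equation is an identity
  between continuous functions and the second one an identity in \<open>L\<^sup>2\<close>. Periodicity in \<open>x\<close> is part
  of \<^const>\<open>sobolev\<close>.
\<close>

definition HS_solution ::
    "real \<Rightarrow> (real \<Rightarrow> real) \<Rightarrow> (real \<Rightarrow> real) \<Rightarrow> (real \<Rightarrow> real) \<Rightarrow> ereal \<Rightarrow>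
     (real \<Rightarrow> real \<Rightarrow> real) \<Rightarrow> (real \<Rightarrow> real \<Rightarrow> real) \<Rightarrow> bool" where
  "HS_solution k h u0 \<rho>0 T u \<rho> \<longleftrightarrow>
     0 < T \<and> u \<in> C0_sobolev T 2 \<and> \<rho> \<in> C0_sobolev T 1 \<and>
     u 0 = u0 \<and> \<rho> 0 = \<rho>0 \<and>
     (\<exists>u_t \<rho>_t.
        C1_sobolev_deriv T 1 u u_t \<and> C1_sobolev_deriv T 0 \<rho> \<rho>_t \<and>
        (\<forall>t. 0 < t \<and> ereal t < T \<longrightarrow>
           (\<forall>x. u_t t x + u t x * deriv (u t) x =
              inv_dx (\<lambda>y. k / 2 * (\<rho> t y)\<^sup>2 + 1 / 2 * (deriv (u t) y)\<^sup>2 + HS_const k u0 \<rho>0) x + h t) \<and>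
           (AE x in lborel. \<rho>_t t x + weak_deriv 1 (\<lambda>y. \<rho> t y * u t y) x = 0)))"

definition max_existence_time ::
    "real \<Rightarrow> (real \<Rightarrow> real) \<Rightarrow> (real \<Rightarrow> real) \<Rightarrow> (real \<Rightarrow> real) \<Rightarrow> ereal" where
  "max_existence_time k h u0 \<rho>0 = Sup {T. \<exists>u \<rho>. HS_solution k h u0 \<rho>0 T u \<rho>}"

text \<open>
  Real \<open>t\<close> tending to \<open>T\<close>: the left-sided filter at \<open>T\<close> on the reals if \<open>T\<close> is finite, and
  \<^const>\<open>at_top\<close> if \<open>T = \<infinity>\<close>.
\<close>

definition tends_to_time :: "ereal \<Rightarrow> real filter" where
  "tends_to_time T = filtercomap ereal (at_left T)"

definition blows_up_in_finite_time ::
    "real \<Rightarrow> (real \<Rightarrow> real) \<Rightarrow> (real \<Rightarrow> real) \<Rightarrow> (real \<Rightarrow> real) \<Rightarrow> bool" where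
  "blows_up_in_finite_time k h u0 \<rho>0 \<longleftrightarrow> max_existence_time k h u0 \<rho>0 < \<infinity>"

end

theory Submission
  imports Defs
begin

text \<open>
  Along a trajectory \<open>q' = u(t,q)\<close> the functions \<open>V = u\<^sub>x(t,q)\<close> and \<open>R = \<rho>(t,q)\<close> satisfy the closed system
  \<open>V' = -V\<^sup>2/2 + kR\<^sup>2/2 + a\<close>, \<open>R' = -VR\<close>. Hence the Jacobian \<open>\<phi> = q\<^sub>x\<close> solves the linear equation
  \<open>\<phi>'' = 2a(\<phi> - 1) + P\<close>, so that \<open>\<phi> = 1 + u\<^sub>0' S + P C\<close>, where \<open>C\<close> and \<open>S = C'\<close> depend only on \<open>t\<close> and \<open>a\<close>, and
  \<open>P = k\<rho>\<^sub>0\<^sup>2/2 + u\<^sub>0'\<^sup>2/2 + a\<close>.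

  If \<open>u\<^sub>x \<ge> -M\<close> near a finite time \<open>T\<close>, then \<open>\<phi>' = u\<^sub>x(t,q) \<phi>\<close> keeps \<open>\<phi>\<close> away from zero up to \<open>T\<close> and, by
  continuity, slightly beyond. The explicit \<open>\<phi>\<close> then defines a flow whose velocity field is a solution on
  a longer interval, contradicting maximality. Neither a local existence theorem nor uniqueness of solutions
  is needed.

  If \<open>T = \<infinity>\<close>, then \<open>u\<^sub>x\<close> is bounded below for all time: for \<open>k = -1\<close> both \<open>V \<plusminus> R\<close> solve the Riccati equation
  \<open>p' = -p\<^sup>2/2 + a\<close>, which blows up in finite time from very negative values; for \<open>k = 1\<close> and \<open>a < 0\<close> the
  function \<open>\<rho>\<^sub>0\<close> has no zero, since \<open>R = 0\<close> would force such a blowup, and \<open>(V\<^sup>2 + R\<^sup>2 - 2a)/R\<close> is constant in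
  time.
\<close>

section \<open>Locally square integrable and absolutely continuous functions\<close>

text \<open>The obstacle is regularity. With u in H^2 and \<rho> in H^1, the functions u_x and
  \<rho> are continuous but have no classical time derivatives, so the system for V and R cannot be
  read off by differentiating the equations. Instead, spatial difference quotients of u and of the
  primitive of \<rho> are differentiated along a trajectory, and their time derivatives converge
  uniformly as the step tends to zero. The equation for \<phi> is linear because \<phi>'' = (V' +
  V^2) \<phi>, and because (k R^2 + V^2 - 2a) \<phi> is constant along trajectories. Conversely, the
  explicit flow is only as regular in x as the data: u_xx and \<rho>_x are combinations of the L^2
  functions u_0'' and \<rho>_0' transported by the inverse flow. Their continuity in time rests on
  the density of continuous functions and on a Jacobian bound uniform in time. The value of a gives
  P mean zero, which makes the flow commute with unit translations. A translation depending on time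
  remains free; the primitive in the equation vanishes at x = 0, and this fixes the translation
  through an ordinary differential equation.\<close>

definition loc_L2 :: "(real \<Rightarrow> real) \<Rightarrow> bool" where
  "loc_L2 f \<longleftrightarrow> f \<in> borel_measurable borel \<and> (\<forall>a b. set_integrable lborel {a..b} (\<lambda>x. (f x)\<^sup>2))"

lemma loc_L2_measurable [measurable_dest]: "loc_L2 f \<Longrightarrow> f \<in> borel_measurable borel"
  by (simp add: loc_L2_def)

lemma loc_L2_sq_integrable: "loc_L2 f \<Longrightarrow> set_integrable lborel {a..b} (\<lambda>x. (f x)\<^sup>2)"
  by (simp add: loc_L2_def)

lemma set_integrable_continuous_UNIV:
  fixes f :: "real \<Rightarrow> real"
  shows "continuous_on UNIV f \<Longrightarrow> set_integrable lborel {a..b} f"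
  by (rule borel_integrable_atLeastAtMost') (rule continuous_on_subset, assumption, simp)

lemma loc_L2_continuous:
  fixes f :: "real \<Rightarrow> real"
  assumes "continuous_on UNIV f" shows "loc_L2 f"
  unfolding loc_L2_def using assms
  by (intro conjI allI borel_measurable_continuous_onI set_integrable_continuous_UNIV continuous_on_power)

lemma set_integrable_le:
  fixes f g :: "real \<Rightarrow> real"
  assumes "set_integrable lborel {a..b} g" "f \<in> borel_measurable borel"
    "\<And>x. x \<in> {a..b} \<Longrightarrow> \<bar>f x\<bar> \<le> g x"
  shows "set_integrable lborel {a..b} f"
  by (rule set_integrable_bound[OF assms(1)])
     (use assms(2,3) in \<open>force simp: set_borel_measurable_def\<close>)+

lemma loc_L2_mult_integrable:
  assumes "loc_L2 f" "loc_L2 g" shows "set_integrable lborel {a..b} (\<lambda>x. f x * g x)"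
proof (rule set_integrable_le)
  show "set_integrable lborel {a..b} (\<lambda>x. (f x)\<^sup>2 + (g x)\<^sup>2)"
    using assms by (intro set_integral_add loc_L2_sq_integrable)
  show "\<bar>f x * g x\<bar> \<le> (f x)\<^sup>2 + (g x)\<^sup>2" for x
    using sum_squares_bound[of "\<bar>f x\<bar>" "\<bar>g x\<bar>"] mult_nonneg_nonneg[of "\<bar>f x\<bar>" "\<bar>g x\<bar>"]
    unfolding abs_mult power2_abs by linarith
qed (use assms in measurable)

lemma loc_L2_const [simp]: "loc_L2 (\<lambda>x. c)"
  by (intro loc_L2_continuous continuous_intros)

lemma loc_L2_integrable: "loc_L2 f \<Longrightarrow> set_integrable lborel {a..b} f"
  using loc_L2_mult_integrable[of f "\<lambda>_. 1"] by simp

lemma loc_L2_add: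
  assumes "loc_L2 f" "loc_L2 g" shows "loc_L2 (\<lambda>x. f x + g x)"
proof -
  have "set_integrable lborel {a..b} (\<lambda>x. (f x + g x)\<^sup>2)" for a b
    unfolding power2_sum mult.assoc using assms
    by (intro set_integral_add loc_L2_sq_integrable set_integrable_mult_right loc_L2_mult_integrable)
  moreover have "(\<lambda>x. f x + g x) \<in> borel_measurable borel"
    using assms by measurable
  ultimately show ?thesis
    unfolding loc_L2_def by blast
qed

lemma loc_L2_mult_bounded:
  assumes "loc_L2 f" "m \<in> borel_measurable borel" "\<And>a b. \<exists>B. \<forall>x\<in>{a..b}. \<bar>m x\<bar> \<le> B"
  shows "loc_L2 (\<lambda>x. m x * f x)"
  unfolding loc_L2_def
proof safe
  fix a b
  obtain B where B: "\<forall>x\<in>{a..b}. \<bar>m x\<bar> \<le> B" using assms(3) by blast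
  show "set_integrable lborel {a..b} (\<lambda>x. (m x * f x)\<^sup>2)"
  proof (rule set_integrable_le)
    show "set_integrable lborel {a..b} (\<lambda>x. B\<^sup>2 * (f x)\<^sup>2)"
      using assms(1) by (intro set_integrable_mult_right loc_L2_sq_integrable)
    fix x assume "x \<in> {a..b}"
    then have "\<bar>m x\<bar>\<^sup>2 \<le> B\<^sup>2" using B by (intro power_mono) auto
    then show "\<bar>(m x * f x)\<^sup>2\<bar> \<le> B\<^sup>2 * (f x)\<^sup>2"
      by (simp add: power_mult_distrib mult_right_mono)
  qed (use assms in measurable)
qed (use assms in measurable)

lemma continuous_bounded_Icc:
  fixes m :: "real \<Rightarrow> real"
  assumes "continuous_on {a..b} m" shows "\<exists>B>0. \<forall>x\<in>{a..b}. \<bar>m x\<bar> \<le> B"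
proof -
  have "bounded (m ` {a..b})" using assms by (intro compact_imp_bounded compact_continuous_image) auto
  then show ?thesis unfolding bounded_pos by auto
qed

lemma loc_L2_mult_continuous:
  assumes "loc_L2 f" "continuous_on UNIV m"
  shows "loc_L2 (\<lambda>x. m x * f x)"
proof (rule loc_L2_mult_bounded[OF assms(1) borel_measurable_continuous_onI[OF assms(2)]])
  show "\<exists>B. \<forall>x\<in>{a..b}. \<bar>m x\<bar> \<le> B" for a b
    using continuous_bounded_Icc[OF continuous_on_subset[OF assms(2)], of a b] by auto
qed

lemma loc_L2_cmult: "loc_L2 f \<Longrightarrow> loc_L2 (\<lambda>x. c * f x)"
  by (rule loc_L2_mult_continuous) auto

lemma loc_L2_diff: "loc_L2 f \<Longrightarrow> loc_L2 g \<Longrightarrow> loc_L2 (\<lambda>x. f x - g x)"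
  using loc_L2_add[of f "\<lambda>x. -1 * g x"] loc_L2_cmult[of g "-1"] by simp

section \<open>Integrals over compact intervals and approximation in L^2\<close>

lemma set_integral_Icc_const: "a \<le> b \<Longrightarrow> (LBINT x:{a..b}. (c::real)) = c * (b - a)"
  unfolding set_lebesgue_integral_def by simp

lemma set_integral_nonneg_real:
  fixes f :: "real \<Rightarrow> real"
  assumes "\<And>x. x \<in> A \<Longrightarrow> 0 \<le> f x" shows "0 \<le> (LBINT x:A. f x)"
  unfolding set_lebesgue_integral_def
  by (rule integral_nonneg_AE) (auto intro!: AE_I2 simp: indicator_def assms)

lemma set_integral_Icc_combine:
  fixes f :: "real \<Rightarrow> real"
  assumes "set_integrable lborel {a..c} f" "a \<le> b" "b \<le> c"
  shows "(LBINT x:{a..c}. f x) = (LBINT x:{a..b}. f x) + (LBINT x:{b..c}. f x)"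
proof -
  have i: "set_integrable lborel {a..b} f" "set_integrable lborel {b..c} f"
    using assms by (auto intro: set_integrable_subset)
  have n: "AE x in lborel. \<not> (x \<in> {a..b} \<and> x \<in> {b..c})"
    using AE_lborel_singleton[of b] by eventually_elim auto
  show ?thesis
    using set_integral_Un_AE[OF n _ _ i] assms by (simp add: ivl_disj_un)
qed

lemma set_integral_mono_subset:
  fixes f :: "real \<Rightarrow> real"
  assumes "set_integrable lborel {a..b} f" "c \<ge> a" "d \<le> b" "\<And>x. 0 \<le> f x"
  shows "(LBINT x:{c..d}. f x) \<le> (LBINT x:{a..b}. f x)"
proof -
  have "set_integrable lborel {c..d} f" using assms by (auto intro: set_integrable_subset)
  then show ?thesis
    using assms unfolding set_integrable_def set_lebesgue_integral_def
    by (intro integral_mono) (auto simp: indicator_def)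
qed

text \<open>The variance of \<open>f\<close> on \<open>[a,b]\<close> is nonnegative.\<close>

lemma set_integral_Cauchy_Schwarz:
  assumes "loc_L2 f" "a \<le> b"
  shows "(LBINT x:{a..b}. f x)\<^sup>2 \<le> (b - a) * (LBINT x:{a..b}. (f x)\<^sup>2)"
proof (cases "a = b")
  case True then show ?thesis by (simp add: set_integral_at_point)
next
  case False
  then have ab: "b - a > 0" using assms by simp
  define I where "I = (LBINT x:{a..b}. f x)"
  define c where "c = I / (b - a)"
  have "0 \<le> (LBINT x:{a..b}. (f x - c)\<^sup>2)" by (intro set_integral_nonneg_real) auto
  also have "\<dots> = (LBINT x:{a..b}. ((f x)\<^sup>2 - (2 * c) * f x) + c\<^sup>2)"
    by (simp add: power2_diff algebra_simps)
  also have "\<dots> = (LBINT x:{a..b}. (f x)\<^sup>2) - 2 * c * I + c\<^sup>2 * (b - a)"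
    using assms by (subst set_integral_add)
      (auto simp: I_def set_integral_Icc_const loc_L2_sq_integrable loc_L2_integrable set_integrable_continuous_UNIV)
  also have "\<dots> = (LBINT x:{a..b}. (f x)\<^sup>2) - I\<^sup>2 / (b - a)"
    using ab by (simp add: c_def power2_eq_square)
  finally show ?thesis using ab by (simp add: field_simps I_def)
qed

lemma set_integral_FTC:
  fixes F f :: "real \<Rightarrow> real"
  assumes "a \<le> b" "\<And>x. a \<le> x \<Longrightarrow> x \<le> b \<Longrightarrow> (F has_real_derivative f x) (at x within {a..b})"
    "continuous_on {a..b} f"
  shows "(LBINT x:{a..b}. f x) = F b - F a"
  unfolding set_lebesgue_integral_def
  by (rule integral_FTC_atLeastAtMost[OF assms(1)])
     (use assms in \<open>auto simp: has_real_derivative_iff_has_vector_derivative\<close>)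

lemma set_integral_dominated_convergence_Icc:
  fixes f :: "nat \<Rightarrow> real \<Rightarrow> real"
  assumes "\<And>n. f n \<in> borel_measurable borel" "g \<in> borel_measurable borel"
    "set_integrable lborel {a..b} w"
    "\<And>n x. x \<in> {a..b} \<Longrightarrow> \<bar>f n x\<bar> \<le> w x"
    "AE x in lborel. x \<in> {a..b} \<longrightarrow> (\<lambda>n. f n x) \<longlonglongrightarrow> g x"
  shows "(\<lambda>n. LBINT x:{a..b}. f n x) \<longlonglongrightarrow> (LBINT x:{a..b}. g x)"
  unfolding set_lebesgue_integral_def
proof (rule integral_dominated_convergence[where w="\<lambda>x. indicator {a..b} x * w x"])
  show "integrable lborel (\<lambda>x. indicator {a..b} x * w x)"
    using assms(3) by (simp add: set_integrable_def)
  show "AE x in lborel. (\<lambda>n. indicator {a..b} x *\<^sub>R f n x) \<longlonglongrightarrow> indicator {a..b} x *\<^sub>R g x"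
    using assms(5) by eventually_elim (auto simp: indicator_def)
qed (use assms in \<open>auto simp: indicator_def\<close>)

text \<open>Truncation reduces the density of continuous functions in \<open>L\<^sup>2\<close> to bounded functions, for
  which almost everywhere approximation by continuous functions suffices.\<close>

lemma L2_approx_bounded:
  fixes f :: "real \<Rightarrow> real"
  assumes f: "f \<in> borel_measurable borel" and B: "\<And>x. \<bar>f x\<bar> \<le> B" and "e > 0"
  shows "\<exists>g. continuous_on UNIV g \<and> (LBINT x:{a..b}. (f x - g x)\<^sup>2) < e"
proof -
  have "f \<in> borel_measurable lebesgue" using f by (simp add: measurable_completion)
  then have "f measurable_on UNIV"
    by (rule lebesgue_measurable_imp_measurable_on_real) simp
  then obtain N h where N: "negligible N" and h: "\<And>n. continuous_on UNIV (h n)"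
    and lim: "\<And>x. x \<notin> N \<Longrightarrow> (\<lambda>n. h n x) \<longlonglongrightarrow> f x"
    unfolding measurable_on_def by auto
  \<comment> \<open>The approximants \<open>h n\<close> may be unbounded. Clamping them to [-B, B]
    supplies a constant majorant and keeps the limit, since f takes values in [-B, B].\<close>
  define g where "g n x = max (-B) (min B (h n x))" for n x
  have gc: "continuous_on UNIV (g n)" for n
    unfolding g_def using h by (intro continuous_intros) auto
  have "B \<ge> 0" using B[of 0] by linarith
  then have gB: "\<bar>g n x\<bar> \<le> B" for n x unfolding g_def by auto
  have glim: "(\<lambda>n. g n x) \<longlonglongrightarrow> f x" if "x \<notin> N" for x
  proof -
    have "(\<lambda>n. g n x) \<longlonglongrightarrow> max (-B) (min B (f x))"
      unfolding g_def by (intro tendsto_intros lim that)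
    then show ?thesis using B[of x] by (simp add: min_def max_def abs_le_iff split: if_splits)
  qed
  have "(\<lambda>n. LBINT x:{a..b}. (f x - g n x)\<^sup>2) \<longlonglongrightarrow> (LBINT x:{a..b}. 0)"
  proof (rule set_integral_dominated_convergence_Icc)
    show "(\<lambda>x. (f x - g n x)\<^sup>2) \<in> borel_measurable borel" for n
      using f borel_measurable_continuous_onI[OF gc] by measurable
    show "set_integrable lborel {a..b} (\<lambda>x. (2 * B)\<^sup>2)"
      by (intro set_integrable_continuous_UNIV continuous_intros)
    show "\<bar>(f x - g n x)\<^sup>2\<bar> \<le> (2 * B)\<^sup>2" for n x
    proof -
      have "\<bar>f x - g n x\<bar> \<le> \<bar>2 * B\<bar>" using B[of x] gB[of n x] by linarith
      then show ?thesis by (simp only: abs_le_square_iff abs_power2)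
    qed
    have "AE x in lebesgue. x \<notin> N" using N negligible_iff_null_sets AE_not_in by blast
    then have "AE x in lborel. x \<notin> N" by (simp add: AE_completion_iff)
    then show "AE x in lborel. x \<in> {a..b} \<longrightarrow> (\<lambda>n. (f x - g n x)\<^sup>2) \<longlonglongrightarrow> 0"
    proof eventually_elim
      case (elim x)
      then have "(\<lambda>n. (f x - g n x)\<^sup>2) \<longlonglongrightarrow> (f x - f x)\<^sup>2" by (intro tendsto_intros glim)
      then show ?case by simp
    qed
  qed simp
  then have "\<forall>\<^sub>F n in sequentially. (LBINT x:{a..b}. (f x - g n x)\<^sup>2) < e"
    using \<open>e > 0\<close> by (intro order_tendstoD) auto
  then show ?thesis using gc by (auto simp: eventually_sequentially)
qed

lemma set_integral_square_add_le:
  assumes "loc_L2 f" "loc_L2 g"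
  shows "(LBINT x:{a..b}. (f x + g x)\<^sup>2) \<le> 2 * (LBINT x:{a..b}. (f x)\<^sup>2) + 2 * (LBINT x:{a..b}. (g x)\<^sup>2)"
proof -
  have "(LBINT x:{a..b}. (f x + g x)\<^sup>2) \<le> (LBINT x:{a..b}. 2 * (f x)\<^sup>2 + 2 * (g x)\<^sup>2)"
  proof (rule set_integral_mono)
    show "(f x + g x)\<^sup>2 \<le> 2 * (f x)\<^sup>2 + 2 * (g x)\<^sup>2" for x
      using sum_squares_bound[of "f x" "g x"] by (simp add: power2_sum)
  qed (use assms in \<open>auto intro!: loc_L2_sq_integrable loc_L2_add set_integral_add\<close>)
  then show ?thesis using assms by (simp add: loc_L2_sq_integrable)
qed

lemma L2_approx:
  assumes f: "loc_L2 f" and "e > 0"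
  shows "\<exists>g. continuous_on UNIV g \<and> (LBINT x:{a..b}. (f x - g x)\<^sup>2) < e"
proof -
  have fm[measurable]: "f \<in> borel_measurable borel" using f by (rule loc_L2_measurable)
  define F where "F n x = max (- real n) (min (real n) (f x))" for n x
  have [measurable]: "F n \<in> borel_measurable borel" for n unfolding F_def by measurable
  have FB: "\<bar>F n x\<bar> \<le> real n" for n x unfolding F_def by auto
  have le: "\<bar>f x - F n x\<bar> \<le> \<bar>f x\<bar>" for n x unfolding F_def by (auto simp: min_def max_def)
  have "(\<lambda>n. LBINT x:{a..b}. (f x - F n x)\<^sup>2) \<longlonglongrightarrow> (LBINT x:{a..b}. 0)"
  proof (rule set_integral_dominated_convergence_Icc)
    show "set_integrable lborel {a..b} (\<lambda>x. (f x)\<^sup>2)" by (rule loc_L2_sq_integrable[OF f])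
    show "\<bar>(f x - F n x)\<^sup>2\<bar> \<le> (f x)\<^sup>2" for n x using le[of x n] by (simp only: abs_le_square_iff abs_power2)
    show "AE x in lborel. x \<in> {a..b} \<longrightarrow> (\<lambda>n. (f x - F n x)\<^sup>2) \<longlonglongrightarrow> 0"
    proof (intro AE_I2 impI)
      fix x
      have "\<forall>\<^sub>F n in sequentially. \<bar>f x\<bar> \<le> real n"
        using eventually_ge_at_top[of "nat \<lceil>\<bar>f x\<bar>\<rceil>"] by eventually_elim linarith
      then have "\<forall>\<^sub>F n in sequentially. (f x - F n x)\<^sup>2 = 0"
        by eventually_elim (auto simp: F_def min_def max_def)
      then show "(\<lambda>n. (f x - F n x)\<^sup>2) \<longlonglongrightarrow> 0" by (rule tendsto_eventually)
    qed
  qed auto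
  \<comment> \<open>A quarter of e for each of the two errors, because the square of a sum costs a
    factor 2: 2 * e/4 + 2 * e/4 = e.\<close>
  then have "\<forall>\<^sub>F n in sequentially. (LBINT x:{a..b}. (f x - F n x)\<^sup>2) < e/4"
    using \<open>e > 0\<close> by (intro order_tendstoD) auto
  then obtain n where n: "(LBINT x:{a..b}. (f x - F n x)\<^sup>2) < e/4"
    by (auto simp: eventually_sequentially)
  obtain g where g: "continuous_on UNIV g" "(LBINT x:{a..b}. (F n x - g x)\<^sup>2) < e/4"
    using L2_approx_bounded[of "F n" "real n" "e/4" a b] FB \<open>e > 0\<close> by auto
  have Fn: "loc_L2 (F n)"
    using loc_L2_mult_bounded[of "\<lambda>_. 1" "F n"] FB by (auto intro: exI[of _ "real n"])
  have "(LBINT x:{a..b}. ((f x - F n x) + (F n x - g x))\<^sup>2) < e"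
    using set_integral_square_add_le[of "\<lambda>x. f x - F n x" "\<lambda>x. F n x - g x" a b] n g
      f Fn loc_L2_continuous[OF g(1)] by (simp add: loc_L2_diff del: diff_add_cancel add_diff_cancel_right' diff_add_cancel)
  then show ?thesis using g(1) by auto
qed

text \<open>This is membership in the local Sobolev space W^{1,2}, stated through the fundamental
  theorem of calculus. The function g is determined only up to null sets, and every rule below is
  proved from the integral identity.\<close>

definition abs_cont :: "(real \<Rightarrow> real) \<Rightarrow> (real \<Rightarrow> real) \<Rightarrow> bool" where
  "abs_cont f g \<longleftrightarrow> loc_L2 g \<and> (\<forall>x y. x \<le> y \<longrightarrow> f y - f x = (LBINT z:{x..y}. g z))"

lemma abs_contD: "abs_cont f g \<Longrightarrow> x \<le> y \<Longrightarrow> f y - f x = (LBINT z:{x..y}. g z)"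
  by (simp add: abs_cont_def)

lemma abs_cont_loc_L2: "abs_cont f g \<Longrightarrow> loc_L2 g"
  by (simp add: abs_cont_def)

lemma abs_cont_add:
  "abs_cont f g \<Longrightarrow> abs_cont f' g' \<Longrightarrow> abs_cont (\<lambda>x. f x + f' x) (\<lambda>x. g x + g' x)"
  unfolding abs_cont_def
  by (intro conjI allI impI loc_L2_add) (simp_all add: loc_L2_integrable add_diff_add)

lemma abs_cont_cmult: "abs_cont f g \<Longrightarrow> abs_cont (\<lambda>x. c * f x) (\<lambda>x. c * g x)"
  unfolding abs_cont_def
  by (auto intro!: loc_L2_cmult simp flip: right_diff_distrib)

lemma abs_cont_const: "abs_cont (\<lambda>x. c) (\<lambda>x. 0)"
  by (auto simp: abs_cont_def)

lemma abs_cont_diff: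
  "abs_cont f g \<Longrightarrow> abs_cont f' g' \<Longrightarrow> abs_cont (\<lambda>x. f x - f' x) (\<lambda>x. g x - g' x)"
  using abs_cont_add[of f g "\<lambda>x. -1 * f' x" "\<lambda>x. -1 * g' x"] abs_cont_cmult[of f' g' "-1"] by simp

lemma abs_cont_C1:
  assumes "\<And>x. (f has_real_derivative f' x) (at x)" "continuous_on UNIV f'"
  shows "abs_cont f f'"
  unfolding abs_cont_def
proof (intro conjI allI impI loc_L2_continuous assms(2) set_integral_FTC[symmetric])
  show "continuous_on {x..y} f'" for x y by (rule continuous_on_subset[OF assms(2)]) simp
qed (use assms(1) in \<open>auto intro: has_field_derivative_at_within\<close>)

text \<open>Cauchy-Schwarz on \<open>{x..y}\<close> gives Hoelder continuity of order 1/2. The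
  integral is enlarged to \<open>{a..b}\<close> so that the constant does not depend on the two
  points.\<close>

lemma abs_cont_Hoelder:
  assumes "abs_cont f g" "x \<in> {a..b}" "y \<in> {a..b}" "x \<le> y"
  shows "(f y - f x)\<^sup>2 \<le> (y - x) * (LBINT z:{a..b}. (g z)\<^sup>2)"
proof -
  have "(f y - f x)\<^sup>2 \<le> (y - x) * (LBINT z:{x..y}. (g z)\<^sup>2)"
    using set_integral_Cauchy_Schwarz[of g x y] assms by (simp add: abs_cont_def)
  also have "\<dots> \<le> (y - x) * (LBINT z:{a..b}. (g z)\<^sup>2)"
    using assms by (intro mult_left_mono set_integral_mono_subset) (auto simp: abs_cont_def loc_L2_sq_integrable)
  finally show ?thesis .
qed

lemma abs_cont_continuous:
  assumes "abs_cont f g" shows "continuous_on S f"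
proof -
  have "isCont f x" for x
  proof -
    define I where "I = (LBINT z:{x-1..x+1}. (g z)\<^sup>2)"
    have le: "\<bar>f y - f x\<bar> \<le> sqrt (\<bar>y - x\<bar> * I)" if "y \<in> {x-1..x+1}" for y
    proof -
      have "(f y - f x)\<^sup>2 \<le> \<bar>y - x\<bar> * I"
        using abs_cont_Hoelder[OF assms, of x "x-1" "x+1" y] abs_cont_Hoelder[OF assms, of y "x-1" "x+1" x] that
        unfolding I_def by (cases "x \<le> y") (auto simp: power2_commute)
      then show ?thesis by (simp add: real_le_rsqrt)
    qed
    have "((\<lambda>y. sqrt (\<bar>y - x\<bar> * I)) \<longlongrightarrow> sqrt (\<bar>x - x\<bar> * I)) (at x)"
      by (intro tendsto_intros)
    then have "((\<lambda>y. sqrt (\<bar>y - x\<bar> * I)) \<longlongrightarrow> 0) (at x)" by simp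
    moreover have "\<forall>\<^sub>F y in at x. norm (f y - f x) \<le> sqrt (\<bar>y - x\<bar> * I)"
      unfolding eventually_at by (rule exI[of _ 1]) (auto intro!: le simp: dist_real_def)
    ultimately have "((\<lambda>y. f y - f x) \<longlongrightarrow> 0) (at x)" by (rule Lim_null_comparison[rotated])
    then show ?thesis by (simp add: isCont_def LIM_zero_iff)
  qed
  then show ?thesis by (simp add: continuous_at_imp_continuous_on)
qed

text \<open>For each x at least one of the two integrals vanishes, so their difference is the signed
  integral from a to x.\<close>

lemma abs_cont_antideriv:
  assumes "loc_L2 g"
  shows "abs_cont (\<lambda>x. (LBINT z:{a..x}. g z) - (LBINT z:{x..a}. g z)) g"
  unfolding abs_cont_def
proof (intro conjI allI impI assms)
  fix x y :: real assume xy: "x \<le> y"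
  have i: "set_integrable lborel {a..b} g" for a b using assms by (rule loc_L2_integrable)
  have e: "(LBINT z:{a..b}. g z) = 0" if "b \<le> a" for a b
    using that by (cases "a = b") (simp_all add: set_integral_at_point, simp add: set_lebesgue_integral_def)
  have c: "(LBINT z:{p..r}. g z) = (LBINT z:{p..q}. g z) + (LBINT z:{q..r}. g z)" if "p \<le> q" "q \<le> r" for p q r
    by (rule set_integral_Icc_combine[OF i that])
  consider "a \<le> x" | "x \<le> a" "a \<le> y" | "y \<le> a" by linarith
  then show "(LBINT z:{a..y}. g z) - (LBINT z:{y..a}. g z) - ((LBINT z:{a..x}. g z) - (LBINT z:{x..a}. g z)) =
     (LBINT z:{x..y}. g z)"
  proof cases
    case 1 then show ?thesis using xy e[of a x] e[of a y] c[of a x y] by simp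
  next
    case 2 then show ?thesis using e[of x a] e[of a y] c[of x a y] by simp
  next
    case 3 then show ?thesis using xy e[of x a] e[of y a] c[of x y a] by simp
  qed
qed

text \<open>Split A_n G_n = A_n g + A_n (G_n - g). Dominated convergence handles the first term, and
  Cauchy-Schwarz with the uniform bound on A_n handles the second.\<close>

lemma set_integral_mult_tendsto:
  assumes g: "loc_L2 g" "\<And>n. loc_L2 (G n)" "(\<lambda>n. LBINT x:{a..b}. (G n x - g x)\<^sup>2) \<longlonglongrightarrow> 0"
    and A: "\<And>n. A n \<in> borel_measurable borel" "A' \<in> borel_measurable borel"
      "\<And>n x. \<bar>A n x\<bar> \<le> B" "\<And>x. x \<in> {a..b} \<Longrightarrow> (\<lambda>n. A n x) \<longlonglongrightarrow> A' x"
    and ab: "a \<le> b"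
  shows "(\<lambda>n. LBINT x:{a..b}. A n x * G n x) \<longlonglongrightarrow> (LBINT x:{a..b}. A' x * g x)"
proof -
  have LA: "loc_L2 (\<lambda>x. A n x * h x)" if "loc_L2 h" for n h
    using A(1,3) by (intro loc_L2_mult_bounded that) auto
  have [simp]: "set_integrable lborel {a..b} (\<lambda>x. A n x * h x)" if "loc_L2 h" for n h
    using LA[OF that] by (rule loc_L2_integrable)
  have d: "loc_L2 (\<lambda>x. G n x - g x)" for n by (intro loc_L2_diff g)
  have 1: "(\<lambda>n. LBINT x:{a..b}. A n x * g x) \<longlonglongrightarrow> (LBINT x:{a..b}. A' x * g x)"
  proof (rule set_integral_dominated_convergence_Icc)
    show "set_integrable lborel {a..b} (\<lambda>x. B * \<bar>g x\<bar>)"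
      by (intro set_integrable_mult_right set_integrable_abs loc_L2_integrable g)
    show "\<bar>A n x * g x\<bar> \<le> B * \<bar>g x\<bar>" for n x
      using A(3) by (simp add: abs_mult mult_right_mono)
    show "AE x in lborel. x \<in> {a..b} \<longrightarrow> (\<lambda>n. A n x * g x) \<longlonglongrightarrow> A' x * g x"
      by (intro AE_I2 impI tendsto_intros A)
  qed (use A g(1) loc_L2_measurable in measurable)
  have "(\<lambda>n. LBINT x:{a..b}. A n x * (G n x - g x)) \<longlonglongrightarrow> 0"
  proof (rule Lim_null_comparison)
    show "\<forall>\<^sub>F n in sequentially. norm (LBINT x:{a..b}. A n x * (G n x - g x))
       \<le> sqrt ((b - a) * (B\<^sup>2 * (LBINT x:{a..b}. (G n x - g x)\<^sup>2)))"
    proof (intro always_eventually allI)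
      fix n
      have "(LBINT x:{a..b}. A n x * (G n x - g x))\<^sup>2 \<le> (b - a) * (LBINT x:{a..b}. (A n x * (G n x - g x))\<^sup>2)"
        by (rule set_integral_Cauchy_Schwarz[OF LA[OF d] ab])
      also have "\<dots> \<le> (b - a) * (LBINT x:{a..b}. B\<^sup>2 * (G n x - g x)\<^sup>2)"
      proof (intro mult_left_mono set_integral_mono)
        show "(A n x * (G n x - g x))\<^sup>2 \<le> B\<^sup>2 * (G n x - g x)\<^sup>2" for x
        proof -
          have "\<bar>A n x\<bar>\<^sup>2 \<le> B\<^sup>2" using A(3) by (intro power_mono) auto
          then show ?thesis by (simp add: power_mult_distrib mult_right_mono)
        qed
      qed (use ab d LA[OF d] in \<open>auto intro!: loc_L2_sq_integrable set_integrable_mult_right\<close>)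
      finally show "norm (LBINT x:{a..b}. A n x * (G n x - g x))
         \<le> sqrt ((b - a) * (B\<^sup>2 * (LBINT x:{a..b}. (G n x - g x)\<^sup>2)))"
        by (simp add: real_le_rsqrt)
    qed
    have "(\<lambda>n. sqrt ((b - a) * (B\<^sup>2 * (LBINT x:{a..b}. (G n x - g x)\<^sup>2)))) \<longlonglongrightarrow> sqrt ((b - a) * (B\<^sup>2 * 0))"
      by (intro tendsto_intros g)
    then show "(\<lambda>n. sqrt ((b - a) * (B\<^sup>2 * (LBINT x:{a..b}. (G n x - g x)\<^sup>2)))) \<longlonglongrightarrow> 0" by simp
  qed
  from tendsto_add[OF 1 this]
  have "(\<lambda>n. (LBINT x:{a..b}. A n x * g x) + (LBINT x:{a..b}. A n x * (G n x - g x)))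
    \<longlonglongrightarrow> (LBINT x:{a..b}. A' x * g x)" by simp
  moreover have "(LBINT x:{a..b}. A n x * g x) + (LBINT x:{a..b}. A n x * (G n x - g x))
     = (LBINT x:{a..b}. A n x * G n x)" for n
  proof -
    have "A n x * g x + A n x * (G n x - g x) = A n x * G n x" for x by (simp add: right_diff_distrib)
    then show ?thesis
      using set_integral_add(2)[of lborel "{a..b}" "\<lambda>x. A n x * g x" "\<lambda>x. A n x * (G n x - g x)"] g d by simp
  qed
  ultimately show ?thesis by simp
qed

lemma abs_cont_has_derivative:
  assumes "abs_cont f g" "continuous_on UNIV g"
  shows "(f has_real_derivative g x) (at x)"
proof -
  have gc: "continuous_on A g" for A by (rule continuous_on_subset[OF assms(2)]) simp
  have "((\<lambda>z. integral {x-1..z} g) has_real_derivative g x) (at x within {x-1..x+1})"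
    by (rule integral_has_real_derivative) (auto intro: gc)
  then have d: "((\<lambda>z. f (x-1) + integral {x-1..z} g) has_real_derivative g x) (at x within {x-1..x+1})"
    by (auto intro!: derivative_eq_intros)
  have eq: "f z = f (x-1) + integral {x-1..z} g" if "z \<in> {x-1..x+1}" for z
  proof -
    have "integral {x-1..z} g = (LBINT y:{x-1..z}. g y)"
      by (rule set_borel_integral_eq_integral(2)[symmetric]) (rule set_integrable_continuous_UNIV[OF assms(2)])
    also have "\<dots> = f z - f (x-1)" using abs_contD[OF assms(1), of "x-1" z] that by simp
    finally show ?thesis by simp
  qed
  have "(f has_real_derivative g x) (at x within {x-1..x+1})"
    by (rule has_field_derivative_transform_within[OF d zero_less_one _ eq[symmetric]]) auto
  then show ?thesis
    by (subst (asm) at_within_interior) auto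
qed

text \<open>Approximate g in L^2 by continuous functions. Their antiderivatives are C^1, so the
  classical chain rule applies to them, and both sides pass to the limit. The approximating
  antiderivatives must stay in D, which compactness of the image of f secures.\<close>

lemma abs_cont_chain:
  assumes fg: "abs_cont f g" and "open D" and f: "\<And>x. f x \<in> D"
    and der: "\<And>z. z \<in> D \<Longrightarrow> (\<Psi> has_real_derivative \<Psi>' z) (at z)"
    and cont: "continuous_on D \<Psi>'"
  shows "abs_cont (\<lambda>x. \<Psi> (f x)) (\<lambda>x. \<Psi>' (f x) * g x)"
  unfolding abs_cont_def
proof (intro conjI allI impI)
  have g: "loc_L2 g" using fg by (rule abs_cont_loc_L2)
  have fc: "continuous_on S f" for S by (rule abs_cont_continuous[OF fg])
  show "loc_L2 (\<lambda>x. \<Psi>' (f x) * g x)"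
    by (intro loc_L2_mult_continuous g continuous_on_compose2[OF cont fc]) (use f in auto)
  fix x y :: real assume xy: "x \<le> y"
  have "compact (f ` {x..y})" by (intro compact_continuous_image fc) auto
  moreover have "f ` {x..y} \<subseteq> D" using f by auto
  ultimately obtain e where e: "e > 0" "(\<Union>z\<in>f ` {x..y}. cball z e) \<subseteq> D"
    using compact_subset_open_imp_cball_epsilon_subset[of "f ` {x..y}" D] \<open>open D\<close> by blast
  \<comment> \<open>The closed e-neighbourhood of the image of f, written as a sum of compact sets
    and hence compact; \<open>\<Psi>'\<close> is bounded on it.\<close>
  define K where "K = {w + d |w d. w \<in> f ` {x..y} \<and> d \<in> cball 0 e}"
  have "compact K" unfolding K_def using \<open>compact (f ` {x..y})\<close> by (intro compact_sums) auto
  have "K \<subseteq> D"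
    using e(2) by (fastforce simp: K_def dist_real_def)
  have inK: "w \<in> K" if "\<bar>w - f z\<bar> \<le> e" "z \<in> {x..y}" for w z
    unfolding K_def using that by (intro CollectI exI[of _ "f z"] exI[of _ "w - f z"]) auto
  have "bounded (\<Psi>' ` K)"
    by (intro compact_imp_bounded compact_continuous_image \<open>compact K\<close> continuous_on_subset[OF cont \<open>K \<subseteq> D\<close>])
  then obtain B where B: "\<And>w. w \<in> K \<Longrightarrow> \<bar>\<Psi>' w\<bar> \<le> B" unfolding bounded_iff by auto
  \<comment> \<open>By the Hoelder estimate the antiderivatives deviate from f by at most the root
    of (y - x) * \<open>\<delta> n\<close>. This choice keeps that below e for every n and tends to
    zero; the added 1 covers x = y.\<close>
  define \<delta> where "\<delta> n = e\<^sup>2 / ((y - x + 1) * (real n + 1))" for n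
  have \<delta>: "\<delta> n > 0" for n unfolding \<delta>_def using e xy by (intro divide_pos_pos mult_pos_pos) auto
  have "\<exists>G. continuous_on UNIV G \<and> (LBINT z:{x..y}. (g z - G z)\<^sup>2) < \<delta> n" for n
    by (rule L2_approx[OF g \<delta>])
  then obtain G where G: "\<And>n. continuous_on UNIV (G n)" "\<And>n. (LBINT z:{x..y}. (g z - G n z)\<^sup>2) < \<delta> n"
    by metis
  define F where "F n z = f x + ((LBINT w:{x..z}. G n w) - (LBINT w:{z..x}. G n w))" for n z
  have FG: "abs_cont (F n) (G n)" for n
    unfolding F_def using abs_cont_add[OF abs_cont_const abs_cont_antideriv[OF loc_L2_continuous[OF G(1)]], of "f x" x n]
    by simp
  have [simp]: "F n x = f x" for n unfolding F_def by simp
  have \<delta>0: "\<delta> \<longlonglongrightarrow> 0"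
  proof -
    have "(\<lambda>n. (e\<^sup>2 / (y - x + 1)) * inverse (real (Suc n))) \<longlonglongrightarrow> (e\<^sup>2 / (y - x + 1)) * 0"
      by (intro tendsto_mult tendsto_const LIMSEQ_inverse_real_of_nat)
    then show ?thesis unfolding \<delta>_def by (simp add: field_simps)
  qed
  have dist: "(F n z - f z)\<^sup>2 \<le> (y - x) * \<delta> n" if "z \<in> {x..y}" for n z
  proof -
    have "(F n z - f z - (F n x - f x))\<^sup>2 \<le> (z - x) * (LBINT z:{x..y}. (G n z - g z)\<^sup>2)"
      using that xy by (intro abs_cont_Hoelder abs_cont_diff FG fg) auto
    also have "\<dots> \<le> (y - x) * \<delta> n"
      using G(2)[of n] \<delta>[of n] that by (intro mult_mono) (auto simp: power2_commute intro!: set_integral_nonneg_real)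
    finally show ?thesis by simp
  qed
  have near: "\<bar>F n z - f z\<bar> \<le> e" if "z \<in> {x..y}" for n z
  proof -
    have "(y - x) * \<delta> n \<le> e\<^sup>2"
    proof -
      have "(y - x) * e\<^sup>2 \<le> e\<^sup>2 * ((y - x + 1) * (real n + 1))"
      proof -
        have "(y - x) * 1 \<le> (y - x + 1) * (real n + 1)" using xy by (intro mult_mono) auto
        then show ?thesis using mult_left_mono[of _ _ "e\<^sup>2"] by (metis mult.commute mult.right_neutral zero_le_power2)
      qed
      moreover have "(y - x + 1) * (real n + 1) > 0" using xy by (intro mult_pos_pos) auto
      ultimately show ?thesis unfolding \<delta>_def by (simp add: pos_divide_le_eq)
    qed
    with dist[OF that, of n] have "(F n z - f z)\<^sup>2 \<le> e\<^sup>2" by simp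
    then show ?thesis using e(1) by (metis abs_le_square_iff abs_of_pos)
  qed
  have lim: "(\<lambda>n. F n z) \<longlonglongrightarrow> f z" if "z \<in> {x..y}" for z
  proof -
    have "(\<lambda>n. F n z - f z) \<longlonglongrightarrow> 0"
    proof (rule Lim_null_comparison)
      show "\<forall>\<^sub>F n in sequentially. norm (F n z - f z) \<le> sqrt ((y - x) * \<delta> n)"
        using dist[OF that] by (intro always_eventually allI) (simp add: real_le_rsqrt)
      have "(\<lambda>n. sqrt ((y - x) * \<delta> n)) \<longlonglongrightarrow> sqrt ((y - x) * 0)" by (intro tendsto_intros \<delta>0)
      then show "(\<lambda>n. sqrt ((y - x) * \<delta> n)) \<longlonglongrightarrow> 0" by simp
    qed
    then show ?thesis by (simp add: LIM_zero_iff)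
  qed
  \<comment> \<open>Projection onto \<open>{x..y}\<close>. The convergence lemma asks for bounds and
    measurability on the whole line, while the approximants are controlled only on the
    interval.\<close>
  define c where "c z = max x (min y z)" for z
  have cc: "continuous_on UNIV c" unfolding c_def by (intro continuous_intros)
  have c: "c z \<in> {x..y}" for z unfolding c_def using xy by auto
  have cid: "c z = z" if "z \<in> {x..y}" for z using that unfolding c_def by auto
  have FK: "F n z \<in> K" if "z \<in> {x..y}" for n z using inK[OF near[OF that] that] .
  have FD: "F n z \<in> D" if "z \<in> {x..y}" for n z using FK[OF that] \<open>K \<subseteq> D\<close> by auto
  have Fc: "continuous_on S (F n)" for S n by (rule abs_cont_continuous[OF FG])
  have isc: "isCont \<Psi>' (f z)" for z using cont \<open>open D\<close> f continuous_on_eq_continuous_at by blast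
  have "(\<lambda>n. LBINT z:{x..y}. \<Psi>' (F n (c z)) * G n z) \<longlonglongrightarrow> (LBINT z:{x..y}. \<Psi>' (f (c z)) * g z)"
  proof (rule set_integral_mult_tendsto)
    show "loc_L2 (G n)" for n by (rule loc_L2_continuous[OF G(1)])
    show "(\<lambda>n. LBINT z:{x..y}. (G n z - g z)\<^sup>2) \<longlonglongrightarrow> 0"
    proof (rule Lim_null_comparison[OF _ \<delta>0])
      show "\<forall>\<^sub>F n in sequentially. norm (LBINT z:{x..y}. (G n z - g z)\<^sup>2) \<le> \<delta> n"
        using G(2) by (intro always_eventually allI)
          (auto simp: power2_commute abs_of_nonneg set_integral_nonneg_real intro: less_imp_le)
    qed
    show "(\<lambda>z. \<Psi>' (F n (c z))) \<in> borel_measurable borel" for n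
      using FD c by (intro borel_measurable_continuous_onI continuous_on_compose2[OF cont]
        continuous_on_compose2[OF Fc cc]) auto
    show "(\<lambda>z. \<Psi>' (f (c z))) \<in> borel_measurable borel"
      using f by (intro borel_measurable_continuous_onI continuous_on_compose2[OF cont]
        continuous_on_compose2[OF fc cc]) auto
    show "\<bar>\<Psi>' (F n (c z))\<bar> \<le> B" for n z using B[OF FK[OF c]] .
    show "(\<lambda>n. \<Psi>' (F n (c z))) \<longlonglongrightarrow> \<Psi>' (f (c z))" for z
      by (rule isCont_tendsto_compose[OF isc lim[OF c]])
  qed (use g xy in auto)
  moreover have "(LBINT z:{x..y}. \<Psi>' (f (c z)) * g z) = (LBINT z:{x..y}. \<Psi>' (f z) * g z)"
    by (rule set_lebesgue_integral_cong) (auto simp: cid)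
  moreover have "(LBINT z:{x..y}. \<Psi>' (F n (c z)) * G n z) = \<Psi> (F n y) - \<Psi> (f x)" for n
  proof -
    have "(LBINT z:{x..y}. \<Psi>' (F n (c z)) * G n z) = (LBINT z:{x..y}. \<Psi>' (F n z) * G n z)"
      by (rule set_lebesgue_integral_cong) (auto simp: cid)
    also have "\<dots> = \<Psi> (F n y) - \<Psi> (F n x)"
    proof (rule set_integral_FTC[OF xy])
      show "((\<lambda>z. \<Psi> (F n z)) has_real_derivative \<Psi>' (F n z) * G n z) (at z within {x..y})"
        if "x \<le> z" "z \<le> y" for z
        by (rule DERIV_chain2[OF der[OF FD] has_field_derivative_at_within[OF abs_cont_has_derivative[OF FG G(1)]]])
          (use that in auto)
      show "continuous_on {x..y} (\<lambda>z. \<Psi>' (F n z) * G n z)"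
      proof (rule continuous_on_mult)
        show "continuous_on {x..y} (G n)" by (rule continuous_on_subset[OF G(1)]) simp
        show "continuous_on {x..y} (\<lambda>z. \<Psi>' (F n z))"
          by (rule continuous_on_compose2[OF cont Fc]) (use FD in auto)
      qed
    qed
    finally show ?thesis by simp
  qed
  moreover have "(\<lambda>n. \<Psi> (F n y) - \<Psi> (f x)) \<longlonglongrightarrow> \<Psi> (f y) - \<Psi> (f x)"
    by (rule tendsto_diff[OF isCont_tendsto_compose[OF DERIV_isCont[OF der[OF f]] lim] tendsto_const]) (use xy in auto)
  ultimately show "\<Psi> (f y) - \<Psi> (f x) = (LBINT z:{x..y}. \<Psi>' (f z) * g z)"
    using LIMSEQ_unique by auto
qed

text \<open>Polarization reduces products to squares.\<close>

lemma abs_cont_mult: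
  assumes "abs_cont f f'" "abs_cont g g'"
  shows "abs_cont (\<lambda>x. f x * g x) (\<lambda>x. f' x * g x + f x * g' x)"
proof -
  have sq: "abs_cont (\<lambda>x. (h x)\<^sup>2) (\<lambda>x. 2 * h x * h' x)" if "abs_cont h h'" for h h'
    using that by (rule abs_cont_chain[where D=UNIV and \<Psi>="\<lambda>z. z\<^sup>2" and \<Psi>'="\<lambda>z. 2 * z"])
      (auto intro!: derivative_eq_intros continuous_intros)
  have "abs_cont (\<lambda>x. 1/4 * ((f x + g x)\<^sup>2 - (f x - g x)\<^sup>2))
    (\<lambda>x. 1/4 * (2 * (f x + g x) * (f' x + g' x) - 2 * (f x - g x) * (f' x - g' x)))"
    by (intro abs_cont_cmult abs_cont_diff[OF sq sq] abs_cont_add abs_cont_diff assms)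
  then show ?thesis
    by (simp add: power2_sum power2_diff algebra_simps)
qed

lemma abs_cont_inverse:
  assumes "abs_cont f g" "\<And>x. f x > 0"
  shows "abs_cont (\<lambda>x. inverse (f x)) (\<lambda>x. - g x * (inverse (f x))\<^sup>2)"
proof -
  have "abs_cont (\<lambda>x. inverse (f x)) (\<lambda>x. - (inverse (f x) ^ 2) * g x)"
    using assms by (intro abs_cont_chain[where D="{0<..}"])
      (auto intro!: derivative_eq_intros continuous_intros simp: power2_eq_square)
  then show ?thesis by (simp add: mult.commute)
qed

lemma abs_cont_integral_by_parts:
  assumes "abs_cont f f'" "abs_cont g g'" "a \<le> b"
  shows "(LBINT x:{a..b}. f x * g' x) = f b * g b - f a * g a - (LBINT x:{a..b}. f' x * g x)"
proof -
  have L: "loc_L2 f" "loc_L2 g" "loc_L2 f'" "loc_L2 g'"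
    using assms by (auto intro: loc_L2_continuous abs_cont_continuous abs_cont_loc_L2)
  have "f b * g b - f a * g a = (LBINT x:{a..b}. f' x * g x + f x * g' x)"
    using abs_contD[OF abs_cont_mult[OF assms(1,2)] assms(3)] .
  also have "\<dots> = (LBINT x:{a..b}. f' x * g x) + (LBINT x:{a..b}. f x * g' x)"
    using L by (intro set_integral_add(2) loc_L2_mult_integrable)
  finally show ?thesis by simp
qed

text \<open>Where M X' is at least 1, dx is at most M X' dx, and substitution does the rest.
  Continuity provides such an M on each compact interval. The second claim keeps M explicit so that
  it can be uniform over a family of maps X.\<close>

lemma loc_L2_compose:
  assumes g: "loc_L2 g" and X: "\<And>x. (X has_real_derivative X' x) (at x)" "\<And>x. X' x > 0" "continuous_on UNIV X'"
  shows "loc_L2 (\<lambda>x. g (X x))"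
    and "a \<le> b \<Longrightarrow> (\<And>x. x \<in> {a..b} \<Longrightarrow> 1 \<le> M * X' x) \<Longrightarrow> {X a..X b} \<subseteq> {c..d} \<Longrightarrow>
      (LBINT x:{a..b}. (g (X x))\<^sup>2) \<le> M * (LBINT x:{c..d}. (g x)\<^sup>2)"
proof -
  have Xc: "continuous_on UNIV X" using X(1) by (auto intro!: continuous_at_imp_continuous_on DERIV_isCont)
  have m: "(\<lambda>x. g (X x)) \<in> borel_measurable borel"
    using loc_L2_measurable[OF g] borel_measurable_continuous_onI[OF Xc] by measurable
  note sub = integral_substitution[OF loc_L2_sq_integrable[OF g] X(1) continuous_on_subset[OF X(3)] less_imp_le[OF X(2)]]
  show L: "loc_L2 (\<lambda>x. g (X x))"
    unfolding loc_L2_def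
  proof (intro conjI allI m)
    fix a b
    show "set_integrable lborel {a..b} (\<lambda>x. (g (X x))\<^sup>2)"
    proof (cases "a \<le> b")
      case True
      have X'0: "X' x \<noteq> 0" for x using X(2)[of x] by simp
      have "continuous_on UNIV (\<lambda>x. inverse (X' x))"
        by (rule continuous_on_inverse[OF X(3)]) (simp add: X'0)
      then have "continuous_on {a..b} (\<lambda>x. inverse (X' x))" by (rule continuous_on_subset) simp
      from continuous_bounded_Icc[OF this] obtain B where B: "\<forall>x\<in>{a..b}. \<bar>inverse (X' x)\<bar> \<le> B" by metis
      show ?thesis
      proof (rule set_integrable_le)
        show "set_integrable lborel {a..b} (\<lambda>x. B * ((g (X x))\<^sup>2 * X' x))"
          using sub(1)[OF subset_UNIV True] by simp
        fix x assume "x \<in> {a..b}"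
        then have "1 \<le> B * X' x" using B X(2)[of x] by (auto simp: inverse_eq_divide pos_divide_le_eq dest!: bspec[of _ _ x])
        then have "1 * (g (X x))\<^sup>2 \<le> (B * X' x) * (g (X x))\<^sup>2" by (intro mult_right_mono) auto
        then show "\<bar>(g (X x))\<^sup>2\<bar> \<le> B * ((g (X x))\<^sup>2 * X' x)" by (simp add: mult_ac)
      qed (use m in measurable)
    qed simp
  qed
  assume ab: "a \<le> b" and M: "\<And>x. x \<in> {a..b} \<Longrightarrow> 1 \<le> M * X' x" and cd: "{X a..X b} \<subseteq> {c..d}"
  have "1 \<le> M * X' a" using M ab by auto
  then have M0: "M > 0" using X(2)[of a] by (smt (verit) mult_nonpos_nonneg)
  have Xab: "X a \<le> X b" using DERIV_pos_imp_increasing[of a b X] X ab by (cases "a = b") (auto intro: less_imp_le)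
  have "(LBINT x:{a..b}. (g (X x))\<^sup>2) \<le> (LBINT x:{a..b}. M * ((g (X x))\<^sup>2 * X' x))"
  proof (rule set_integral_mono)
    show "set_integrable lborel {a..b} (\<lambda>x. M * ((g (X x))\<^sup>2 * X' x))"
      using sub(1)[OF subset_UNIV ab] by simp
    fix x assume "x \<in> {a..b}"
    then have "1 * (g (X x))\<^sup>2 \<le> (M * X' x) * (g (X x))\<^sup>2" by (intro mult_right_mono M) auto
    then show "(g (X x))\<^sup>2 \<le> M * ((g (X x))\<^sup>2 * X' x)" by (simp add: mult_ac)
  qed (rule loc_L2_sq_integrable[OF L])
  also have "\<dots> = M * (LBINT x:{X a..X b}. (g x)\<^sup>2)"
    using sub(2)[OF subset_UNIV ab] by (simp add: set_lebesgue_integral_def mult_ac)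
  also have "\<dots> \<le> M * (LBINT x:{c..d}. (g x)\<^sup>2)"
    using cd M0 Xab by (intro mult_left_mono set_integral_mono_subset loc_L2_sq_integrable g) auto
  finally show "(LBINT x:{a..b}. (g (X x))\<^sup>2) \<le> M * (LBINT x:{c..d}. (g x)\<^sup>2)" .
qed

lemma abs_cont_compose:
  assumes fg: "abs_cont f g" and X: "\<And>x. (X has_real_derivative X' x) (at x)" "\<And>x. X' x > 0" "continuous_on UNIV X'"
  shows "abs_cont (\<lambda>x. f (X x)) (\<lambda>x. g (X x) * X' x)"
  unfolding abs_cont_def
proof (intro conjI allI impI)
  have g: "loc_L2 g" using fg by (rule abs_cont_loc_L2)
  show "loc_L2 (\<lambda>x. g (X x) * X' x)"
    using loc_L2_mult_continuous[OF loc_L2_compose(1)[OF g X] X(3)] by (simp add: mult.commute)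
  fix x y :: real assume xy: "x \<le> y"
  have "X x \<le> X y" using DERIV_pos_imp_increasing[of x y X] X xy by (cases "x = y") (auto intro: less_imp_le)
  then have "f (X y) - f (X x) = (LBINT z:{X x..X y}. g z)" by (rule abs_contD[OF fg])
  also have "\<dots> = (LBINT z:{x..y}. g (X z) * X' z)"
    using integral_substitution(2)[OF loc_L2_integrable[OF g] X(1) continuous_on_subset[OF X(3) subset_UNIV] less_imp_le[OF X(2)] xy]
    by (simp add: set_lebesgue_integral_def mult_ac)
  finally show "f (X y) - f (X x) = (LBINT z:{x..y}. g (X z) * X' z)" .
qed

section \<open>Weak derivatives of periodic functions\<close>

lemma periodic_plus_int:
  fixes f :: "real \<Rightarrow> real"
  assumes "periodic_fun_simple' f" shows "f (x + of_int n) = f x"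
proof -
  interpret periodic_fun_simple' f by fact
  show ?thesis by (rule plus_of_int)
qed

lemma periodicI: "(\<And>x. f (x + 1) = f x) \<Longrightarrow> periodic_fun_simple' f"
  by unfold_locales

lemma periodicD: "periodic_fun_simple' f \<Longrightarrow> f (x + 1) = f x"
  by (rule periodic_fun_simple'.plus_period)

lemma periodic_diff:
  fixes f g :: "real \<Rightarrow> real"
  shows "periodic_fun_simple' f \<Longrightarrow> periodic_fun_simple' g \<Longrightarrow> periodic_fun_simple' (\<lambda>x. f x - g x)"
  by (simp add: periodic_fun_simple'_def)

lemma periodic_frac: "periodic_fun_simple' f \<Longrightarrow> f (frac x) = f x" for f :: "real \<Rightarrow> real"
  using periodic_plus_int[of f "frac x" "\<lfloor>x\<rfloor>"] by (simp add: frac_def)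

text \<open>Periodicity carries integrability from \<open>{0..1}\<close> to each unit interval with
  integer endpoints, and finitely many of these cover \<open>{a..b}\<close>.\<close>

lemma square_integrable_loc_L2:
  assumes "square_integrable f" shows "loc_L2 f"
  unfolding loc_L2_def
proof (intro conjI allI)
  have per: "periodic_fun_simple' f" and m: "f \<in> borel_measurable borel"
    and i: "set_integrable lborel {0..1} (\<lambda>x. (f x)\<^sup>2)"
    using assms by (auto simp: square_integrable_def)
  show "f \<in> borel_measurable borel" by fact
  have shift: "set_integrable lborel {of_int n..of_int n + 1} (\<lambda>x. (f x)\<^sup>2)" for n
  proof -
    have "set_integrable lborel {of_int n..of_int n + 1} (\<lambda>x. (f (x - of_int n))\<^sup>2 * 1)"
      by (rule integral_substitution(1)[where g="\<lambda>x. x - of_int n"])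
         (use i in \<open>auto intro!: derivative_eq_intros\<close>)
    moreover have "f (x - of_int n) = f x" for x
      using periodic_plus_int[OF per, of x "-n"] by simp
    ultimately show ?thesis by simp
  qed
  fix a b :: real
  have U: "set_integrable lborel (\<Union>n\<in>{\<lfloor>a\<rfloor>..\<lfloor>b\<rfloor>}. {of_int n..of_int n + 1}) (\<lambda>x. (f x)\<^sup>2)"
    by (rule set_integrable_UN) (auto intro: shift)
  have sub: "{a..b} \<subseteq> (\<Union>n\<in>{\<lfloor>a\<rfloor>..\<lfloor>b\<rfloor>}. {of_int n..of_int n + 1})"
  proof
    fix x assume "x \<in> {a..b}"
    then have "\<lfloor>x\<rfloor> \<in> {\<lfloor>a\<rfloor>..\<lfloor>b\<rfloor>}" by (auto intro: floor_mono)
    moreover have "x \<in> {of_int \<lfloor>x\<rfloor>..of_int \<lfloor>x\<rfloor> + 1}"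
      using of_int_floor_le[of x] real_of_int_floor_add_one_ge[of x] by simp
    ultimately show "x \<in> (\<Union>n\<in>{\<lfloor>a\<rfloor>..\<lfloor>b\<rfloor>}. {of_int n..of_int n + 1})" by blast
  qed
  show "set_integrable lborel {a..b} (\<lambda>x. (f x)\<^sup>2)"
    by (rule set_integrable_subset[OF U _ sub]) simp
qed

lemma set_integral_shift:
  fixes f :: "real \<Rightarrow> real"
  assumes "periodic_fun_simple' f" "\<And>a b. set_integrable lborel {a..b} f"
  shows "(LBINT x:{a+1..b+1}. f x) = (LBINT x:{a..b}. f x)"
proof (cases "a \<le> b")
  case True
  have "(LBINT x. f x * indicator {a+1..b+1} x) = (LBINT x. f (x + 1) * 1 * indicator {a..b} x)"
    by (rule integral_substitution(2)[where g="\<lambda>x. x + 1"])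
       (use True assms(2) in \<open>auto intro!: derivative_eq_intros\<close>)
  then show ?thesis
    using periodicD[OF assms(1)] by (simp add: set_lebesgue_integral_def mult.commute)
qed (simp add: set_lebesgue_integral_def)

lemma abs_cont_periodic:
  assumes "abs_cont F f" "periodic_fun_simple' f" "(LBINT x:{0..1}. f x) = 0"
  shows "periodic_fun_simple' F"
proof (rule periodicI)
  have L: "loc_L2 f" by (rule abs_cont_loc_L2[OF assms(1)])
  have le: "F (y + 1) - F (x + 1) = F y - F x" if "x \<le> y" for x y
    using abs_contD[OF assms(1), of x y] abs_contD[OF assms(1), of "x+1" "y+1"] that
      set_integral_shift[OF assms(2) loc_L2_integrable[OF L], of x y] by simp
  have F1: "F 1 = F 0" using abs_contD[OF assms(1), of 0 1] assms(3) by simp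
  fix x
  show "F (x + 1) = F x" using le[of 0 x] le[of x 0] F1 by (cases "0 \<le> x") auto
qed

lemma set_integral_period:
  fixes f :: "real \<Rightarrow> real"
  assumes per: "periodic_fun_simple' f" and i: "\<And>a b. set_integrable lborel {a..b} f"
  shows "(LBINT z:{x..x+1}. f z) = (LBINT z:{0..1}. f z)"
proof -
  define S where "S y = (LBINT z:{y..y+1}. f z)" for y
  note shift = set_integral_shift[OF per i]
  define n where "n = \<lfloor>x\<rfloor>"
  have int: "S (of_int m) = S 0" for m
  proof (induction m rule: int_induct[where k=0])
    case (step1 i) then show ?case using shift[of "of_int i" "of_int i + 1"] by (simp add: S_def add.assoc)
  next
    case (step2 i) then show ?case using shift[of "of_int i - 1" "of_int i"] by (simp add: S_def)
  qed simp
  have n: "of_int n \<le> x" "x \<le> of_int n + 1" unfolding n_def by linarith+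
  have "S x = (LBINT z:{x..of_int n + 1}. f z) + (LBINT z:{of_int n + 1..x + 1}. f z)"
    unfolding S_def using n by (intro set_integral_Icc_combine i) auto
  also have "\<dots> = S (of_int n)"
    using shift[of "of_int n" x] set_integral_Icc_combine[OF i, of "of_int n" x "of_int n + 1"] n by (simp add: S_def)
  finally show ?thesis using int by (simp add: S_def)
qed

text \<open>The algebra generated by the two first harmonics. Closure under differentiation follows
  by induction, so every member is a test function, and the algebra is large enough for
  Stone-Weierstrass on the circle.\<close>

inductive trig :: "(real \<Rightarrow> real) \<Rightarrow> bool" where
  trig_const: "trig (\<lambda>x. c)"
| trig_cos: "trig (\<lambda>x. cos (2 * pi * x))"
| trig_sin: "trig (\<lambda>x. sin (2 * pi * x))"
| trig_add: "trig f \<Longrightarrow> trig g \<Longrightarrow> trig (\<lambda>x. f x + g x)"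
| trig_mult: "trig f \<Longrightarrow> trig g \<Longrightarrow> trig (\<lambda>x. f x * g x)"

lemma trig_has_derivative: "trig f \<Longrightarrow> \<exists>f'. trig f' \<and> (\<forall>x. (f has_real_derivative f' x) (at x))"
proof (induction rule: trig.induct)
  case (trig_const c)
  then show ?case by (intro exI[of _ "\<lambda>_. 0"]) (auto intro: trig.intros)
next
  case trig_cos
  have "trig (\<lambda>x. (-2 * pi) * sin (2 * pi * x))" by (intro trig.intros)
  then show ?case
    by (intro exI[of _ "\<lambda>x. (-2 * pi) * sin (2 * pi * x)"]) (auto intro!: derivative_eq_intros)
next
  case trig_sin
  have "trig (\<lambda>x. (2 * pi) * cos (2 * pi * x))" by (intro trig.intros)
  then show ?case
    by (intro exI[of _ "\<lambda>x. (2 * pi) * cos (2 * pi * x)"]) (auto intro!: derivative_eq_intros)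
next
  case (trig_add f g)
  then obtain f' g' where "trig f'" "\<forall>x. (f has_real_derivative f' x) (at x)"
    "trig g'" "\<forall>x. (g has_real_derivative g' x) (at x)" by auto
  then show ?case by (intro exI[of _ "\<lambda>x. f' x + g' x"]) (auto intro!: trig.intros derivative_eq_intros)
next
  case (trig_mult f g)
  then obtain f' g' where "trig f'" "\<forall>x. (f has_real_derivative f' x) (at x)"
    "trig g'" "\<forall>x. (g has_real_derivative g' x) (at x)" by auto
  with trig_mult show ?case
    by (intro exI[of _ "\<lambda>x. f' x * g x + g' x * f x"]) (auto intro!: trig.intros DERIV_mult)
qed

lemma trig_deriv:
  assumes "trig f" shows "trig (deriv f) \<and> f differentiable (at x)"
proof -
  obtain f' where f': "trig f'" "\<And>x. (f has_real_derivative f' x) (at x)"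
    using trig_has_derivative[OF assms] by blast
  moreover have "deriv f = f'" using f'(2) by (intro ext DERIV_imp_deriv)
  ultimately show ?thesis by (auto simp: real_differentiable_def)
qed

lemma trig_periodic: "trig f \<Longrightarrow> f (x + 1) = f x"
  by (induction rule: trig.induct) (auto simp: distrib_left)

lemma trig_test_function: "trig f \<Longrightarrow> test_function f"
proof -
  have "trig f \<Longrightarrow> trig ((deriv ^^ n) f)" for n
    by (induction n) (auto simp: trig_deriv)
  then show "trig f \<Longrightarrow> test_function f"
    unfolding test_function_def using trig_deriv trig_periodic by (auto intro: periodicI)
qed

lemma trig_polynomial:
  assumes "real_polynomial_function p"
  shows "trig (\<lambda>x. p (cos (2 * pi * x), sin (2 * pi * x)))"
  using assms
proof (induction rule: real_polynomial_function.induct)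
  case (linear f)
  then interpret f: bounded_linear f .
  have "f (c, s) = f (1, 0) * c + f (0, 1) * s" for c s
    using f.add[of "(c, 0)" "(0, s)"] f.scaleR[of c "(1, 0)"] f.scaleR[of s "(0, 1)"] by simp
  then have eq: "(\<lambda>x. f (cos (2 * pi * x), sin (2 * pi * x))) =
      (\<lambda>x. f (1, 0) * cos (2 * pi * x) + f (0, 1) * sin (2 * pi * x))" by blast
  show ?case unfolding eq by (intro trig.intros)
qed (auto intro: trig.intros)

text \<open>A continuous periodic function descends to a continuous function on the unit circle in
  the plane. There polynomials in the two coordinates are dense, and they pull back to trigonometric
  polynomials.\<close>

lemma trig_dense:
  assumes per: "periodic_fun_simple' \<Phi>" and cont: "continuous_on UNIV \<Phi>" and "e > 0"
  shows "\<exists>p. trig p \<and> (\<forall>x::real. \<bar>\<Phi> x - p x\<bar> < (e::real))"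
proof -
  define E where "E x = (cos (2 * pi * x), sin (2 * pi * x))" for x :: real
  define S where "S = E ` {0..1}"
  have Ec: "continuous_on A E" for A unfolding E_def by (intro continuous_intros)
  have E_eq: "\<Phi> x = \<Phi> y" if "E x = E y" for x y
  proof -
    have "sin (2 * pi * x) = sin (2 * pi * y) \<and> cos (2 * pi * x) = cos (2 * pi * y)"
      using that by (simp add: E_def)
    then obtain n :: int where "2 * pi * x = 2 * pi * y + 2 * pi * n"
      using sin_cos_eq_iff[where y="2 * pi * x" and x="2 * pi * y"] unfolding E_def by blast
    then have "2 * pi * x = 2 * pi * (y + n)" by (simp add: algebra_simps)
    then have "x = y + n" by simp
    then show ?thesis using periodic_plus_int[OF per] by simp
  qed
  have E_frac: "E x = E (frac x)" for x
  proof -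
    have "2 * pi * x = 2 * pi * frac x + 2 * pi * of_int \<lfloor>x\<rfloor>" by (simp add: frac_def algebra_simps)
    then show ?thesis using sin_cos_eq_iff[where y="2 * pi * x" and x="2 * pi * frac x"] unfolding E_def by blast
  qed
  have ES: "E x \<in> S" for x
    unfolding S_def E_frac[of x] using frac_lt_1[of x] frac_ge_0[of x] by (intro imageI) auto
  define F where "F z = \<Phi> (SOME x. E x = z)" for z
  have FE: "F (E x) = \<Phi> x" for x
    unfolding F_def by (rule E_eq) (rule someI_ex, auto)
  have "compact S" unfolding S_def by (intro compact_continuous_image Ec) auto
  have "continuous_on S F"
  proof (subst continuous_on_closed_vimage)
    show "closed S" using \<open>compact S\<close> by (rule compact_imp_closed)
    show "\<forall>B. closed B \<longrightarrow> closed (F -` B \<inter> S)"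
    proof (intro allI impI)
      fix B :: "real set" assume "closed B"
      \<comment> \<open>Continuity of the descended function: preimages of closed sets are images
        under E of compact subsets of the fundamental interval.\<close>
      have "F -` B \<inter> S = E ` ({0..1} \<inter> \<Phi> -` B)"
        unfolding S_def using FE by auto
      moreover have "closed (\<Phi> -` B)"
        using continuous_on_closed_vimage[of UNIV \<Phi>] cont \<open>closed B\<close> by auto
      then have "compact ({0..1} \<inter> \<Phi> -` B)" by (intro compact_Int_closed) auto
      ultimately show "closed (F -` B \<inter> S)"
        by (auto intro!: compact_imp_closed compact_continuous_image Ec)
    qed
  qed
  then obtain p where p: "real_polynomial_function p" "\<And>z. z \<in> S \<Longrightarrow> \<bar>F z - p z\<bar> < e"
    using Stone_Weierstrass_real_polynomial_function[OF \<open>compact S\<close> _ \<open>e > 0\<close>] by metis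
  have "\<bar>\<Phi> x - p (E x)\<bar> < e" for x using p(2)[OF ES[of x]] FE[of x] by simp
  then show ?thesis
    using trig_polynomial[OF p(1)] unfolding E_def by (intro exI[of _ "\<lambda>x. p (cos (2 * pi * x), sin (2 * pi * x))"]) auto
qed

section \<open>Test functions and their periodic antiderivatives\<close>

lemma test_function_deriv:
  assumes "test_function \<phi>"
  shows "(\<phi> has_real_derivative deriv \<phi> x) (at x)" "test_function (deriv \<phi>)"
    "continuous_on UNIV \<phi>" "abs_cont \<phi> (deriv \<phi>)" "periodic_fun_simple' \<phi>"
proof -
  show per: "periodic_fun_simple' \<phi>" using assms by (simp add: test_function_def)
  have d: "(\<phi> has_real_derivative deriv \<phi> x) (at x)" if "test_function \<phi>" for \<phi> x
    using that[unfolded test_function_def, THEN conjunct2, rule_format, of 0 x]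
    by (simp add: DERIV_deriv_iff_real_differentiable)
  show "(\<phi> has_real_derivative deriv \<phi> x) (at x)" by (rule d[OF assms])
  show t: "test_function (deriv \<phi>)"
    unfolding test_function_def
  proof (intro conjI allI)
    fix n x show "(deriv ^^ n) (deriv \<phi>) differentiable (at x)"
      using assms[unfolded test_function_def, THEN conjunct2, rule_format, of "Suc n" x] by (simp add: funpow_swap1)
    show "periodic_fun_simple' (deriv \<phi>)"
    proof (rule periodicI)
      fix x
      have "((\<lambda>x. \<phi> (x + 1)) has_real_derivative deriv \<phi> (x + 1)) (at x)"
        using d[OF assms, of "x + 1"] by (simp add: DERIV_shift)
      then have "(\<phi> has_real_derivative deriv \<phi> (x + 1)) (at x)"
        using periodicD[OF per] by simp
      then show "deriv \<phi> (x + 1) = deriv \<phi> x" by (simp add: DERIV_imp_deriv)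
    qed
  qed
  show "continuous_on UNIV \<phi>"
    using d[OF assms] by (auto intro!: continuous_at_imp_continuous_on DERIV_isCont)
  show "abs_cont \<phi> (deriv \<phi>)"
    by (rule abs_cont_C1[OF d[OF assms]])
       (use d[OF t] in \<open>auto intro!: continuous_at_imp_continuous_on DERIV_isCont\<close>)
qed

text \<open>A mean-zero integrand has a periodic antiderivative. Subtracting the mean makes the
  result mean zero again, so that the construction can be iterated for second derivatives.\<close>

lemma test_function_antideriv:
  assumes "test_function \<psi>" "(LBINT x:{0..1}. \<psi> x) = 0"
  obtains \<phi> where "test_function \<phi>" "deriv \<phi> = \<psi>" "(LBINT x:{0..1}. \<phi> x) = 0"
proof -
  define F where "F x = (LBINT z:{0..x}. \<psi> z) - (LBINT z:{x..0}. \<psi> z)" for x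
  have c: "continuous_on UNIV \<psi>" using test_function_deriv(3)[OF assms(1)] .
  have F: "abs_cont F \<psi>" unfolding F_def by (intro abs_cont_antideriv loc_L2_continuous c)
  define m where "m = (LBINT x:{0..1}. F x)"
  have Fm: "abs_cont (\<lambda>x. F x - m) \<psi>" using abs_cont_diff[OF F abs_cont_const[of m]] by simp
  have d: "((\<lambda>x. F x - m) has_real_derivative \<psi> x) (at x)" for x
    by (rule abs_cont_has_derivative[OF Fm c])
  have per: "periodic_fun_simple' (\<lambda>x. F x - m)"
    by (rule abs_cont_periodic[OF Fm _ assms(2)]) (use assms(1) in \<open>simp add: test_function_def\<close>)
  have dF: "deriv (\<lambda>x. F x - m) = \<psi>" using d by (intro ext DERIV_imp_deriv)
  have "test_function (\<lambda>x. F x - m)"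
    unfolding test_function_def
  proof (intro conjI allI per)
    fix n x
    show "(deriv ^^ n) (\<lambda>x. F x - m) differentiable (at x)"
    proof (cases n)
      case 0 then show ?thesis using d[of x] by (auto simp: real_differentiable_def)
    next
      case (Suc k)
      then have "(deriv ^^ n) (\<lambda>x. F x - m) = (deriv ^^ k) \<psi>" by (simp add: funpow_Suc_right dF del: funpow.simps)
      then show ?thesis using assms(1) by (simp add: test_function_def)
    qed
  qed
  moreover have "(LBINT x:{0..1}. F x - m) = 0"
    using loc_L2_integrable[OF loc_L2_continuous[OF abs_cont_continuous[OF F]]]
    by (subst set_integral_diff(2)) (auto simp: m_def set_integral_Icc_const loc_L2_integrable)
  ultimately show thesis using that dF by blast
qed

lemma test_function_minus_const: 
  assumes "test_function \<psi>" shows "test_function (\<lambda>x. \<psi> x - c)"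
proof -
  have "deriv (\<lambda>x. \<psi> x - c) = deriv \<psi>"
    using test_function_deriv(1)[OF assms] by (intro ext DERIV_imp_deriv) (auto intro!: derivative_eq_intros)
  then have "(deriv ^^ Suc n) (\<lambda>x. \<psi> x - c) = (deriv ^^ Suc n) \<psi>" for n
    by (simp add: funpow_swap1)
  then have "(deriv ^^ n) (\<lambda>x. \<psi> x - c) differentiable (at x)" for n x
    using assms test_function_deriv(1)[OF assms, of x] unfolding test_function_def
    by (cases n) (auto simp del: funpow.simps(2) intro!: derivative_intros simp: real_differentiable_def)
  then show ?thesis
    using assms by (auto simp: test_function_def intro!: periodicI dest: periodicD)
qed

section \<open>Vanishing criteria and the fundamental lemma of the calculus of variations\<close>

lemma set_integral_square_zero:
  fixes f :: "real \<Rightarrow> real"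
  assumes "loc_L2 f" "(LBINT x:{a..b}. (f x)\<^sup>2) = 0"
  shows "AE x in lborel. x \<in> {a..b} \<longrightarrow> f x = 0"
proof -
  have "AE x in lborel. indicator {a..b} x *\<^sub>R (f x)\<^sup>2 = 0"
    using assms loc_L2_sq_integrable[OF assms(1), of a b]
    by (subst integral_nonneg_eq_0_iff_AE[symmetric])
       (auto simp: set_integrable_def set_lebesgue_integral_def)
  then show ?thesis by eventually_elim (auto simp: indicator_def)
qed

lemma continuous_AE_zero:
  fixes f :: "real \<Rightarrow> real"
  assumes "continuous_on UNIV f" "AE x in lborel. x \<in> {a<..<b} \<longrightarrow> f x = 0" "x \<in> {a<..<b}"
  shows "f x = 0"
proof (rule ccontr)
  assume "f x \<noteq> 0"
  define U where "U = {a<..<b} \<inter> f -` (- {0})"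
  have "open U" unfolding U_def
    using assms(1) by (intro open_Int open_vimage) auto
  moreover have "x \<in> U" using assms(3) \<open>f x \<noteq> 0\<close> by (auto simp: U_def)
  ultimately obtain e where e: "e > 0" "ball x e \<subseteq> U" using openE by blast
  have "AE x in lborel. x \<notin> U" using assms(2) by eventually_elim (auto simp: U_def)
  then have "AE y in lborel. y \<notin> {x - e/2..x + e/2}"
  proof eventually_elim
    case (elim y)
    then have "y \<notin> ball x e" using e by auto
    then show ?case using e(1) by (auto simp: dist_real_def)
  qed
  then have "emeasure lborel {x - e/2..x + e/2} = 0"
    by (subst (asm) AE_iff_measurable[of "{x - e/2..x + e/2}"]) auto
  then show False using e(1) by simp
qed

lemma continuous_periodic_zero:
  fixes f :: "real \<Rightarrow> real"
  assumes f: "continuous_on UNIV f" and per: "periodic_fun_simple' f" and 0: "(LBINT x:{0..1}. (f x)\<^sup>2) = 0"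
  shows "f x = 0"
proof -
  have L: "loc_L2 f" by (rule loc_L2_continuous[OF f])
  have "periodic_fun_simple' (\<lambda>y. (f y)\<^sup>2)" using periodicD[OF per] by (intro periodicI) simp
  \<comment> \<open>The period is centred at x, so that x lies in the interior of the interval on
    which f vanishes almost everywhere.\<close>
  from set_integral_period[OF this loc_L2_sq_integrable[OF L], of "x - 1/2"] 0
  have "(LBINT y:{x-1/2..x-1/2+1}. (f y)\<^sup>2) = 0" by simp
  from set_integral_square_zero[OF L this]
  have "AE y in lborel. y \<in> {x-1/2<..<x-1/2+1} \<longrightarrow> f y = 0" by eventually_elim auto
  then show ?thesis by (rule continuous_AE_zero[OF f]) auto
qed

text \<open>Pythagoras. If f is orthogonal to functions p arbitrarily close to it, then f has norm
  zero; the vanishing criteria below rest on this.\<close>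

lemma set_integral_square_le_orthogonal:
  assumes f: "loc_L2 f" and p: "loc_L2 p" and 0: "(LBINT x:{a..b}. f x * p x) = 0"
  shows "(LBINT x:{a..b}. (f x)\<^sup>2) \<le> (LBINT x:{a..b}. (f x - p x)\<^sup>2)"
proof -
  have "(LBINT x:{a..b}. (f x - p x)\<^sup>2) = (LBINT x:{a..b}. ((f x)\<^sup>2 - 2 * (f x * p x)) + (p x)\<^sup>2)"
    by (simp add: power2_diff algebra_simps)
  also have "\<dots> = (LBINT x:{a..b}. (f x)\<^sup>2) - 2 * (LBINT x:{a..b}. f x * p x) + (LBINT x:{a..b}. (p x)\<^sup>2)"
    using f p by (subst set_integral_add(2)) (auto simp: loc_L2_sq_integrable loc_L2_mult_integrable)
  finally show ?thesis using 0 set_integral_nonneg_real[of "{a..b}" "\<lambda>x. (p x)\<^sup>2"] by simp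
qed

lemma L2_approx_C1:
  assumes f: "loc_L2 f" and e: "e > 0" and ab: "a \<le> b"
  obtains p p' where "\<And>x. (p has_real_derivative p' x) (at x)" "continuous_on UNIV p'" "continuous_on UNIV p"
    "(LBINT x:{a..b}. (f x - p x)\<^sup>2) < e"
proof -
  obtain g where g: "continuous_on UNIV g" "(LBINT x:{a..b}. (f x - g x)\<^sup>2) < e/4"
    using L2_approx[OF f, of "e/4" a b] e by auto
  \<comment> \<open>A uniform error d contributes d^2 (b - a) to the squared L^2 error, here at most
    e/4. The added 1 in the denominator covers a = b.\<close>
  define d where "d = sqrt (e / (4 * (b - a + 1)))"
  have d: "d > 0" "d\<^sup>2 * (b - a) \<le> e/4" unfolding d_def using e ab by (auto simp: field_simps)
  have "continuous_on {a..b} g" by (rule continuous_on_subset[OF g(1)]) simp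
  then obtain p where p: "real_polynomial_function p" "\<And>z. z \<in> {a..b} \<Longrightarrow> \<bar>g z - p z\<bar> < d"
    using Stone_Weierstrass_real_polynomial_function[of "{a..b}" g d] d by auto
  obtain p' where p': "real_polynomial_function p'" "\<And>x. (p has_real_derivative p' x) (at x)"
    using has_real_derivative_polynomial_function[OF p(1)] by blast
  have pc: "continuous_on UNIV q" if "real_polynomial_function q" for q :: "real \<Rightarrow> real"
    using that continuous_real_polymonial_function by (intro continuous_at_imp_continuous_on) blast
  have Lp: "loc_L2 p" "loc_L2 g" by (auto intro: loc_L2_continuous pc p g)
  have "(LBINT x:{a..b}. (g x - p x)\<^sup>2) \<le> (LBINT x:{a..b}. d\<^sup>2)"
  proof (intro set_integral_mono loc_L2_sq_integrable loc_L2_diff Lp)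
    show "(g x - p x)\<^sup>2 \<le> d\<^sup>2" if "x \<in> {a..b}" for x
      using p(2)[OF that] d by (metis abs_le_square_iff abs_of_pos less_imp_le)
  qed (simp add: loc_L2_integrable)
  also have "\<dots> \<le> e/4" using d ab by (simp add: set_integral_Icc_const)
  finally have "(LBINT x:{a..b}. ((f x - g x) + (g x - p x))\<^sup>2) < e"
    using set_integral_square_add_le[of "\<lambda>x. f x - g x" "\<lambda>x. g x - p x" a b] g(2)
    by (simp add: loc_L2_diff f Lp del: diff_add_cancel add_diff_cancel_right')
  then have "(LBINT x:{a..b}. (f x - p x)\<^sup>2) < e" by simp
  then show thesis using that p'(2) pc[OF p'(1)] pc[OF p(1)] by blast
qed

text \<open>The hypothesis says that the constant 0 is an antiderivative of f. Integration by parts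
  then makes f orthogonal to all C^1 functions, which are dense in L^2.\<close>

lemma AE_zero_if_interval_integrals_zero:
  assumes f: "loc_L2 f" and 0: "\<And>x y. x \<le> y \<Longrightarrow> (LBINT z:{x..y}. f z) = 0"
  shows "AE x in lborel. f x = 0"
proof -
  have "AE x in lborel. x \<in> {a..b} \<longrightarrow> f x = 0" if ab: "a \<le> b" for a b
  proof (rule set_integral_square_zero[OF f])
    have "(LBINT x:{a..b}. (f x)\<^sup>2) \<le> e" if e: "e > 0" for e
    proof -
      obtain p p' where p: "\<And>x. (p has_real_derivative p' x) (at x)" "continuous_on UNIV p'"
          "continuous_on UNIV p" "(LBINT x:{a..b}. (f x - p x)\<^sup>2) < e"
        by (rule L2_approx_C1[OF f e ab]) blast
      have "abs_cont (\<lambda>_. 0) f" using f 0 by (simp add: abs_cont_def)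
      from abs_cont_integral_by_parts[OF abs_cont_C1[OF p(1,2)] this ab]
      have "(LBINT x:{a..b}. f x * p x) = 0" by (simp add: mult.commute)
      from set_integral_square_le_orthogonal[OF f loc_L2_continuous[OF p(3)] this] p(4)
      show ?thesis by simp
    qed
    moreover have "0 \<le> (LBINT x:{a..b}. (f x)\<^sup>2)" by (intro set_integral_nonneg_real) auto
    ultimately show "(LBINT x:{a..b}. (f x)\<^sup>2) = 0" by (meson dense_ge order.antisym)
  qed
  then have "AE x in lborel. \<forall>n. x \<in> {-real n..real n} \<longrightarrow> f x = 0"
    by (subst AE_all_countable) auto
  then show ?thesis
  proof eventually_elim
    case (elim x)
    obtain n where "\<bar>x\<bar> \<le> real n" using real_arch_simple by blast
    then show ?case using elim[rule_format, of n] by (auto simp: abs_le_iff)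
  qed
qed

text \<open>Testing with p minus its mean shows that \<Phi> minus its mean is orthogonal to every
  trigonometric polynomial p. Choosing p uniformly close to that difference forces it to
  vanish.\<close>

lemma du_Bois_Reymond:
  assumes per: "periodic_fun_simple' \<Phi>" and cont: "continuous_on UNIV \<Phi>"
    and orth: "\<And>\<psi>. test_function \<psi> \<Longrightarrow> (LBINT x:{0..1}. \<psi> x) = 0 \<Longrightarrow> (LBINT x:{0..1}. \<Phi> x * \<psi> x) = 0"
  shows "\<Phi> x = (LBINT x:{0..1}. \<Phi> x)"
proof -
  define m where "m = (LBINT x:{0..1}. \<Phi> x)"
  define W where "W x = \<Phi> x - m" for x
  have Wc: "continuous_on UNIV W" unfolding W_def by (intro continuous_intros cont)
  have Wp: "periodic_fun_simple' W" using periodicD[OF per] by (auto simp: W_def intro: periodicI)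
  have LW: "loc_L2 W" and L\<Phi>: "loc_L2 \<Phi>" using Wc cont by (auto intro: loc_L2_continuous)
  have "(LBINT x:{0..1}. (W x)\<^sup>2) \<le> e" if "e > 0" for e
  proof -
    obtain p where p: "trig p" "\<And>x. \<bar>W x - p x\<bar> < sqrt e"
      using trig_dense[OF Wp Wc, of "sqrt e"] \<open>e > 0\<close> by auto
    have tp: "test_function p" by (rule trig_test_function[OF p(1)])
    have Lp: "loc_L2 p" by (intro loc_L2_continuous test_function_deriv(3) tp)
    define q where "q = (LBINT x:{0..1}. p x)"
    have "(LBINT x:{0..1}. p x - q) = 0"
      using Lp by (subst set_integral_diff(2)) (auto simp: loc_L2_integrable q_def set_integral_Icc_const)
    then have "0 = (LBINT x:{0..1}. \<Phi> x * (p x - q))"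
      by (intro orth[symmetric] test_function_minus_const tp)
    also have "\<dots> = (LBINT x:{0..1}. \<Phi> x * p x - q * \<Phi> x)" by (simp add: algebra_simps)
    also have "\<dots> = (LBINT x:{0..1}. \<Phi> x * p x) - q * m"
      using Lp L\<Phi> by (subst set_integral_diff(2)) (auto simp: loc_L2_mult_integrable loc_L2_integrable m_def)
    finally have 1: "(LBINT x:{0..1}. \<Phi> x * p x) = q * m" by simp
    have "(LBINT x:{0..1}. W x * p x) = (LBINT x:{0..1}. \<Phi> x * p x - m * p x)"
      by (simp add: W_def algebra_simps)
    also have "\<dots> = 0"
      using Lp L\<Phi> 1 by (subst set_integral_diff(2)) (auto simp: loc_L2_mult_integrable loc_L2_integrable q_def)
    finally have Wp0: "(LBINT x:{0..1}. W x * p x) = 0" .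
    have 2: "(LBINT x:{0..1}. (W x)\<^sup>2) \<le> (LBINT x:{0..1}. (W x - p x)\<^sup>2)"
      by (rule set_integral_square_le_orthogonal[OF LW Lp Wp0])
    have "(LBINT x:{0..1}. (W x - p x)\<^sup>2) \<le> (LBINT x:{0..(1::real)}. e)"
    proof (intro set_integral_mono loc_L2_sq_integrable loc_L2_diff LW Lp)
      show "(W x - p x)\<^sup>2 \<le> e" for x
      proof -
        have "\<bar>W x - p x\<bar>\<^sup>2 \<le> (sqrt e)\<^sup>2" using p(2)[of x] by (intro power_mono) auto
        then show ?thesis using \<open>e > 0\<close> by simp
      qed
    qed (simp add: loc_L2_integrable)
    also have "\<dots> = e" by (simp add: set_integral_Icc_const)
    finally show ?thesis using 2 by simp
  qed
  then have "(LBINT x:{0..1}. (W x)\<^sup>2) = 0"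
    by (meson dense_ge order.antisym set_integral_nonneg_real zero_le_power2)
  then have "W x = 0" by (rule continuous_periodic_zero[OF Wc Wp])
  then show ?thesis by (simp add: W_def m_def)
qed

text \<open>Testing with 1 gives f mean zero, so its antiderivative F is periodic. Integration by
  parts turns the hypothesis into orthogonality of F to mean-zero test functions. Hence F is
  constant by the continuous version, and all interval integrals of f vanish.\<close>

lemma du_Bois_Reymond_L2:
  assumes per: "periodic_fun_simple' f" and f: "loc_L2 f"
    and orth: "\<And>\<phi>. test_function \<phi> \<Longrightarrow> (LBINT x:{0..1}. f x * \<phi> x) = 0"
  shows "AE x in lborel. f x = 0"
proof (rule AE_zero_if_interval_integrals_zero[OF f])
  define F where "F x = (LBINT z:{0..x}. f z) - (LBINT z:{x..0}. f z)" for x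
  have F: "abs_cont F f" unfolding F_def by (rule abs_cont_antideriv[OF f])
  have 0: "(LBINT x:{0..1}. f x) = 0"
    using orth[OF trig_test_function[OF trig_const[of 1]]] by simp
  have Fp: "periodic_fun_simple' F" by (rule abs_cont_periodic[OF F per 0])
  fix x y :: real assume "x \<le> y"
  have "F x = F y"
  proof -
    have "F x = (LBINT x:{0..1}. F x)" for x
    proof (rule du_Bois_Reymond[OF Fp abs_cont_continuous[OF F]])
      fix \<psi> assume "test_function \<psi>" "(LBINT x:{0..1}. \<psi> x) = 0"
      then obtain \<phi> where \<phi>: "test_function \<phi>" "deriv \<phi> = \<psi>" by (rule test_function_antideriv)
      show "(LBINT x:{0..1}. F x * \<psi> x) = 0"
        using abs_cont_integral_by_parts[OF F test_function_deriv(4)[OF \<phi>(1)], of 0 1] \<phi> orth[OF \<phi>(1)]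
          periodicD[OF Fp, of 0] periodicD[OF test_function_deriv(5)[OF \<phi>(1)], of 0] by simp
    qed
    then show "F x = F y" by metis
  qed
  then show "(LBINT z:{x..y}. f z) = 0" using abs_contD[OF F \<open>x \<le> y\<close>] by simp
qed

text \<open>This makes the representative chosen by \<open>weak_deriv\<close> irrelevant: norms and
  almost everywhere identities may be computed with any explicit weak derivative.\<close>

lemma has_weak_deriv_unique:
  assumes "has_weak_deriv j f g" "has_weak_deriv j f g'"
  shows "AE x in lborel. g x = g' x"
proof -
  have sq: "square_integrable g" "square_integrable g'" using assms by (auto simp: has_weak_deriv_def)
  have L: "loc_L2 g" "loc_L2 g'" using sq by (auto intro: square_integrable_loc_L2)
  have "AE x in lborel. g x - g' x = 0"
  proof (rule du_Bois_Reymond_L2)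
    show "periodic_fun_simple' (\<lambda>x. g x - g' x)"
      using sq by (auto simp: square_integrable_def intro!: periodic_diff)
    fix \<phi> assume t: "test_function \<phi>"
    then have "(-1) ^ j * (LBINT x:{0..1}. g x * \<phi> x) = (-1) ^ j * (LBINT x:{0..1}. g' x * \<phi> x)"
      using assms by (simp add: has_weak_deriv_def)
    moreover have "loc_L2 \<phi>" by (intro loc_L2_continuous test_function_deriv(3) t)
    ultimately show "(LBINT x:{0..1}. (g x - g' x) * \<phi> x) = 0"
      using L by (simp add: left_diff_distrib loc_L2_mult_integrable)
  qed (intro loc_L2_diff L)
  then show ?thesis by eventually_elim simp
qed

lemma weak_deriv_AE:
  assumes "has_weak_deriv j f g" shows "AE x in lborel. weak_deriv j f x = g x"
  using has_weak_deriv_unique[OF someI[of "has_weak_deriv j f", OF assms] assms]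
  by (simp add: weak_deriv_def)

lemma weak_deriv_has_weak_deriv:
  assumes "has_weak_deriv j f g" shows "has_weak_deriv j f (weak_deriv j f)"
  unfolding weak_deriv_def by (rule someI[of "has_weak_deriv j f", OF assms])

lemma weak_deriv_norm:
  assumes "has_weak_deriv j f g"
  shows "(LBINT x:{0..1}. (weak_deriv j f x)\<^sup>2) = (LBINT x:{0..1}. (g x)\<^sup>2)"
proof (rule set_lebesgue_integral_cong_AE)
  have "square_integrable (weak_deriv j f)" "square_integrable g"
    using assms weak_deriv_has_weak_deriv[OF assms] by (auto simp: has_weak_deriv_def)
  then have "weak_deriv j f \<in> borel_measurable borel" "g \<in> borel_measurable borel"
    by (auto simp: square_integrable_def)
  then show "(\<lambda>x. (weak_deriv j f x)\<^sup>2) \<in> borel_measurable lborel" "(\<lambda>x. (g x)\<^sup>2) \<in> borel_measurable lborel"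
    by measurable
  show "AE x\<in>{0..1} in lborel. (weak_deriv j f x)\<^sup>2 = (g x)\<^sup>2"
    using weak_deriv_AE[OF assms] by eventually_elim simp
qed simp

lemma square_integrableI:
  "periodic_fun_simple' f \<Longrightarrow> loc_L2 f \<Longrightarrow> square_integrable f"
  by (auto simp: square_integrable_def loc_L2_def)

lemma has_weak_deriv_0: "square_integrable f \<Longrightarrow> has_weak_deriv 0 f f"
  by (simp add: has_weak_deriv_def)

lemma abs_cont_has_weak_deriv:
  assumes F: "abs_cont f g" and per: "periodic_fun_simple' f" "periodic_fun_simple' g"
  shows "has_weak_deriv 1 f g"
  unfolding has_weak_deriv_def
proof (intro conjI allI impI square_integrableI per abs_cont_loc_L2[OF F])
  fix \<phi> assume t: "test_function \<phi>"
  show "(LBINT x:{0..1}. f x * (deriv ^^ 1) \<phi> x) = (-1) ^ 1 * (LBINT x:{0..1}. g x * \<phi> x)"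
    using abs_cont_integral_by_parts[OF F test_function_deriv(4)[OF t], of 0 1]
      periodicD[OF per(1), of 0] periodicD[OF test_function_deriv(5)[OF t], of 0] by simp
qed

lemma abs_cont_has_weak_deriv_2:
  assumes V: "abs_cont f v" and F: "abs_cont v g"
    and per: "periodic_fun_simple' f" "periodic_fun_simple' v" "periodic_fun_simple' g"
  shows "has_weak_deriv 2 f g"
  unfolding has_weak_deriv_def
proof (intro conjI allI impI square_integrableI per abs_cont_loc_L2[OF F])
  fix \<phi> assume t: "test_function \<phi>"
  show "(LBINT x:{0..1}. f x * (deriv ^^ 2) \<phi> x) = (-1)\<^sup>2 * (LBINT x:{0..1}. g x * \<phi> x)"
    using abs_cont_has_weak_deriv[OF V per(1,2)] abs_cont_has_weak_deriv[OF F per(2,3)] t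
      test_function_deriv(2)[OF t]
    by (auto simp: has_weak_deriv_def numeral_2_eq_2)
qed

text \<open>Test with the constant 1, whose derivatives vanish. The mean-zero property is what makes
  antiderivatives periodic.\<close>

lemma has_weak_deriv_mean_zero:
  assumes "has_weak_deriv j f g" "j > 0" shows "(LBINT x:{0..1}. g x) = 0"
proof -
  have d0: "deriv (\<lambda>x::real. c::real) = (\<lambda>x. 0)" for c by auto
  have "(deriv ^^ j) (\<lambda>x::real. 1::real) = (\<lambda>x. 0)"
    using assms(2) by (induction j) (auto simp: d0 split: nat.splits, metis d0 funpow_0 gr0I)
  then show ?thesis
    using assms(1) trig_test_function[OF trig_const[of 1]] by (auto simp: has_weak_deriv_def dest!: spec[of _ "\<lambda>x. 1"])
qed

text \<open>The periodic antiderivative G of g has the same weak derivative as f. So f - G is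
  orthogonal to all mean-zero test functions and therefore constant.\<close>

lemma sobolev_1_abs_cont:
  assumes f: "continuous_on UNIV f" "periodic_fun_simple' f" and w: "has_weak_deriv 1 f g"
  shows "abs_cont f g"
proof -
  have per: "periodic_fun_simple' g" and g: "loc_L2 g"
    using w by (auto simp: has_weak_deriv_def square_integrable_def intro!: square_integrable_loc_L2)
  define G where "G x = (LBINT z:{0..x}. g z) - (LBINT z:{x..0}. g z)" for x
  have G: "abs_cont G g" unfolding G_def by (rule abs_cont_antideriv[OF g])
  have Gp: "periodic_fun_simple' G"
    by (rule abs_cont_periodic[OF G per has_weak_deriv_mean_zero[OF w]]) simp
  have "f x - G x = (LBINT x:{0..1}. f x - G x)" for x
  proof (rule du_Bois_Reymond)
    show "periodic_fun_simple' (\<lambda>x. f x - G x)"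
      by (rule periodic_diff[OF f(2) Gp])
    show "continuous_on UNIV (\<lambda>x. f x - G x)" by (intro continuous_intros f abs_cont_continuous[OF G])
    fix \<psi> assume "test_function \<psi>" "(LBINT x:{0..1}. \<psi> x) = 0"
    then obtain \<phi> where \<phi>: "test_function \<phi>" "deriv \<phi> = \<psi>" by (rule test_function_antideriv)
    have L: "loc_L2 f" "loc_L2 G" "loc_L2 \<psi>"
      using f(1) abs_cont_continuous[OF G] test_function_deriv(3)[OF \<open>test_function \<psi>\<close>]
      by (auto intro: loc_L2_continuous)
    have "(LBINT x:{0..1}. f x * \<psi> x) = - (LBINT x:{0..1}. g x * \<phi> x)"
      using w \<phi> by (auto simp: has_weak_deriv_def)
    moreover have "(LBINT x:{0..1}. G x * \<psi> x) = - (LBINT x:{0..1}. g x * \<phi> x)"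
      using abs_cont_has_weak_deriv[OF G Gp per] \<phi> by (auto simp: has_weak_deriv_def)
    ultimately show "(LBINT x:{0..1}. (f x - G x) * \<psi> x) = 0"
      using L by (simp add: left_diff_distrib loc_L2_mult_integrable)
  qed
  then obtain c where c: "\<And>x. f x - G x = c" by metis
  have "f y - f x = G y - G x" for x y using c[of x] c[of y] by simp
  then show ?thesis using G by (simp add: abs_cont_def)
qed

text \<open>Every mean-zero test function is a second derivative of a test function, so f differs by
  a constant from the double antiderivative H of g. The latter is C^1 by construction.\<close>

lemma sobolev_2_C1:
  assumes f: "continuous_on UNIV f" "periodic_fun_simple' f" and w: "has_weak_deriv 2 f g"
  shows "(f has_real_derivative deriv f x) (at x)" "abs_cont (deriv f) g"
proof -
  have per: "periodic_fun_simple' g" and g: "loc_L2 g"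
    using w by (auto simp: has_weak_deriv_def square_integrable_def intro!: square_integrable_loc_L2)
  define G0 where "G0 x = (LBINT z:{0..x}. g z) - (LBINT z:{x..0}. g z)" for x
  have G0: "abs_cont G0 g" unfolding G0_def by (rule abs_cont_antideriv[OF g])
  \<comment> \<open>The constant is chosen so that G has mean zero; only then is its antiderivative
    H periodic.\<close>
  define G where "G x = G0 x - (LBINT x:{0..1}. G0 x)" for x
  have G: "abs_cont G g" using abs_cont_diff[OF G0 abs_cont_const] unfolding G_def by simp
  have Gp: "periodic_fun_simple' G"
    by (rule abs_cont_periodic[OF G per has_weak_deriv_mean_zero[OF w]]) simp
  have LG: "loc_L2 G" "loc_L2 G0"
    using abs_cont_continuous[OF G] abs_cont_continuous[OF G0] by (auto intro: loc_L2_continuous)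
  have Gm: "(LBINT x:{0..1}. G x) = 0"
    unfolding G_def using LG(2) by (subst set_integral_diff(2)) (auto simp: loc_L2_integrable set_integral_Icc_const)
  define H where "H x = (LBINT z:{0..x}. G z) - (LBINT z:{x..0}. G z)" for x
  have H: "abs_cont H G" unfolding H_def by (rule abs_cont_antideriv[OF LG(1)])
  have Hp: "periodic_fun_simple' H" by (rule abs_cont_periodic[OF H Gp Gm])
  have "f x - H x = (LBINT x:{0..1}. f x - H x)" for x
  proof (rule du_Bois_Reymond)
    show "periodic_fun_simple' (\<lambda>x. f x - H x)"
      by (rule periodic_diff[OF f(2) Hp])
    show "continuous_on UNIV (\<lambda>x. f x - H x)" by (intro continuous_intros f abs_cont_continuous[OF H])
    fix \<psi> assume \<psi>: "test_function \<psi>" "(LBINT x:{0..1}. \<psi> x) = 0"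
    then obtain \<phi>1 where \<phi>1: "test_function \<phi>1" "deriv \<phi>1 = \<psi>" "(LBINT x:{0..1}. \<phi>1 x) = 0"
      by (rule test_function_antideriv)
    then obtain \<phi> where \<phi>: "test_function \<phi>" "deriv \<phi> = \<phi>1"
      by (metis test_function_antideriv)
    have L: "loc_L2 f" "loc_L2 H" "loc_L2 \<psi>"
      using f(1) abs_cont_continuous[OF H] test_function_deriv(3)[OF \<psi>(1)]
      by (auto intro: loc_L2_continuous)
    have "(LBINT x:{0..1}. f x * \<psi> x) = (LBINT x:{0..1}. g x * \<phi> x)"
      using w[unfolded has_weak_deriv_def, THEN conjunct2, rule_format, OF \<phi>(1)] \<phi>(2) \<phi>1(2)
      by (simp add: numeral_2_eq_2)
    moreover have "(LBINT x:{0..1}. H x * \<psi> x) = (LBINT x:{0..1}. g x * \<phi> x)"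
      using abs_cont_has_weak_deriv_2[OF H G Hp Gp per, unfolded has_weak_deriv_def, THEN conjunct2, rule_format, OF \<phi>(1)]
        \<phi>(2) \<phi>1(2) by (simp add: numeral_2_eq_2)
    ultimately show "(LBINT x:{0..1}. (f x - H x) * \<psi> x) = 0"
      using L by (simp add: left_diff_distrib loc_L2_mult_integrable)
  qed
  then obtain c where c: "\<And>x. f x - H x = c" by metis
  have fH: "f = (\<lambda>x. H x + c)" using c by (auto simp: algebra_simps)
  have d: "(f has_real_derivative G x) (at x)" for x
    unfolding fH by (auto intro!: derivative_eq_intros abs_cont_has_derivative[OF H abs_cont_continuous[OF G]])
  then have "deriv f = G" by (intro ext DERIV_imp_deriv)
  then show "(f has_real_derivative deriv f x) (at x)" "abs_cont (deriv f) g" using d G by auto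
qed

section \<open>The spaces \<open>H\<^sup>1\<close> and \<open>H\<^sup>2\<close>\<close>

lemma sobolev_1D:
  assumes "f \<in> sobolev 1"
  obtains g where "abs_cont f g" "periodic_fun_simple' f" "periodic_fun_simple' g" "has_weak_deriv 1 f g"
proof -
  obtain g where g: "has_weak_deriv 1 f g" using assms by (auto simp: sobolev_def)
  moreover have "periodic_fun_simple' f" "continuous_on UNIV f" "periodic_fun_simple' g"
    using assms g by (auto simp: sobolev_def square_integrable_def has_weak_deriv_def)
  ultimately show thesis using that sobolev_1_abs_cont by blast
qed

lemma sobolev_1I:
  assumes "abs_cont f g" "periodic_fun_simple' f" "periodic_fun_simple' g"
  shows "f \<in> sobolev 1"
  unfolding sobolev_def
proof (intro CollectI conjI allI impI)
  show sq: "square_integrable f"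
    using assms by (intro square_integrableI loc_L2_continuous abs_cont_continuous[OF assms(1)])
  show "continuous_on UNIV f" by (rule abs_cont_continuous[OF assms(1)])
  fix j :: nat assume "j \<le> 1"
  then consider "j = 0" | "j = 1" by linarith
  then show "\<exists>g. has_weak_deriv j f g"
    using has_weak_deriv_0[OF sq] abs_cont_has_weak_deriv[OF assms] by cases auto
qed

lemma sobolev_2D:
  assumes "f \<in> sobolev 2"
  obtains g where "\<And>x. (f has_real_derivative deriv f x) (at x)" "abs_cont (deriv f) g"
    "periodic_fun_simple' f" "periodic_fun_simple' (deriv f)" "periodic_fun_simple' g"
proof -
  obtain g where g: "has_weak_deriv 2 f g" using assms by (auto simp: sobolev_def)
  have 1: "periodic_fun_simple' f" "continuous_on UNIV f" "periodic_fun_simple' g"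
    using assms g by (auto simp: sobolev_def square_integrable_def has_weak_deriv_def)
  note d = sobolev_2_C1[OF 1(2,1) g]
  have "periodic_fun_simple' (deriv f)"
  proof (rule periodicI)
    fix x
    have "((\<lambda>x. f (x + 1)) has_real_derivative deriv f (x + 1)) (at x)"
      using d(1)[of "x + 1"] by (simp add: DERIV_shift)
    then have "(f has_real_derivative deriv f (x + 1)) (at x)" using periodicD[OF 1(1)] by simp
    then show "deriv f (x + 1) = deriv f x" by (simp add: DERIV_imp_deriv)
  qed
  with 1 d that show thesis by blast
qed

lemma sobolev_2I:
  assumes d: "\<And>x. (f has_real_derivative v x) (at x)" and v: "abs_cont v g"
    and per: "periodic_fun_simple' f" "periodic_fun_simple' v" "periodic_fun_simple' g"
  shows "f \<in> sobolev 2" "deriv f = v"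
proof -
  have fv: "abs_cont f v" by (rule abs_cont_C1[OF d abs_cont_continuous[OF v]])
  show "deriv f = v" using d by (intro ext DERIV_imp_deriv)
  show "f \<in> sobolev 2"
    unfolding sobolev_def
  proof (intro CollectI conjI allI impI)
    show sq: "square_integrable f"
      using per by (intro square_integrableI loc_L2_continuous abs_cont_continuous[OF fv])
    show "continuous_on UNIV f" by (rule abs_cont_continuous[OF fv])
    fix j :: nat assume "j \<le> 2"
    then consider "j = 0" | "j = 1" | "j = 2" by linarith
    then show "\<exists>g. has_weak_deriv j f g"
      using has_weak_deriv_0[OF sq] abs_cont_has_weak_deriv[OF fv per(1,2)]
        abs_cont_has_weak_deriv_2[OF fv v per] by cases auto
  qed
qed

section \<open>Explicit Sobolev norms and embedding into bounded functions\<close>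

lemma sobolev_norm_0:
  "square_integrable f \<Longrightarrow> sobolev_norm 0 f = sqrt (LBINT x:{0..1}. (f x)\<^sup>2)"
  by (simp add: sobolev_norm_def weak_deriv_norm[OF has_weak_deriv_0])

lemma sobolev_norm_1:
  assumes "abs_cont f g" "periodic_fun_simple' f" "periodic_fun_simple' g"
  shows "sobolev_norm 1 f = sqrt ((LBINT x:{0..1}. (f x)\<^sup>2) + (LBINT x:{0..1}. (g x)\<^sup>2))"
proof -
  have "square_integrable f"
    using assms by (intro square_integrableI loc_L2_continuous abs_cont_continuous[OF assms(1)])
  from weak_deriv_norm[OF has_weak_deriv_0[OF this]] weak_deriv_norm[OF abs_cont_has_weak_deriv[OF assms]]
  show ?thesis by (simp add: sobolev_norm_def)
qed

lemma sobolev_norm_2: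
  assumes d: "\<And>x. (f has_real_derivative v x) (at x)" and v: "abs_cont v g"
    and per: "periodic_fun_simple' f" "periodic_fun_simple' v" "periodic_fun_simple' g"
  shows "sobolev_norm 2 f = sqrt ((LBINT x:{0..1}. (f x)\<^sup>2) + (LBINT x:{0..1}. (v x)\<^sup>2) + (LBINT x:{0..1}. (g x)\<^sup>2))"
proof -
  have fv: "abs_cont f v" by (rule abs_cont_C1[OF d abs_cont_continuous[OF v]])
  then have "square_integrable f"
    using per by (intro square_integrableI loc_L2_continuous abs_cont_continuous[OF fv])
  from weak_deriv_norm[OF has_weak_deriv_0[OF this]] weak_deriv_norm[OF abs_cont_has_weak_deriv[OF fv per(1,2)]]
    weak_deriv_norm[OF abs_cont_has_weak_deriv_2[OF fv v per]]
  show ?thesis by (simp add: sobolev_norm_def numeral_2_eq_2)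
qed

text \<open>Compare f x with f y for y in the period starting at x by the Hoelder estimate, and
  average over y.\<close>

lemma abs_cont_sup_bound:
  assumes fg: "abs_cont f g" and per: "periodic_fun_simple' f" "periodic_fun_simple' g"
  shows "(f x)\<^sup>2 \<le> 2 * ((LBINT x:{0..1}. (f x)\<^sup>2) + (LBINT x:{0..1}. (g x)\<^sup>2))"
proof -
  have L: "loc_L2 f" "loc_L2 g" using fg by (auto intro: loc_L2_continuous abs_cont_continuous abs_cont_loc_L2)
  define G where "G = (LBINT z:{x..x+1}. (g z)\<^sup>2)"
  have sqp: "(LBINT z:{x..x+1}. (h z)\<^sup>2) = (LBINT z:{0..1}. (h z)\<^sup>2)"
    if "loc_L2 h" "periodic_fun_simple' h" for h
    using periodicD[OF that(2)] by (intro set_integral_period periodicI loc_L2_sq_integrable that(1)) simp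
  have le: "(f x)\<^sup>2 \<le> 2 * (f y)\<^sup>2 + 2 * G" if "y \<in> {x..x+1}" for y
  proof -
    have "(f y - f x)\<^sup>2 \<le> (y - x) * G"
      unfolding G_def using that by (intro abs_cont_Hoelder[OF fg]) auto
    also have "\<dots> \<le> 1 * G" using that by (intro mult_right_mono) (auto simp: G_def set_integral_nonneg_real)
    finally have "(f y - f x)\<^sup>2 \<le> G" by simp
    moreover have "(f x)\<^sup>2 \<le> 2 * (f y)\<^sup>2 + 2 * (f y - f x)\<^sup>2"
      using zero_le_power2[of "2 * f y - f x"] by (simp add: power2_eq_square algebra_simps)
    ultimately show ?thesis by linarith
  qed
  have "(f x)\<^sup>2 = (LBINT y:{x..x+1}. (f x)\<^sup>2)" by (simp add: set_integral_Icc_const)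
  also have "\<dots> \<le> (LBINT y:{x..x+1}. 2 * (f y)\<^sup>2 + 2 * G)"
    by (intro set_integral_mono le set_integral_add set_integrable_mult_right loc_L2_sq_integrable L loc_L2_integrable loc_L2_const)
  also have "\<dots> = 2 * (LBINT y:{x..x+1}. (f y)\<^sup>2) + 2 * G"
    using L by (subst set_integral_add(2)) (auto simp: loc_L2_sq_integrable loc_L2_integrable set_integral_Icc_const)
  finally show ?thesis using sqp[OF L(1) per(1)] sqp[OF L(2) per(2)] by (simp add: G_def)
qed

lemma sobolev_norm_sup_1:
  assumes "f \<in> sobolev 1" shows "\<bar>f x\<bar> \<le> 2 * sobolev_norm 1 f"
proof -
  obtain g where g: "abs_cont f g" "periodic_fun_simple' f" "periodic_fun_simple' g"
    by (rule sobolev_1D[OF assms])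
  \<comment> \<open>The constant is relaxed from 2 to 4 so that its square root is the integer
    2.\<close>
  have "(f x)\<^sup>2 \<le> 4 * ((LBINT x:{0..1}. (f x)\<^sup>2) + (LBINT x:{0..1}. (g x)\<^sup>2))"
    using abs_cont_sup_bound[OF g, of x] set_integral_nonneg_real[of "{0..1}" "\<lambda>x. (f x)\<^sup>2"]
      set_integral_nonneg_real[of "{0..1}" "\<lambda>x. (g x)\<^sup>2"] by simp
  then have "\<bar>f x\<bar> \<le> sqrt (4 * ((LBINT x:{0..1}. (f x)\<^sup>2) + (LBINT x:{0..1}. (g x)\<^sup>2)))"
    by (intro real_le_rsqrt) simp
  then show ?thesis unfolding sobolev_norm_1[OF g] real_sqrt_mult by simp
qed

lemma sobolev_norm_sup_2:
  assumes "f \<in> sobolev 2" shows "\<bar>f x\<bar> \<le> 2 * sobolev_norm 2 f" "\<bar>deriv f x\<bar> \<le> 2 * sobolev_norm 2 f"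
proof -
  obtain g where g: "\<And>x. (f has_real_derivative deriv f x) (at x)" "abs_cont (deriv f) g"
    and per: "periodic_fun_simple' f" "periodic_fun_simple' (deriv f)" "periodic_fun_simple' g"
    using sobolev_2D[OF assms] by blast
  have fv: "abs_cont f (deriv f)" by (rule abs_cont_C1[OF g(1) abs_cont_continuous[OF g(2)]])
  have nn: "0 \<le> (LBINT x:{0..1}. (h x)\<^sup>2)" for h :: "real \<Rightarrow> real" by (rule set_integral_nonneg_real) simp
  let ?N = "(LBINT x:{0..1}. (f x)\<^sup>2) + (LBINT x:{0..1}. (deriv f x)\<^sup>2) + (LBINT x:{0..1}. (g x)\<^sup>2)"
  have "(f x)\<^sup>2 \<le> 4 * ?N" "(deriv f x)\<^sup>2 \<le> 4 * ?N"
    using abs_cont_sup_bound[OF fv per(1,2), of x] abs_cont_sup_bound[OF g(2) per(2,3), of x]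
      nn[of f] nn[of "deriv f"] nn[of g] by simp_all
  then have "\<bar>f x\<bar> \<le> sqrt (4 * ?N)" "\<bar>deriv f x\<bar> \<le> sqrt (4 * ?N)"
    by (simp_all only: real_le_rsqrt power2_abs)
  then show "\<bar>f x\<bar> \<le> 2 * sobolev_norm 2 f" "\<bar>deriv f x\<bar> \<le> 2 * sobolev_norm 2 f"
    unfolding sobolev_norm_2[OF g per] real_sqrt_mult by simp_all
qed

lemma sobolev_1_diff:
  assumes "f \<in> sobolev 1" "g \<in> sobolev 1" shows "(\<lambda>x. f x - g x) \<in> sobolev 1"
proof -
  obtain f' where f: "abs_cont f f'" "periodic_fun_simple' f" "periodic_fun_simple' f'"
    by (rule sobolev_1D[OF assms(1)])
  obtain g' where g: "abs_cont g g'" "periodic_fun_simple' g" "periodic_fun_simple' g'"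
    by (rule sobolev_1D[OF assms(2)])
  show ?thesis
    by (rule sobolev_1I[OF abs_cont_diff[OF f(1) g(1)] periodic_diff[OF f(2) g(2)] periodic_diff[OF f(3) g(3)]])
qed

lemma sobolev_1_cmult:
  assumes "f \<in> sobolev 1" shows "(\<lambda>x. c * f x) \<in> sobolev 1"
proof -
  obtain g where g: "abs_cont f g" "periodic_fun_simple' f" "periodic_fun_simple' g"
    by (rule sobolev_1D[OF assms])
  show ?thesis
    by (rule sobolev_1I[OF abs_cont_cmult[OF g(1)]]) (use g in \<open>auto simp: periodic_fun_simple'_def\<close>)
qed

lemma sobolev_2_diff:
  assumes "f \<in> sobolev 2" "g \<in> sobolev 2"
  shows "(\<lambda>x. f x - g x) \<in> sobolev 2" "deriv (\<lambda>x. f x - g x) x = deriv f x - deriv g x"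
proof -
  obtain f' where f: "\<And>x. (f has_real_derivative deriv f x) (at x)" "abs_cont (deriv f) f'"
    "periodic_fun_simple' f" "periodic_fun_simple' (deriv f)" "periodic_fun_simple' f'"
    using sobolev_2D[OF assms(1)] by blast
  obtain g' where g: "\<And>x. (g has_real_derivative deriv g x) (at x)" "abs_cont (deriv g) g'"
    "periodic_fun_simple' g" "periodic_fun_simple' (deriv g)" "periodic_fun_simple' g'"
    using sobolev_2D[OF assms(2)] by blast
  have d: "((\<lambda>x. f x - g x) has_real_derivative deriv f x - deriv g x) (at x)" for x
    by (intro derivative_intros f g)
  note I = sobolev_2I[OF d abs_cont_diff[OF f(2) g(2)] periodic_diff[OF f(3) g(3)]
    periodic_diff[OF f(4) g(4)] periodic_diff[OF f(5) g(5)]]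
  show "(\<lambda>x. f x - g x) \<in> sobolev 2" "deriv (\<lambda>x. f x - g x) x = deriv f x - deriv g x"
    using I by auto
qed

text \<open>Convergence in time uniform in x, together with continuity of each slice, gives joint
  continuity. In the applications b is twice a Sobolev norm of the difference, and the embedding
  supplies the uniform bound.\<close>

lemma jointly_continuousI:
  fixes w :: "real \<Rightarrow> real \<Rightarrow> real"
  assumes c: "\<And>t. t \<in> I \<Longrightarrow> continuous_on UNIV (w t)"
    and b: "\<And>t. t \<in> I \<Longrightarrow> ((\<lambda>s. b s t) \<longlongrightarrow> 0) (at t within I)"
    and le: "\<And>s t y. s \<in> I \<Longrightarrow> t \<in> I \<Longrightarrow> \<bar>w s y - w t y\<bar> \<le> b s t"
  shows "continuous_on (I \<times> UNIV) (\<lambda>(t, x). w t x)"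
  unfolding continuous_on_def
proof (safe, simp)
  fix t x assume t: "t \<in> I"
  have b0: "((\<lambda>s. w s (y s) - w t (y s)) \<longlongrightarrow> 0) (at t within I)" for y
    by (rule Lim_null_comparison[OF _ b[OF t]]) (auto simp: eventually_at_filter intro!: always_eventually le t)
  show "((\<lambda>(t, x). w t x) \<longlongrightarrow> w t x) (at (t, x) within I \<times> UNIV)"
  proof (rule tendstoI)
    fix e :: real assume "e > 0"
    then have "\<forall>\<^sub>F s in at t within I. b s t < e/2" using b[OF t] by (intro order_tendstoD) auto
    then obtain d1 where d1: "d1 > 0" "\<And>s. s \<in> I \<Longrightarrow> s \<noteq> t \<Longrightarrow> dist s t < d1 \<Longrightarrow> b s t < e/2"
      unfolding eventually_at by blast
    obtain d2 where d2: "d2 > 0" "\<And>y. dist y x < d2 \<Longrightarrow> dist (w t y) (w t x) < e/2"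
      using c[OF t] \<open>e > 0\<close> unfolding continuous_on_iff by (metis UNIV_I half_gt_zero_iff)
    show "\<forall>\<^sub>F p in at (t, x) within I \<times> UNIV. dist (case p of (t, x) \<Rightarrow> w t x) (w t x) < e"
      unfolding eventually_at
    proof (intro exI[of _ "min d1 d2"] conjI ballI impI)
      show "0 < min d1 d2" using d1 d2 by simp
      fix p assume p: "p \<in> I \<times> UNIV" "p \<noteq> (t, x) \<and> dist p (t, x) < min d1 d2"
      obtain s y where sy: "p = (s, y)" by force
      have s: "s \<in> I" "dist (s, y) (t, x) < d1" "dist (s, y) (t, x) < d2" using p sy by auto
      have sd: "dist s t < d1" "dist y x < d2"
        using s dist_fst_le[of "(s,y)" "(t,x)"] dist_snd_le[of "(s,y)" "(t,x)"] by auto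
      have "\<bar>w s y - w t y\<bar> < e/2"
        using le[OF s(1) t, of y] d1(2)[OF s(1) _ sd(1)] \<open>e > 0\<close> by (cases "s = t") auto
      moreover have "dist (w s y) (w t x) \<le> \<bar>w s y - w t y\<bar> + dist (w t y) (w t x)"
        by (simp add: dist_real_def)
      ultimately show "dist (case p of (t, x) \<Rightarrow> w t x) (w t x) < e"
        using d2(2)[OF sd(2)] sy by simp
    qed
  qed
qed

section \<open>Pointwise consequences of continuity and differentiability in Sobolev norms\<close>

lemma C0_sobolev_1_continuous:
  assumes "w \<in> C0_sobolev T 1"
  shows "continuous_on (time_interval T \<times> UNIV) (\<lambda>(t, x). w t x)"
proof (rule jointly_continuousI)
  fix t assume t: "t \<in> time_interval T"
  show "continuous_on UNIV (w t)" using assms t by (auto simp: C0_sobolev_def sobolev_def)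
  have "((\<lambda>s. 2 * sobolev_norm 1 (\<lambda>x. w s x - w t x)) \<longlongrightarrow> 2 * 0) (at t within time_interval T)"
    using assms t by (intro tendsto_intros) (auto simp: C0_sobolev_def)
  then show "((\<lambda>s. 2 * sobolev_norm 1 (\<lambda>x. w s x - w t x)) \<longlongrightarrow> 0) (at t within time_interval T)" by simp
  fix s y assume s: "s \<in> time_interval T"
  show "\<bar>w s y - w t y\<bar> \<le> 2 * sobolev_norm 1 (\<lambda>x. w s x - w t x)"
    using assms s t by (intro sobolev_norm_sup_1[of "\<lambda>x. w s x - w t x"] sobolev_1_diff) (auto simp: C0_sobolev_def)
qed

lemma C0_sobolev_2_continuous:
  assumes "w \<in> C0_sobolev T 2"
  shows "continuous_on (time_interval T \<times> UNIV) (\<lambda>(t, x). w t x)"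
    "continuous_on (time_interval T \<times> UNIV) (\<lambda>(t, x). deriv (w t) x)"
proof -
  have S: "w t \<in> sobolev 2" if "t \<in> time_interval T" for t
    using assms that by (auto simp: C0_sobolev_def)
  have lim: "((\<lambda>s. 2 * sobolev_norm 2 (\<lambda>x. w s x - w t x)) \<longlongrightarrow> 0) (at t within time_interval T)"
    if "t \<in> time_interval T" for t
  proof -
    have "((\<lambda>s. 2 * sobolev_norm 2 (\<lambda>x. w s x - w t x)) \<longlongrightarrow> 2 * 0) (at t within time_interval T)"
      using assms that by (intro tendsto_intros) (auto simp: C0_sobolev_def)
    then show ?thesis by simp
  qed
  show "continuous_on (time_interval T \<times> UNIV) (\<lambda>(t, x). w t x)"
  proof (rule jointly_continuousI[OF _ lim])
    fix s t y assume st: "s \<in> time_interval T" "t \<in> time_interval T"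
    show "continuous_on UNIV (w t)" using S[OF st(2)] by (auto simp: sobolev_def)
    show "\<bar>w s y - w t y\<bar> \<le> 2 * sobolev_norm 2 (\<lambda>x. w s x - w t x)"
      using sobolev_norm_sup_2(1)[OF sobolev_2_diff(1)[OF S[OF st(1)] S[OF st(2)]]] .
  qed auto
  show "continuous_on (time_interval T \<times> UNIV) (\<lambda>(t, x). deriv (w t) x)"
  proof (rule jointly_continuousI[OF _ lim])
    fix s t y assume st: "s \<in> time_interval T" "t \<in> time_interval T"
    show "continuous_on UNIV (deriv (w t))" using sobolev_2D[OF S[OF st(2)]] abs_cont_continuous by metis
    show "\<bar>deriv (w s) y - deriv (w t) y\<bar> \<le> 2 * sobolev_norm 2 (\<lambda>x. w s x - w t x)"
      using sobolev_norm_sup_2(2)[OF sobolev_2_diff(1)[OF S[OF st(1)] S[OF st(2)]], of y]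
        sobolev_2_diff(2)[OF S[OF st(1)] S[OF st(2)], of y] by simp
  qed auto
qed

text \<open>The H^1 norm dominates the supremum, so difference quotients converging in H^1 converge
  at every point x.\<close>

lemma C1_sobolev_deriv_1:
  assumes "C1_sobolev_deriv T 1 w w'" "t \<in> time_interval T"
  shows "((\<lambda>s. w s x) has_real_derivative w' t x) (at t within time_interval T)"
proof -
  have S: "w s \<in> sobolev 1" "w' s \<in> sobolev 1" if "s \<in> time_interval T" for s
    using assms(1) that by (auto simp: C1_sobolev_deriv_def C0_sobolev_def)
  let ?D = "\<lambda>s x. (w s x - w t x) / (s - t) - w' t x"
  have A: "((\<lambda>s. 2 * sobolev_norm 1 (?D s)) \<longlongrightarrow> 0) (at t within time_interval T)"
    using assms by (intro tendsto_mult_right_zero) (auto simp: C1_sobolev_deriv_def)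
  have B: "\<forall>\<^sub>F s in at t within time_interval T. norm (?D s x) \<le> 2 * sobolev_norm 1 (?D s)"
    unfolding eventually_at_filter
  proof (intro always_eventually allI impI)
    fix s assume s: "s \<in> time_interval T"
    have "(\<lambda>x. (1/(s-t)) * (w s x - w t x) - w' t x) \<in> sobolev 1"
      by (intro sobolev_1_diff sobolev_1_cmult S s assms)
    then have "?D s \<in> sobolev 1" by simp
    then show "norm (?D s x) \<le> 2 * sobolev_norm 1 (?D s)"
      using sobolev_norm_sup_1[of "?D s" x] by simp
  qed
  have "((\<lambda>s. ?D s x) \<longlongrightarrow> 0) (at t within time_interval T)"
    by (rule Lim_null_comparison[OF B A])
  then show ?thesis by (simp add: has_field_derivative_iff LIM_zero_iff)
qed

lemma inv_dx_eq: "inv_dx g x = (LBINT z:{0..x}. g z) - (LBINT z:{x..0}. g z)"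
proof (cases "0 \<le> x")
  case True
  have "(LBINT z:{x..0}. g z) = 0"
    using True by (cases "x = 0") (simp_all add: set_integral_at_point, simp add: set_lebesgue_integral_def)
  then show ?thesis using True by (simp add: inv_dx_def interval_integral_Icc)
next
  case False
  then show ?thesis
    using interval_integral_endpoints_reverse[of "ereal 0" "ereal x" g]
    by (simp add: inv_dx_def interval_integral_Icc) (simp add: set_lebesgue_integral_def)
qed

lemma abs_cont_inv_dx: "loc_L2 g \<Longrightarrow> abs_cont (inv_dx g) g"
  using abs_cont_antideriv[of g 0] by (simp add: inv_dx_eq[abs_def])

lemma inv_dx_0 [simp]: "inv_dx g 0 = 0"
  by (simp add: inv_dx_eq)

section \<open>Ordinary differential equations\<close>

text \<open>The weight \<open>e\<^bsup>-Kt\<^esup>\<close> with \<open>K > L\<close> makes the Picard operator a contraction on a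
  half-line, so that no step-by-step continuation is needed.\<close>

lemma Picard_Lindeloef_forward:
  fixes f :: "real \<Rightarrow> 'a::euclidean_space \<Rightarrow> 'a"
  assumes fc: "continuous_on UNIV (\<lambda>(t, x). f t x)"
    and lip: "\<And>t x y. norm (f t x - f t y) \<le> L * norm (x - y)"
    and bd: "\<And>t. norm (f t y0) \<le> B"
  shows "\<exists>y. y 0 = y0 \<and> (\<forall>t\<ge>0. (y has_vector_derivative f t (y t)) (at t within {0..}))"
proof -
  have L0: "L \<ge> 0"
    using order_trans[OF norm_ge_zero lip[of 0 "SOME b. b \<in> Basis" 0]]
    by (simp add: SOME_Basis norm_Basis)
  have B0: "B \<ge> 0" using bd[of 0] norm_ge_zero[of "f 0 y0"] by linarith
  \<comment> \<open>This gives L / K at most 1/2, the contraction factor, and keeps K positive even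
    for L = 0.\<close>
  define K where "K = 2 * L + 1"
  have K: "K > 0" "L / K \<le> 1/2" using L0 by (auto simp: K_def field_simps)
  \<comment> \<open>The unknown is the weighted deviation z = exp(-K t) (y - y0), so a bounded z
    represents a solution of at most exponential growth.\<close>
  define Y where "Y z s = y0 + exp (K * s) *\<^sub>R z s" for z :: "real \<Rightarrow> 'a" and s
  define I where "I z t = integral {0..t} (\<lambda>s. f s (Y z s))" for z t
  \<comment> \<open>The cut-off \<open>max 0 t\<close> extends the image by zero to negative times,
    so that the fixed point can be sought among bounded continuous functions on the whole
    line.\<close>
  define \<Phi> where "\<Phi> z t = exp (- K * max 0 t) *\<^sub>R I z (max 0 t)" for z t
  have cY: "continuous_on A (\<lambda>s. f s (Y z s))" if "continuous_on UNIV z" for z A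
  proof -
    have "continuous_on A (\<lambda>s. (s, Y z s))"
      unfolding Y_def using continuous_on_subset[OF that subset_UNIV] by (intro continuous_intros) auto
    from continuous_on_compose2[OF fc this] show ?thesis by simp
  qed
  have exp_int: "integral {0..t} (\<lambda>s. c * exp (K * s)) \<le> c * exp (K * t) / K" if "t \<ge> 0" "c \<ge> 0" for c t
  proof -
    have "((\<lambda>s. c * exp (K * s)) has_integral (c * exp (K * t) / K - c * exp (K * 0) / K)) {0..t}"
      using that K by (intro fundamental_theorem_of_calculus)
        (auto intro!: derivative_eq_intros simp flip: has_real_derivative_iff_has_vector_derivative)
    then show ?thesis using that K by (auto dest!: integral_unique)
  qed
  have growth: "norm (integral {0..t} g) \<le> c * exp (K * t) / K"
    if "continuous_on {0..t} g" "\<And>s. s \<in> {0..t} \<Longrightarrow> norm (g s) \<le> c * exp (K * s)" "t \<ge> 0" "c \<ge> 0"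
    for g :: "real \<Rightarrow> 'a" and c t
  proof -
    have "norm (integral {0..t} g) \<le> integral {0..t} (\<lambda>s. c * exp (K * s))"
      using that by (intro integral_norm_bound_integral integrable_continuous_real continuous_intros) auto
    then show ?thesis using exp_int[OF that(3,4)] by linarith
  qed
  have \<Phi>b: "\<Phi> (apply_bcontfun z) \<in> bcontfun" for z :: "real \<Rightarrow>\<^sub>C 'a"
  proof (rule bcontfun_normI)
    have zc: "continuous_on UNIV (apply_bcontfun z)" by simp
    have der: "(I z has_vector_derivative f t (Y z t)) (at t within {0..b})" if "t \<in> {0..b}" for t b
      unfolding I_def using that by (intro integral_has_vector_derivative cY zc)
    have "continuous_on {0..b} (I z)" for b
      using der by (meson continuous_on_eq_continuous_within has_vector_derivative_continuous)
    then have Ic: "continuous_on {0..} (I z)"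
    proof -
      have "isCont (\<lambda>t. I z (max 0 t)) t" for t
      proof -
        have "continuous_on {-1<..<\<bar>t\<bar>+1} (\<lambda>t. I z (max 0 t))"
          by (rule continuous_on_compose2[OF \<open>\<And>b. continuous_on {0..b} (I z)\<close>[of "\<bar>t\<bar>+1"]]) (auto intro!: continuous_intros)
        moreover have "continuous_on {..<0} (\<lambda>t. I z (max 0 t))"
          by (rule continuous_on_eq[of _ "\<lambda>_. I z 0"]) (auto simp: max_def)
        ultimately show ?thesis
          by (cases "t < 0") (auto simp: continuous_on_eq_continuous_at)
      qed
      then have "continuous_on {0..} (\<lambda>t. I z (max 0 t))" by (auto intro!: continuous_at_imp_continuous_on)
      then show ?thesis by (rule continuous_on_eq) auto
    qed
    show "continuous_on UNIV (\<Phi> z)"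
      unfolding \<Phi>_def by (intro continuous_intros continuous_on_compose2[OF Ic]) auto
    fix t
    have "norm (I z (max 0 t)) \<le> (B + L * norm z) * exp (K * max 0 t) / K"
      unfolding I_def
    proof (rule growth)
      fix s assume "s \<in> {0..max 0 t}"
      then have s: "s \<ge> 0" by simp
      have "norm (f s (Y z s)) \<le> norm (f s y0) + norm (f s (Y z s) - f s y0)" by (metis norm_triangle_sub)
      also have "\<dots> \<le> B + L * (exp (K * s) * norm z)"
      proof (intro add_mono bd order_trans[OF lip] mult_left_mono L0)
        show "norm (Y z s - y0) \<le> exp (K * s) * norm z" using norm_bounded[of z s] by (simp add: Y_def)
      qed
      also have "\<dots> \<le> (B + L * norm z) * exp (K * s)"
      proof -
        have "B * 1 \<le> B * exp (K * s)" using s K B0 by (intro mult_left_mono) auto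
        then show ?thesis by (simp add: algebra_simps)
      qed
      finally show "norm (f s (Y z s)) \<le> (B + L * norm z) * exp (K * s)" .
    qed (use B0 L0 in \<open>auto intro!: cY\<close>)
    then have "norm (\<Phi> z t) \<le> exp (- K * max 0 t) * ((B + L * norm z) * exp (K * max 0 t) / K)"
      unfolding \<Phi>_def norm_scaleR abs_exp_cancel by (intro mult_left_mono) auto
    also have "\<dots> = (B + L * norm z) / K" by (simp add: exp_minus)
    finally show "norm (\<Phi> z t) \<le> (B + L * norm z) / K" .
  qed
  define P where "P z = Bcontfun (\<Phi> (apply_bcontfun z))" for z
  have P: "apply_bcontfun (P z) = \<Phi> (apply_bcontfun z)" for z
    unfolding P_def by (rule Bcontfun_inverse[OF \<Phi>b])
  have "\<exists>!z. P z = z"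
  proof (rule banach_fix_type)
    show "\<forall>z w. dist (P z) (P w) \<le> 1/2 * dist z w"
    proof (intro allI dist_bound)
      fix z w :: "real \<Rightarrow>\<^sub>C 'a" and t :: real
      let ?m = "max 0 t"
      have "I z ?m - I w ?m = integral {0..?m} (\<lambda>s. f s (Y z s) - f s (Y w s))"
        unfolding I_def by (intro Henstock_Kurzweil_Integration.integral_diff[symmetric] integrable_continuous_real cY) auto
      also have "norm \<dots> \<le> (L * dist z w) * exp (K * ?m) / K"
      proof (rule growth)
        fix s assume "s \<in> {0..?m}"
        have "norm (f s (Y z s) - f s (Y w s)) \<le> L * norm (Y z s - Y w s)" by (rule lip)
        also have "\<dots> = L * (exp (K * s) * dist (z s) (w s))"
          by (simp add: Y_def dist_norm flip: scaleR_diff_right)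
        also have "\<dots> \<le> L * (exp (K * s) * dist z w)"
          using dist_bounded[of z s w] L0 by (intro mult_left_mono) auto
        finally show "norm (f s (Y z s) - f s (Y w s)) \<le> (L * dist z w) * exp (K * s)" by (simp add: mult_ac)
      qed (use L0 in \<open>auto intro!: continuous_intros cY\<close>)
      finally have "norm (I z ?m - I w ?m) \<le> (L * dist z w) * exp (K * ?m) / K" .
      then have "norm (\<Phi> z t - \<Phi> w t) \<le> exp (- K * ?m) * ((L * dist z w) * exp (K * ?m) / K)"
        unfolding \<Phi>_def scaleR_diff_right[symmetric] norm_scaleR abs_exp_cancel by (intro mult_left_mono) auto
      also have "\<dots> = (L / K) * dist z w" by (simp add: exp_minus)
      also have "\<dots> \<le> 1/2 * dist z w" using K by (intro mult_right_mono) auto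
      finally show "dist (P z t) (P w t) \<le> 1/2 * dist z w" by (simp add: P dist_norm)
    qed
  qed auto
  then obtain z where z: "P z = z" by blast
  have zt: "exp (K * t) *\<^sub>R z t = I z t" if "t \<ge> 0" for t
  proof -
    have "z t = \<Phi> z t" using P[of z] z by metis
    then show ?thesis using that by (simp add: \<Phi>_def exp_minus)
  qed
  show ?thesis
  proof (intro exI[of _ "\<lambda>t. y0 + I z t"] conjI allI impI)
    show "y0 + I z 0 = y0" by (simp add: I_def)
    fix t :: real assume t: "t \<ge> 0"
    have eq: "f t (y0 + I z t) = f t (Y z t)" using zt[OF t] by (simp add: Y_def)
    have "((\<lambda>t. y0 + I z t) has_vector_derivative 0 + f t (Y z t)) (at t within {0..t+1})"
      unfolding I_def using t by (intro derivative_intros integral_has_vector_derivative cY) auto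
    then have "((\<lambda>t. y0 + I z t) has_vector_derivative f t (Y z t)) (at t within {0..})"
      by (subst (asm) at_within_nhd[where S="{..<t+1}" and U="{0..}"]) auto
    then show "((\<lambda>t. y0 + I z t) has_vector_derivative f t (y0 + I z t)) (at t within {0..})"
      using eq by simp
  qed
qed

text \<open>The solution is glued from two forward solutions starting at t0, the second one for the
  time-reversed field. Both have the same one-sided derivative at t0.\<close>

lemma Picard_Lindeloef:
  fixes f :: "real \<Rightarrow> 'a::euclidean_space \<Rightarrow> 'a"
  assumes fc: "continuous_on UNIV (\<lambda>(t, x). f t x)"
    and lip: "\<And>t x y. norm (f t x - f t y) \<le> L * norm (x - y)"
    and bd: "\<And>t. norm (f t y0) \<le> B"
  shows "\<exists>y. y t0 = y0 \<and> (\<forall>t. (y has_vector_derivative f t (y t)) (at t))"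
proof -
  have c1: "continuous_on UNIV (\<lambda>(t, x). f (t0 + t) x)"
    using continuous_on_compose2[OF fc, of UNIV "\<lambda>p. (t0 + fst p, snd p)"]
    by (simp add: case_prod_beta continuous_intros)
  have c2: "continuous_on UNIV (\<lambda>(t, x). - f (t0 - t) x)"
    using continuous_on_minus[OF continuous_on_compose2[OF fc, of UNIV "\<lambda>p. (t0 - fst p, snd p)"]]
    by (simp add: case_prod_beta continuous_intros)
  obtain y1 where y1: "y1 0 = y0" "\<And>t. t \<ge> 0 \<Longrightarrow> (y1 has_vector_derivative f (t0 + t) (y1 t)) (at t within {0..})"
    using Picard_Lindeloef_forward[OF c1, of L y0 B] lip bd by blast
  have "norm (- f t x - - f t y) \<le> L * norm (x - y)" for t x y
    using lip[of t x y] by (metis minus_diff_minus norm_minus_cancel)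
  then obtain y2 where y2: "y2 0 = y0" "\<And>t. t \<ge> 0 \<Longrightarrow> (y2 has_vector_derivative - f (t0 - t) (y2 t)) (at t within {0..})"
    using Picard_Lindeloef_forward[OF c2, of L y0 B] bd by auto
  have d1: "((\<lambda>t. y1 (t - t0)) has_vector_derivative f t (y1 (t - t0))) (at t within {t0..})" if "t \<ge> t0" for t
  proof -
    have "((y1 \<circ> (\<lambda>t. t - t0)) has_vector_derivative 1 *\<^sub>R f (t0 + (t - t0)) (y1 (t - t0))) (at t within {t0..})"
    proof (rule vector_diff_chain_within)
      show "((\<lambda>t. t - t0) has_vector_derivative 1) (at t within {t0..})"
        by (auto intro!: derivative_eq_intros)
      show "(y1 has_vector_derivative f (t0 + (t - t0)) (y1 (t - t0))) (at (t - t0) within (\<lambda>t. t - t0) ` {t0..})"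
        by (rule has_vector_derivative_within_subset[OF y1(2)]) (use that in auto)
    qed
    then show ?thesis by (simp add: o_def)
  qed
  have d2: "((\<lambda>t. y2 (t0 - t)) has_vector_derivative f t (y2 (t0 - t))) (at t within {..t0})" if "t \<le> t0" for t
  proof -
    have "((y2 \<circ> (\<lambda>t. t0 - t)) has_vector_derivative (-1) *\<^sub>R - f (t0 - (t0 - t)) (y2 (t0 - t))) (at t within {..t0})"
    proof (rule vector_diff_chain_within)
      show "((\<lambda>t. t0 - t) has_vector_derivative -1) (at t within {..t0})"
        by (auto intro!: derivative_eq_intros)
      show "(y2 has_vector_derivative - f (t0 - (t0 - t)) (y2 (t0 - t))) (at (t0 - t) within (\<lambda>t. t0 - t) ` {..t0})"
        by (rule has_vector_derivative_within_subset[OF y2(2)]) (use that in auto)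
    qed
    then show ?thesis by (simp add: o_def)
  qed
  define y where "y t = (if t \<in> {t0..} then y1 (t - t0) else y2 (t0 - t))" for t
  show ?thesis
  proof (intro exI[of _ y] conjI allI)
    show "y t0 = y0" using y1 by (simp add: y_def)
    fix t
    have Un: "UNIV = {t0..} \<union> {..t0}" by auto
    have Int: "{t0..} \<union> ({t0..} \<inter> {..t0}) = {t0..}" "{..t0} \<union> ({t0..} \<inter> {..t0}) = {..t0}" by auto
    have "(y has_vector_derivative (if t \<in> {t0..} then f t (y1 (t - t0)) else f t (y2 (t0 - t)))) (at t within UNIV)"
      unfolding y_def[abs_def]
      by (rule has_vector_derivative_If_within_closures[OF _ Un])
         (use y1(1) y2(1) in \<open>auto simp: Int closure_closed intro!: d1 d2 dest!: antisym\<close>)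
    then show "(y has_vector_derivative f t (y t)) (at t)" by (simp add: y_def if_distrib)
  qed
qed

text \<open>In the interior f and the integral of f' differ by a constant, and by continuity also at
  the endpoints. This carries evolution equations known only for interior times to the initial
  time.\<close>

lemma has_real_derivative_closed_extension:
  fixes f f' :: "real \<Rightarrow> real"
  assumes "continuous_on {a..b} f" "continuous_on {a..b} f'"
    and d: "\<And>t. a < t \<Longrightarrow> t < b \<Longrightarrow> (f has_real_derivative f' t) (at t)" and t: "t \<in> {a..b}"
  shows "(f has_real_derivative f' t) (at t within {a..b})"
proof -
  define F where "F t = integral {a..t} f'" for t
  have F: "(F has_real_derivative f' t) (at t within {a..b})" if "t \<in> {a..b}" for t
    unfolding F_def using that assms(2) by (intro integral_has_real_derivative)
  have eq: "f t = f a - F a + F t" if t: "t \<in> {a..b}" for t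
  proof (cases "a = t")
    case False
    have "f t - F t = f a - F a"
    proof (rule DERIV_isconst_end[where f="\<lambda>t. f t - F t"])
      show "continuous_on {a..t} (\<lambda>t. f t - F t)"
      proof (rule continuous_on_diff)
        show "continuous_on {a..t} f" by (rule continuous_on_subset[OF assms(1)]) (use t in auto)
        have "continuous_on {a..b} F" using F by (meson DERIV_continuous continuous_on_eq_continuous_within)
        then show "continuous_on {a..t} F" by (rule continuous_on_subset) (use t in auto)
      qed
      fix s assume s: "a < s" "s < t"
      then have "(F has_real_derivative f' s) (at s)"
        using F[of s] t by (simp add: at_within_Icc_at)
      then show "((\<lambda>t. f t - F t) has_real_derivative 0) (at s)"
        using d[of s] s t by (auto intro!: derivative_eq_intros)
    qed (use t False in auto)
    then show ?thesis by simp
  qed simp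
  have "((\<lambda>t. f a - F a + F t) has_real_derivative f' t) (at t within {a..b})"
    using F[OF t] by (auto intro!: derivative_eq_intros)
  then show ?thesis
    by (rule has_field_derivative_transform_within[OF _ zero_less_one t eq[symmetric]])
qed

text \<open>The point \<xi> s lies between p s and p t, hence tends to p t, and joint continuity of
  the slope gives the limit. Both the chain rule and the implicit differentiation below rest on
  this.\<close>

lemma mean_value_near_curve:
  fixes A Ax :: "real \<Rightarrow> real \<Rightarrow> real"
  assumes S: "open S" "t \<in> S"
    and Ax: "\<And>s y. s \<in> S \<Longrightarrow> (A s has_real_derivative Ax s y) (at y)"
    and Axc: "continuous_on (S \<times> UNIV) (\<lambda>(s, y). Ax s y)"
    and p: "isCont p t"
  obtains \<xi> where "\<And>s. s \<in> S \<Longrightarrow> A s (p s) - A s (p t) = Ax s (\<xi> s) * (p s - p t)"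
    "((\<lambda>s. Ax s (\<xi> s)) \<longlongrightarrow> Ax t (p t)) (at t)"
proof -
  have "\<exists>\<xi>. \<bar>\<xi> - p t\<bar> \<le> \<bar>p s - p t\<bar> \<and> A s (p s) - A s (p t) = Ax s \<xi> * (p s - p t)" if s: "s \<in> S" for s
  proof (cases "p s" "p t" rule: linorder_cases)
    case less
    from MVT2[OF less Ax[OF s]] obtain z where "p s < z" "z < p t"
      "A s (p t) - A s (p s) = (p t - p s) * Ax s z" by auto
    then show ?thesis by (intro exI[of _ z]) (auto simp: algebra_simps)
  next
    case greater
    from MVT2[OF greater Ax[OF s]] obtain z where "p t < z" "z < p s"
      "A s (p s) - A s (p t) = (p s - p t) * Ax s z" by auto
    then show ?thesis by (intro exI[of _ z]) (auto simp: algebra_simps)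
  qed auto
  then obtain \<xi> where \<xi>: "\<And>s. s \<in> S \<Longrightarrow> \<bar>\<xi> s - p t\<bar> \<le> \<bar>p s - p t\<bar>"
    "\<And>s. s \<in> S \<Longrightarrow> A s (p s) - A s (p t) = Ax s (\<xi> s) * (p s - p t)" by metis
  have evS: "\<forall>\<^sub>F s in at t. s \<in> S" using S by (rule eventually_at_in_open')
  have "((\<lambda>s. p s) \<longlongrightarrow> p t) (at t)" using p by (simp add: isCont_def)
  then have p0: "((\<lambda>s. \<bar>p s - p t\<bar>) \<longlongrightarrow> 0) (at t)" by (simp add: LIM_zero tendsto_rabs_zero)
  have "((\<lambda>s. \<xi> s - p t) \<longlongrightarrow> 0) (at t)"
    by (rule Lim_null_comparison[OF _ p0]) (use evS in \<open>eventually_elim, use \<xi> in auto\<close>)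
  then have \<xi>t: "(\<xi> \<longlongrightarrow> p t) (at t)" by (simp add: LIM_zero_iff)
  have "continuous (at (t, p t)) (\<lambda>(s, y). Ax s y)"
    using Axc S by (subst (asm) continuous_on_eq_continuous_at) (auto intro: open_Times)
  then have "isCont (\<lambda>(s, y). Ax s y) (t, p t)" .
  moreover have "((\<lambda>s. (s, \<xi> s)) \<longlongrightarrow> (t, p t)) (at t)" by (intro tendsto_intros \<xi>t)
  ultimately have "((\<lambda>s. (\<lambda>(s, y). Ax s y) (s, \<xi> s)) \<longlongrightarrow> (\<lambda>(s, y). Ax s y) (t, p t)) (at t)"
    by (rule isCont_tendsto_compose)
  then have "((\<lambda>s. Ax s (\<xi> s)) \<longlongrightarrow> Ax t (p t)) (at t)" by simp
  with \<xi>(2) show thesis by (rule that)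
qed

text \<open>The increment splits into a time increment at the fixed point p t and a space increment
  at time s. The mean value form controls the second.\<close>

lemma joint_chain_rule:
  fixes A Ax :: "real \<Rightarrow> real \<Rightarrow> real"
  assumes S: "open S" "t \<in> S"
    and At: "((\<lambda>s. A s (p t)) has_real_derivative a) (at t)"
    and Ax: "\<And>s y. s \<in> S \<Longrightarrow> (A s has_real_derivative Ax s y) (at y)"
    and Axc: "continuous_on (S \<times> UNIV) (\<lambda>(s, y). Ax s y)"
    and p: "(p has_real_derivative p') (at t)"
  shows "((\<lambda>s. A s (p s)) has_real_derivative a + Ax t (p t) * p') (at t)"
proof -
  obtain \<xi> where \<xi>: "\<And>s. s \<in> S \<Longrightarrow> A s (p s) - A s (p t) = Ax s (\<xi> s) * (p s - p t)"
    and Axl: "((\<lambda>s. Ax s (\<xi> s)) \<longlongrightarrow> Ax t (p t)) (at t)"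
    using mean_value_near_curve[OF S Ax Axc DERIV_isCont[OF p]] by metis
  have evS: "\<forall>\<^sub>F s in at t. s \<in> S" using S by (rule eventually_at_in_open')
  have "((\<lambda>s. (A s (p t) - A t (p t)) / (s - t) + Ax s (\<xi> s) * ((p s - p t) / (s - t)))
      \<longlongrightarrow> a + Ax t (p t) * p') (at t)"
    using At p unfolding has_field_derivative_iff by (intro tendsto_intros Axl)
  then have "((\<lambda>s. (A s (p s) - A t (p t)) / (s - t)) \<longlongrightarrow> a + Ax t (p t) * p') (at t)"
  proof (rule Lim_transform_eventually)
    show "\<forall>\<^sub>F s in at t. (A s (p t) - A t (p t)) / (s - t) + Ax s (\<xi> s) * ((p s - p t) / (s - t)) =
       (A s (p s) - A t (p t)) / (s - t)"
      using evS
    proof eventually_elim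
      case (elim s)
      have "(A s (p t) - A t (p t)) / (s - t) + Ax s (\<xi> s) * ((p s - p t) / (s - t))
        = ((A s (p t) - A t (p t)) + Ax s (\<xi> s) * (p s - p t)) / (s - t)" by (simp add: add_divide_distrib)
      then show ?case using \<xi>[OF elim] by simp
    qed
  qed
  then show ?thesis by (simp add: has_field_derivative_iff)
qed

lemma uniform_near_curve:
  fixes F :: "real \<Rightarrow> real \<Rightarrow> real"
  assumes F: "continuous_on ({a..b} \<times> UNIV) (\<lambda>(s, y). F s y)" and q: "continuous_on {a..b} q" and "e > 0"
  shows "\<exists>d>0. \<forall>s\<in>{a..b}. \<forall>y. \<bar>y - q s\<bar> \<le> d \<longrightarrow> \<bar>F s y - F s (q s)\<bar> < e"
proof -
  obtain Q where Q: "\<And>s. s \<in> {a..b} \<Longrightarrow> \<bar>q s\<bar> \<le> Q" using continuous_bounded_Icc[OF q] by (meson less_imp_le)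
  define C where "C = {a..b} \<times> {-Q-1..Q+1}"
  have "compact C" unfolding C_def by (intro compact_Times) auto
  moreover have "continuous_on C (\<lambda>(s, y). F s y)"
    by (rule continuous_on_subset[OF F]) (auto simp: C_def)
  ultimately have "uniformly_continuous_on C (\<lambda>(s, y). F s y)" by (rule compact_uniformly_continuous[rotated])
  then obtain d where d: "d > 0" "\<And>p p'. p \<in> C \<Longrightarrow> p' \<in> C \<Longrightarrow> dist p' p < d \<Longrightarrow>
      dist ((\<lambda>(s, y). F s y) p') ((\<lambda>(s, y). F s y) p) < e"
    using \<open>e > 0\<close> unfolding uniformly_continuous_on_def by metis
  show ?thesis
  proof (intro exI[of _ "min (d/2) 1"] conjI ballI allI impI)
    show "0 < min (d/2) 1" using d by simp
    fix s y assume s: "s \<in> {a..b}" and y: "\<bar>y - q s\<bar> \<le> min (d/2) 1"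
    have "dist (s, y) (s, q s) < d" using y d(1) by (simp add: dist_Pair_Pair dist_real_def)
    moreover have "(s, y) \<in> C" "(s, q s) \<in> C" using s y Q[OF s] by (auto simp: C_def abs_le_iff)
    ultimately show "\<bar>F s y - F s (q s)\<bar> < e" using d(2)[of "(s, q s)" "(s, y)"] by (simp add: dist_real_def)
  qed
qed

text \<open>Gronwall: multiplied by the exponential of minus the integral of c, the function P
  becomes nonincreasing. The equality follows by applying the inequality to P and to -P.\<close>

lemma integrating_factor:
  fixes P c :: "real \<Rightarrow> real"
  assumes d: "\<And>t. t \<in> {a..b} \<Longrightarrow> (P has_real_derivative P' t) (at t within {a..b})"
    and c: "continuous_on {a..b} c" and t: "t \<in> {a..b}"
  shows "(\<And>t. t \<in> {a..b} \<Longrightarrow> P' t \<le> c t * P t) \<Longrightarrow> P t \<le> P a * exp (integral {a..t} c)"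
    and "(\<And>t. t \<in> {a..b} \<Longrightarrow> P' t = c t * P t) \<Longrightarrow> P t = P a * exp (integral {a..t} c)"
proof -
  have le: "Q t \<le> Q a * exp (integral {a..t} c)"
    if dQ: "\<And>t. t \<in> {a..b} \<Longrightarrow> (Q has_real_derivative Q' t) (at t within {a..b})"
    and leQ: "\<And>t. t \<in> {a..b} \<Longrightarrow> Q' t \<le> c t * Q t" for Q Q'
  proof -
    define E where "E t = integral {a..t} c" for t
    have E: "(E has_real_derivative c t) (at t within {a..b})" if "t \<in> {a..b}" for t
      unfolding E_def using that c by (intro integral_has_real_derivative)
    have D: "((\<lambda>t. Q t * exp (- E t)) has_real_derivative (Q' t - c t * Q t) * exp (- E t)) (at t within {a..b})"
      if "t \<in> {a..b}" for t
      by (rule derivative_eq_intros dQ[OF that] E[OF that] refl)+ (simp add: algebra_simps)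
    have "(\<lambda>t. Q t * exp (- E t)) t \<le> (\<lambda>t. Q t * exp (- E t)) a"
    proof (cases "a = t")
      case False
      then have at: "a < t" using t by simp
      show ?thesis
      proof (rule DERIV_nonpos_imp_decreasing_open[where f="\<lambda>t. Q t * exp (- E t)"])
        show "a \<le> t" using at by simp
        have "continuous_on {a..b} (\<lambda>t. Q t * exp (- E t))"
          by (rule DERIV_continuous_on[OF D])
        then show "continuous_on {a..t} (\<lambda>t. Q t * exp (- E t))"
          by (rule continuous_on_subset) (use t in auto)
        fix s assume s: "a < s" "s < t"
        then have sb: "s \<in> {a..b}" "a < s" "s < b" using t by auto
        have "((\<lambda>t. Q t * exp (- E t)) has_real_derivative (Q' s - c s * Q s) * exp (- E s)) (at s)"
          using D[OF sb(1)] sb by (simp add: at_within_Icc_at)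
        moreover have "(Q' s - c s * Q s) * exp (- E s) \<le> 0"
          using leQ[OF sb(1)] by (intro mult_nonpos_nonneg) auto
        ultimately show "\<exists>y. ((\<lambda>t. Q t * exp (- E t)) has_real_derivative y) (at s) \<and> y \<le> 0" by blast
      qed
    qed auto
    then show ?thesis by (simp add: E_def exp_minus field_simps)
  qed
  show "(\<And>t. t \<in> {a..b} \<Longrightarrow> P' t \<le> c t * P t) \<Longrightarrow> P t \<le> P a * exp (integral {a..t} c)"
    by (rule le[OF d])
  assume eq: "\<And>t. t \<in> {a..b} \<Longrightarrow> P' t = c t * P t"
  have "P t \<le> P a * exp (integral {a..t} c)" using eq by (intro le[OF d]) auto
  moreover have "- P t \<le> (- P a) * exp (integral {a..t} c)"
    by (rule le[of "\<lambda>t. - P t" "\<lambda>t. - P' t"]) (use eq d in \<open>auto intro: derivative_intros\<close>)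
  ultimately show "P t = P a * exp (integral {a..t} c)" by simp
qed

text \<open>Along a solution of \<open>p' \<le> -p\<^sup>2/2 + m\<close> starting below \<open>-K\<close>, the reciprocal \<open>1/p\<close> grows at rate
  at least \<open>1/4\<close> while staying negative.\<close>

lemma Riccati_lower_bound:
  fixes p :: "real \<Rightarrow> real"
  assumes d: "\<And>t. t \<in> {a..b} \<Longrightarrow> (p has_real_derivative p' t) (at t within {a..b})"
    and le: "\<And>t. t \<in> {a..b} \<Longrightarrow> p' t \<le> - (p t)\<^sup>2 / 2 + m"
    and K: "K > 0" "4 * m \<le> K\<^sup>2" and b: "b - a \<ge> 4 / K"
  shows "p a > - K"
proof (rule ccontr)
  assume "\<not> p a > - K"
  then have pa: "p a \<le> - K" by simp
  have "4 / K > 0" using K by simp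
  then have ab: "a < b" using b by linarith
  have pc: "continuous_on {a..b} p" by (rule DERIV_continuous_on[OF d])
  \<comment> \<open>Since 2m is at most K^2, the inequality reads (p + K)' <= -(p - K)/2 * (p + K).
    It is linear in p + K once p is regarded as known, so p + K stays nonpositive.\<close>
  have pK: "p t \<le> - K" if t: "t \<in> {a..b}" for t
  proof -
    have "(\<lambda>t. p t + K) t \<le> (\<lambda>t. p t + K) a * exp (integral {a..t} (\<lambda>t. - (p t - K) / 2))"
    proof (rule integrating_factor(1)[OF _ _ t])
      show "((\<lambda>t. p t + K) has_real_derivative p' t) (at t within {a..b})" if "t \<in> {a..b}" for t
        using d[OF that] by (auto intro!: derivative_eq_intros)
      show "continuous_on {a..b} (\<lambda>t. - (p t - K) / 2)" by (intro continuous_intros pc) auto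
      show "p' t \<le> - (p t - K) / 2 * (p t + K)" if "t \<in> {a..b}" for t
      proof -
        have "2 * m \<le> K\<^sup>2" using K zero_le_power2[of K] by linarith
        then show ?thesis using le[OF that] by (simp add: algebra_simps power2_eq_square)
      qed
    qed
    also have "\<dots> \<le> 0" using pa by (intro mult_nonpos_nonneg) auto
    finally show ?thesis by simp
  qed
  have pneg: "p t < 0" if "t \<in> {a..b}" for t using pK[OF that] K by simp
  have D: "((\<lambda>t. inverse (p t) - t / 4) has_real_derivative - p' t / (p t)\<^sup>2 - 1/4) (at t within {a..b})"
    if "t \<in> {a..b}" for t
  proof -
    have "((\<lambda>t. inverse (p t) - t / 4) has_real_derivative - (inverse (p t) * p' t * inverse (p t)) - 1/4) (at t within {a..b})"
      by (intro DERIV_diff DERIV_inverse' d that DERIV_cdivide DERIV_ident) (use pneg[OF that] in simp)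
    moreover have "inverse (p t) * p' t * inverse (p t) = p' t / (p t)\<^sup>2"
      by (simp add: divide_simps power2_eq_square)
    ultimately show ?thesis by simp
  qed
  have "inverse (p a) - a / 4 \<le> inverse (p b) - b / 4"
  proof (rule DERIV_nonneg_imp_increasing_open[where f="\<lambda>t. inverse (p t) - t / 4"])
    show "a \<le> b" using ab by simp
    show "continuous_on {a..b} (\<lambda>t. inverse (p t) - t / 4)"
      by (rule DERIV_continuous_on[OF D])
    fix s assume s: "a < s" "s < b"
    then have sb: "s \<in> {a..b}" by simp
    \<comment> \<open>Here m is at most K^2/4 and so at most p^2/4, which leaves -p' at least
      p^2/4.\<close>
    have "K\<^sup>2 \<le> (p s)\<^sup>2" using pK[OF sb] K by (simp add: abs_le_square_iff[symmetric])
    then have "1/4 * (p s)\<^sup>2 \<le> - p' s" using le[OF sb] K by simp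
    moreover have "0 < (p s)\<^sup>2" using pneg[OF sb] by simp
    ultimately have "1/4 \<le> - p' s / (p s)\<^sup>2" by (subst pos_le_divide_eq) auto
    moreover have "((\<lambda>t. inverse (p t) - t / 4) has_real_derivative - p' s / (p s)\<^sup>2 - 1/4) (at s)"
      using D[OF sb] s by (simp add: at_within_Icc_at)
    ultimately show "\<exists>y. ((\<lambda>t. inverse (p t) - t / 4) has_real_derivative y) (at s) \<and> y \<ge> 0"
      by (intro exI[of _ "- p' s / (p s)\<^sup>2 - 1/4"]) auto
  qed
  moreover have "inverse (p b) < 0" using pneg[of b] ab by simp
  moreover have "inverse (p a) \<ge> - inverse K"
    using pa K le_imp_inverse_le[of K "- p a"] by simp
  \<comment> \<open>The reciprocal starts at or above -1/K and gains at least (b - a)/4, which is at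
    least 1/K. It would be nonnegative at b, although p is negative there.\<close>
  moreover have "inverse K \<le> (b - a) / 4" proof -
    have "(4 / K) / 4 \<le> (b - a) / 4" using b by (intro divide_right_mono) auto
    then show ?thesis by (simp add: inverse_eq_divide)
  qed
  moreover have False if "x - a / 4 \<le> y - b / 4" "y < 0" "- z \<le> x" "z \<le> (b - a) / 4" for x y z :: real
    using that by (simp add: diff_divide_distrib)
  ultimately show False by blast
qed

text \<open>B, the x-derivative of A, need not have a time derivative of its own. Difference
  quotients of A along the curve do, and if these time derivatives converge uniformly then the limit
  is the time derivative of B along the curve. The lemma is applied with A = u, B = u_x and with A
  the primitive of \<rho>, B = \<rho>.\<close>

lemma curve_limit_ODE:
  fixes A B De :: "real \<Rightarrow> real \<Rightarrow> real"
  assumes \<tau>: "0 < \<tau>"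
    and der: "\<And>\<epsilon> t. \<epsilon> > 0 \<Longrightarrow> 0 < t \<Longrightarrow> t < \<tau> \<Longrightarrow>
      ((\<lambda>s. (A s (q s + \<epsilon>) - A s (q s)) / \<epsilon>) has_real_derivative De \<epsilon> t) (at t)"
    and unif: "\<And>e. e > 0 \<Longrightarrow> \<exists>d>0. \<forall>\<epsilon>. 0 < \<epsilon> \<and> \<epsilon> \<le> d \<longrightarrow> (\<forall>t\<in>{0<..<\<tau>}. \<bar>De \<epsilon> t - D t\<bar> \<le> e)"
    and Ax: "\<And>t y. t \<in> {0..\<tau>} \<Longrightarrow> (A t has_real_derivative B t y) (at y)"
    and Bc: "continuous_on {0..\<tau>} (\<lambda>t. B t (q t))" and Dc: "continuous_on {0..\<tau>} D"
    and t: "t \<in> {0..\<tau>}"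
  shows "((\<lambda>t. B t (q t)) has_real_derivative D t) (at t within {0..\<tau>})"
proof (rule has_real_derivative_closed_extension[OF Bc Dc _ t])
  fix t assume t: "0 < t" "t < \<tau>"
  \<comment> \<open>A positive sequence of steps, because the theorem on derivatives of uniform
    limits concerns sequences.\<close>
  define \<epsilon> where "\<epsilon> n = inverse (real (Suc n))" for n
  have \<epsilon>: "\<epsilon> n > 0" for n by (simp add: \<epsilon>_def)
  have \<epsilon>0: "\<epsilon> \<longlonglongrightarrow> 0" unfolding \<epsilon>_def by (rule LIMSEQ_inverse_real_of_nat)
  define f where "f n s = (A s (q s + \<epsilon> n) - A s (q s)) / \<epsilon> n" for n s
  have lim: "(\<lambda>n. f n s) \<longlonglongrightarrow> B s (q s)" if "s \<in> {0..\<tau>}" for s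
  proof -
    have "((\<lambda>h. (A s (q s + h) - A s (q s)) / h) \<longlongrightarrow> B s (q s)) (at 0)"
      using Ax[OF that] by (simp add: DERIV_def)
    moreover have "filterlim \<epsilon> (at 0) sequentially"
      using \<epsilon>0 \<epsilon> by (auto simp: filterlim_at intro!: always_eventually less_imp_neq[THEN not_sym])
    ultimately show ?thesis unfolding f_def by (rule filterlim_compose)
  qed
  have "\<exists>g. \<forall>s\<in>{0<..<\<tau>}. (\<lambda>n. f n s) \<longlonglongrightarrow> g s \<and> (g has_derivative (\<lambda>h. D s * h)) (at s within {0<..<\<tau>})"
  proof (rule has_derivative_sequence)
    show "(f n has_derivative (\<lambda>h. De (\<epsilon> n) s * h)) (at s within {0<..<\<tau>})" if "s \<in> {0<..<\<tau>}" for n s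
      using der[OF \<epsilon>[of n], of s] that unfolding f_def
      by (auto simp: has_field_derivative_def intro: has_derivative_at_withinI)
    show "\<forall>\<^sub>F n in sequentially. \<forall>s\<in>{0<..<\<tau>}. \<forall>h. norm (De (\<epsilon> n) s * h - D s * h) \<le> e * norm h"
      if e: "e > 0" for e
    proof -
      obtain d where d: "d > 0" "\<And>\<epsilon> t. 0 < \<epsilon> \<Longrightarrow> \<epsilon> \<le> d \<Longrightarrow> t \<in> {0<..<\<tau>} \<Longrightarrow> \<bar>De \<epsilon> t - D t\<bar> \<le> e"
        using unif[OF e] by metis
      have "\<forall>\<^sub>F n in sequentially. \<epsilon> n < d" using \<epsilon>0 d(1) by (intro order_tendstoD) auto
      then show ?thesis
      proof eventually_elim
        case (elim n)
        have "\<bar>De (\<epsilon> n) s - D s\<bar> * \<bar>h\<bar> \<le> e * \<bar>h\<bar>" if "s \<in> {0<..<\<tau>}" for s h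
          using d(2)[OF \<epsilon>[of n] _ that] elim by (intro mult_right_mono) auto
        then show ?case by (auto simp: left_diff_distrib[symmetric] abs_mult)
      qed
    qed
    show "t \<in> {0<..<\<tau>}" using t by simp
    show "(\<lambda>n. f n t) \<longlonglongrightarrow> B t (q t)" using t by (intro lim) auto
  qed simp
  then obtain g where g: "\<And>s. s \<in> {0<..<\<tau>} \<Longrightarrow> (\<lambda>n. f n s) \<longlonglongrightarrow> g s"
    "\<And>s. s \<in> {0<..<\<tau>} \<Longrightarrow> (g has_derivative (\<lambda>h. D s * h)) (at s within {0<..<\<tau>})" by blast
  have gB: "g s = B s (q s)" if "s \<in> {0<..<\<tau>}" for s
    using LIMSEQ_unique[OF g(1)[OF that] lim] that by auto
  have "(g has_real_derivative D t) (at t)"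
    using g(2)[of t] t by (simp add: has_field_derivative_def at_within_open[of t "{0<..<\<tau>}"])
  then show "((\<lambda>t. B t (q t)) has_real_derivative D t) (at t)"
    by (rule has_field_derivative_transform_within_open[where S="{0<..<\<tau>}"]) (use t gB in auto)
qed

lemma periodic_jointly_bounded:
  fixes F :: "real \<Rightarrow> real \<Rightarrow> real"
  assumes F: "continuous_on ({a..b} \<times> UNIV) (\<lambda>(t, x). F t x)"
    and per: "\<And>t. t \<in> {a..b} \<Longrightarrow> periodic_fun_simple' (F t)"
  shows "\<exists>B>0. \<forall>t\<in>{a..b}. \<forall>x. \<bar>F t x\<bar> \<le> B"
proof -
  have "compact ({a..b} \<times> {0..1::real})" by (intro compact_Times) auto
  then have "bounded ((\<lambda>(t, x). F t x) ` ({a..b} \<times> {0..1}))"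
    by (intro compact_imp_bounded compact_continuous_image continuous_on_subset[OF F]) auto
  then obtain B where B: "B > 0" "\<And>t x. t \<in> {a..b} \<Longrightarrow> x \<in> {0..1} \<Longrightarrow> \<bar>F t x\<bar> \<le> B"
    unfolding bounded_pos by fastforce
  have "\<bar>F t x\<bar> \<le> B" if "t \<in> {a..b}" for t x
    using B(2)[OF that, of "frac x"] periodic_frac[OF per[OF that], of x] frac_lt_1[of x] frac_ge_0[of x] by simp
  then show ?thesis using B by blast
qed

section \<open>Dynamics along trajectories\<close>

text \<open>A pointwise form of the system on a closed time interval, using only derivatives that
  exist for H^2 x H^1 solutions. As \<rho>_t lives only in L^2, the continuity equation is
  integrated from 0 to x, which produces the difference of fluxes in \<open>mass\<close>.\<close>

locale HS_classical =
  fixes k a \<tau> :: real and h :: "real \<Rightarrow> real" and u v \<rho> :: "real \<Rightarrow> real \<Rightarrow> real"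
  assumes tau: "0 < \<tau>"
    and uc: "continuous_on ({0..\<tau>} \<times> UNIV) (\<lambda>(t, x). u t x)"
    and vc: "continuous_on ({0..\<tau>} \<times> UNIV) (\<lambda>(t, x). v t x)"
    and rc: "continuous_on ({0..\<tau>} \<times> UNIV) (\<lambda>(t, x). \<rho> t x)"
    and ux: "\<And>t x. t \<in> {0..\<tau>} \<Longrightarrow> (u t has_real_derivative v t x) (at x)"
    and uper: "\<And>t. t \<in> {0..\<tau>} \<Longrightarrow> periodic_fun_simple' (u t)"
    and vper: "\<And>t. t \<in> {0..\<tau>} \<Longrightarrow> periodic_fun_simple' (v t)"
    and rper: "\<And>t. t \<in> {0..\<tau>} \<Longrightarrow> periodic_fun_simple' (\<rho> t)"
    and ut: "\<And>t x. 0 < t \<Longrightarrow> t < \<tau> \<Longrightarrow> ((\<lambda>s. u s x) has_real_derivative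
        inv_dx (\<lambda>y. k / 2 * (\<rho> t y)\<^sup>2 + 1 / 2 * (v t y)\<^sup>2 + a) x + h t - u t x * v t x) (at t)"
    and mass: "\<And>t x. 0 < t \<Longrightarrow> t < \<tau> \<Longrightarrow> ((\<lambda>s. inv_dx (\<rho> s) x) has_real_derivative
        \<rho> t 0 * u t 0 - \<rho> t x * u t x) (at t)"
begin

definition g :: "real \<Rightarrow> real \<Rightarrow> real" where
  "g t y = k / 2 * (\<rho> t y)\<^sup>2 + 1 / 2 * (v t y)\<^sup>2 + a"

lemma slice_continuous:
  assumes "continuous_on ({0..\<tau>} \<times> UNIV) (\<lambda>(t, x). F t x)" "t \<in> {0..\<tau>}"
  shows "continuous_on A (F t)"
proof -
  have "continuous_on A (\<lambda>x. (\<lambda>(t, x). F t x) (t, x))"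
    by (rule continuous_on_compose2[OF assms(1)]) (use assms(2) in \<open>auto intro!: continuous_intros\<close>)
  then show ?thesis by simp
qed

lemma curve_continuous:
  assumes "continuous_on ({0..\<tau>} \<times> UNIV) (\<lambda>(t, x). F t x)" "continuous_on {0..\<tau>} q"
  shows "continuous_on {0..\<tau>} (\<lambda>t. F t (q t))"
proof -
  have "continuous_on {0..\<tau>} (\<lambda>t. (\<lambda>(t, x). F t x) (t, q t))"
    by (rule continuous_on_compose2[OF assms(1)]) (use assms(2) in \<open>auto intro!: continuous_intros\<close>)
  then show ?thesis by simp
qed

lemma gc: "continuous_on ({0..\<tau>} \<times> UNIV) (\<lambda>(t, x). g t x)"
proof -
  have "continuous_on ({0..\<tau>} \<times> UNIV) (\<lambda>p. \<rho> (fst p) (snd p))" "continuous_on ({0..\<tau>} \<times> UNIV) (\<lambda>p. v (fst p) (snd p))"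
    using rc vc by (simp_all add: case_prod_beta)
  then show ?thesis unfolding g_def case_prod_beta
    by (intro continuous_on_add continuous_on_mult continuous_on_power continuous_on_const)
qed

lemma inv_dx_deriv:
  assumes "continuous_on ({0..\<tau>} \<times> UNIV) (\<lambda>(t, x). F t x)" "t \<in> {0..\<tau>}"
  shows "(inv_dx (F t) has_real_derivative F t x) (at x)"
  by (intro abs_cont_has_derivative abs_cont_inv_dx loc_L2_continuous slice_continuous[OF assms])

lemma trajectory_exists:
  assumes t1: "t1 \<in> {0..\<tau>}"
  obtains q where "q t1 = y" "\<And>t. t \<in> {0..\<tau>} \<Longrightarrow> (q has_real_derivative u t (q t)) (at t within {0..\<tau>})"
proof -
  \<comment> \<open>Time is frozen outside \<open>{0..\<tau>}\<close>, which gives a globally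
    defined field with global bounds.\<close>
  define c where "c t = max 0 (min \<tau> t)" for t
  have c: "c t \<in> {0..\<tau>}" for t unfolding c_def using tau by auto
  obtain L where L: "\<And>t x. t \<in> {0..\<tau>} \<Longrightarrow> \<bar>v t x\<bar> \<le> L"
    using periodic_jointly_bounded[OF vc vper] by blast
  obtain B where B: "\<And>t x. t \<in> {0..\<tau>} \<Longrightarrow> \<bar>u t x\<bar> \<le> B"
    using periodic_jointly_bounded[OF uc uper] by blast
  have "\<exists>q. q t1 = y \<and> (\<forall>t. (q has_vector_derivative u (c t) (q t)) (at t))"
  proof (rule Picard_Lindeloef)
    have cc: "continuous_on UNIV (\<lambda>p. (c (fst p), snd p :: real))" unfolding c_def by (intro continuous_intros)
    have "continuous_on UNIV (\<lambda>p. (\<lambda>(t, x). u t x) (c (fst p), snd p))"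
      by (rule continuous_on_compose2[OF uc cc]) (use c in auto)
    then show "continuous_on UNIV (\<lambda>(t, x). u (c t) x)" by (simp add: case_prod_beta)
    show "norm (u (c t) x - u (c t) z) \<le> L * norm (x - z)" for t x z
      by (rule field_differentiable_bound[of UNIV "u (c t)" "v (c t)"])
         (use ux[OF c] L[OF c] in \<open>auto intro: has_field_derivative_at_within\<close>)
    show "norm (u (c t) y) \<le> B" for t using B[OF c] by simp
  qed
  then obtain q where q: "q t1 = y" "\<And>t. (q has_real_derivative u (c t) (q t)) (at t)"
    by (auto simp: has_real_derivative_iff_has_vector_derivative)
  have "(q has_real_derivative u t (q t)) (at t within {0..\<tau>})" if "t \<in> {0..\<tau>}" for t
    using has_field_derivative_at_within[OF q(2)[of t]] that by (simp add: c_def)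
  with q(1) that show thesis by blast
qed

end

locale HS_trajectory = HS_classical +
  fixes q :: "real \<Rightarrow> real"
  assumes q: "\<And>t. t \<in> {0..\<tau>} \<Longrightarrow> (q has_real_derivative u t (q t)) (at t within {0..\<tau>})"
begin

definition V where "V t = v t (q t)"
definition R where "R t = \<rho> t (q t)"

section \<open>Evolution of the slope and the density along a trajectory\<close>

lemma qc: "continuous_on {0..\<tau>} q"
  by (rule DERIV_continuous_on[OF q])

lemma q_at: "0 < t \<Longrightarrow> t < \<tau> \<Longrightarrow> (q has_real_derivative u t (q t)) (at t)"
  using q[of t] by (simp add: at_within_Icc_at)

lemma Vc: "continuous_on {0..\<tau>} V" and Rc: "continuous_on {0..\<tau>} R"
  unfolding V_def[abs_def] R_def[abs_def] by (rule curve_continuous[OF vc qc], rule curve_continuous[OF rc qc])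

lemma difference_quotient:
  assumes "\<And>y. (f has_real_derivative f' y) (at y)" "0 < \<epsilon>"
  shows "\<exists>\<xi>. x < \<xi> \<and> \<xi> < x + \<epsilon> \<and> (f (x + \<epsilon>) - f x) / \<epsilon> = f' \<xi>"
  using MVT2[of x "x + \<epsilon>" f f'] assms by auto

lemma V_deriv:
  assumes t: "t \<in> {0..\<tau>}"
  shows "(V has_real_derivative k / 2 * (R t)\<^sup>2 - 1 / 2 * (V t)\<^sup>2 + a) (at t within {0..\<tau>})"
proof -
  \<comment> \<open>The shifted point q + \<epsilon> still moves with the velocity at q. Its
    transport terms therefore leave the residue -v(q + \<epsilon>) (u(q + \<epsilon>) - u(q)), which
    after division by \<epsilon> tends to -V^2.\<close>
  define De where "De \<epsilon> t = (inv_dx (g t) (q t + \<epsilon>) - inv_dx (g t) (q t)) / \<epsilon>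
    - v t (q t + \<epsilon>) * ((u t (q t + \<epsilon>) - u t (q t)) / \<epsilon>)" for \<epsilon> t
  have "((\<lambda>t. v t (q t)) has_real_derivative g t (q t) - (V t)\<^sup>2) (at t within {0..\<tau>})"
  proof (rule curve_limit_ODE[where De=De and A=u and B=v and q=q, OF tau _ _ ux _ _ t])
    show "continuous_on {0..\<tau>} (\<lambda>t. v t (q t))" using Vc by (simp add: V_def[abs_def])
    show "continuous_on {0..\<tau>} (\<lambda>t. g t (q t) - (V t)\<^sup>2)"
      by (intro continuous_on_diff continuous_on_power curve_continuous[OF gc qc] Vc)
    fix \<epsilon> t :: real assume e: "\<epsilon> > 0" and t: "0 < t" "t < \<tau>"
    have cu: "((\<lambda>s. u s (q s + \<delta>)) has_real_derivative
      (inv_dx (g t) (q t + \<delta>) + h t - u t (q t + \<delta>) * v t (q t + \<delta>)) + v t (q t + \<delta>) * u t (q t)) (at t)" for \<delta>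
    proof (rule joint_chain_rule[where S="{0<..<\<tau>}" and A=u and Ax=v and p="\<lambda>s. q s + \<delta>"])
      show "((\<lambda>s. u s (q t + \<delta>)) has_real_derivative
         inv_dx (g t) (q t + \<delta>) + h t - u t (q t + \<delta>) * v t (q t + \<delta>)) (at t)"
        using ut[OF t] unfolding g_def[abs_def] by simp
      show "((\<lambda>s. q s + \<delta>) has_real_derivative u t (q t)) (at t)"
        using q_at[OF t] by (auto intro!: derivative_eq_intros)
      show "continuous_on ({0<..<\<tau>} \<times> UNIV) (\<lambda>(s, y). v s y)"
        by (rule continuous_on_subset[OF vc]) auto
    qed (use t ux in auto)
    have "((\<lambda>s. (u s (q s + \<epsilon>) - u s (q s)) / \<epsilon>) has_real_derivative
       ((inv_dx (g t) (q t + \<epsilon>) + h t - u t (q t + \<epsilon>) * v t (q t + \<epsilon>)) + v t (q t + \<epsilon>) * u t (q t)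
       - ((inv_dx (g t) (q t) + h t - u t (q t) * v t (q t)) + v t (q t) * u t (q t))) / \<epsilon>) (at t)"
      using cu[of \<epsilon>] cu[of 0] by (intro DERIV_cdivide DERIV_diff) auto
    moreover have "((inv_dx (g t) (q t + \<epsilon>) + h t - u t (q t + \<epsilon>) * v t (q t + \<epsilon>)) + v t (q t + \<epsilon>) * u t (q t)
       - ((inv_dx (g t) (q t) + h t - u t (q t) * v t (q t)) + v t (q t) * u t (q t))) / \<epsilon> = De \<epsilon> t"
      using e by (simp add: De_def field_simps)
    ultimately show "((\<lambda>s. (u s (q s + \<epsilon>) - u s (q s)) / \<epsilon>) has_real_derivative De \<epsilon> t) (at t)" by simp
  next
    fix e :: real assume e: "e > 0"
    obtain L where L: "L > 0" "\<And>t x. t \<in> {0..\<tau>} \<Longrightarrow> \<bar>v t x\<bar> \<le> L"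
      using periodic_jointly_bounded[OF vc vper] by blast
    obtain d1 where d1: "d1 > 0" "\<And>s y. s \<in> {0..\<tau>} \<Longrightarrow> \<bar>y - q s\<bar> \<le> d1 \<Longrightarrow> \<bar>g s y - g s (q s)\<bar> < e/2"
      using uniform_near_curve[OF gc qc, of "e/2"] e by auto
    \<comment> \<open>The error of the product of two slopes is at most 2 L * e/(4 L) = e/2; the
      other half of e is spent on g.\<close>
    obtain d2 where d2: "d2 > 0" "\<And>s y. s \<in> {0..\<tau>} \<Longrightarrow> \<bar>y - q s\<bar> \<le> d2 \<Longrightarrow> \<bar>v s y - v s (q s)\<bar> < e/(4*L)"
      using uniform_near_curve[OF vc qc, of "e/(4*L)"] e L by auto
    show "\<exists>d>0. \<forall>\<epsilon>. 0 < \<epsilon> \<and> \<epsilon> \<le> d \<longrightarrow> (\<forall>t\<in>{0<..<\<tau>}. \<bar>De \<epsilon> t - (g t (q t) - (V t)\<^sup>2)\<bar> \<le> e)"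
    proof (intro exI[of _ "min d1 d2"] conjI allI impI ballI)
      show "min d1 d2 > 0" using d1 d2 by simp
      fix \<epsilon> t assume \<epsilon>: "0 < \<epsilon> \<and> \<epsilon> \<le> min d1 d2" and t: "t \<in> {0<..<\<tau>}"
      then have t': "t \<in> {0..\<tau>}" by simp
      obtain \<xi> where \<xi>: "q t < \<xi>" "\<xi> < q t + \<epsilon>" "(inv_dx (g t) (q t + \<epsilon>) - inv_dx (g t) (q t)) / \<epsilon> = g t \<xi>"
        using difference_quotient[OF inv_dx_deriv[OF gc t']] \<epsilon> by blast
      obtain \<zeta> where \<zeta>: "q t < \<zeta>" "\<zeta> < q t + \<epsilon>" "(u t (q t + \<epsilon>) - u t (q t)) / \<epsilon> = v t \<zeta>"
        using difference_quotient[OF ux[OF t']] \<epsilon> by blast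
      define w where "w = v t (q t)"
      have 1: "\<bar>g t \<xi> - g t (q t)\<bar> < e/2" using d1(2)[OF t'] \<xi> \<epsilon> by auto
      have 2: "\<bar>v t (q t + \<epsilon>) - w\<bar> < e/(4*L)" "\<bar>v t \<zeta> - w\<bar> < e/(4*L)" unfolding w_def using d2(2)[OF t'] \<zeta> \<epsilon> by auto
      have "\<bar>v t (q t + \<epsilon>) * v t \<zeta> - w\<^sup>2\<bar> = \<bar>(v t (q t + \<epsilon>) - w) * v t \<zeta> + w * (v t \<zeta> - w)\<bar>"
        by (simp add: algebra_simps power2_eq_square)
      also have "\<dots> \<le> \<bar>v t (q t + \<epsilon>) - w\<bar> * \<bar>v t \<zeta>\<bar> + \<bar>w\<bar> * \<bar>v t \<zeta> - w\<bar>"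
        by (rule order_trans[OF abs_triangle_ineq]) (simp add: abs_mult)
      also have "\<dots> \<le> e/(4*L) * L + L * (e/(4*L))"
        using 2 L(2)[OF t'] L(1) e unfolding w_def by (intro add_mono mult_mono) (auto intro: less_imp_le)
      also have "\<dots> = e/2" using L by (simp add: field_simps)
      finally show "\<bar>De \<epsilon> t - (g t (q t) - (V t)\<^sup>2)\<bar> \<le> e"
        using 1 unfolding De_def \<xi>(3) \<zeta>(3) V_def w_def[symmetric] by linarith
    qed
  qed
  then show ?thesis by (simp add: V_def[abs_def] R_def g_def field_simps)
qed

lemma R_deriv:
  assumes t: "t \<in> {0..\<tau>}"
  shows "(R has_real_derivative - V t * R t) (at t within {0..\<tau>})"
proof -
  \<comment> \<open>The primitive of \<rho> takes the role of u. The flux through 0 occurs at both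
    points and cancels in the difference.\<close>
  define De where "De \<epsilon> t = - \<rho> t (q t + \<epsilon>) * ((u t (q t + \<epsilon>) - u t (q t)) / \<epsilon>)" for \<epsilon> t
  have "((\<lambda>t. \<rho> t (q t)) has_real_derivative - V t * R t) (at t within {0..\<tau>})"
  proof (rule curve_limit_ODE[where De=De and A="\<lambda>s. inv_dx (\<rho> s)" and B=\<rho> and q=q, OF tau _ _ inv_dx_deriv[OF rc] _ _ t])
    show "continuous_on {0..\<tau>} (\<lambda>t. \<rho> t (q t))" using Rc by (simp add: R_def[abs_def])
    show "continuous_on {0..\<tau>} (\<lambda>t. - V t * R t)"
      by (intro continuous_on_mult continuous_on_minus Vc Rc)
    fix \<epsilon> t :: real assume e: "\<epsilon> > 0" and t: "0 < t" "t < \<tau>"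
    have cu: "((\<lambda>s. inv_dx (\<rho> s) (q s + \<delta>)) has_real_derivative
      (\<rho> t 0 * u t 0 - \<rho> t (q t + \<delta>) * u t (q t + \<delta>)) + \<rho> t (q t + \<delta>) * u t (q t)) (at t)" for \<delta>
    proof (rule joint_chain_rule[where S="{0<..<\<tau>}" and A="\<lambda>s. inv_dx (\<rho> s)" and Ax=\<rho> and p="\<lambda>s. q s + \<delta>"])
      show "((\<lambda>s. inv_dx (\<rho> s) (q t + \<delta>)) has_real_derivative
         \<rho> t 0 * u t 0 - \<rho> t (q t + \<delta>) * u t (q t + \<delta>)) (at t)"
        using mass[OF t] by simp
      show "((\<lambda>s. q s + \<delta>) has_real_derivative u t (q t)) (at t)"
        using q_at[OF t] by (auto intro!: derivative_eq_intros)
      show "continuous_on ({0<..<\<tau>} \<times> UNIV) (\<lambda>(s, y). \<rho> s y)"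
        by (rule continuous_on_subset[OF rc]) auto
    qed (use t inv_dx_deriv[OF rc] in auto)
    have "((\<lambda>s. (inv_dx (\<rho> s) (q s + \<epsilon>) - inv_dx (\<rho> s) (q s)) / \<epsilon>) has_real_derivative
       ((\<rho> t 0 * u t 0 - \<rho> t (q t + \<epsilon>) * u t (q t + \<epsilon>)) + \<rho> t (q t + \<epsilon>) * u t (q t)
       - ((\<rho> t 0 * u t 0 - \<rho> t (q t) * u t (q t)) + \<rho> t (q t) * u t (q t))) / \<epsilon>) (at t)"
      using cu[of \<epsilon>] cu[of 0] by (intro DERIV_cdivide DERIV_diff) auto
    moreover have "((\<rho> t 0 * u t 0 - \<rho> t (q t + \<epsilon>) * u t (q t + \<epsilon>)) + \<rho> t (q t + \<epsilon>) * u t (q t)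
       - ((\<rho> t 0 * u t 0 - \<rho> t (q t) * u t (q t)) + \<rho> t (q t) * u t (q t))) / \<epsilon> = De \<epsilon> t"
      using e by (simp add: De_def field_simps)
    ultimately show "((\<lambda>s. (inv_dx (\<rho> s) (q s + \<epsilon>) - inv_dx (\<rho> s) (q s)) / \<epsilon>) has_real_derivative De \<epsilon> t) (at t)" by simp
  next
    fix e :: real assume e: "e > 0"
    obtain L1 where L1: "L1 > 0" "\<And>t x. t \<in> {0..\<tau>} \<Longrightarrow> \<bar>v t x\<bar> \<le> L1"
      using periodic_jointly_bounded[OF vc vper] by blast
    obtain L2 where L2: "L2 > 0" "\<And>t x. t \<in> {0..\<tau>} \<Longrightarrow> \<bar>\<rho> t x\<bar> \<le> L2"
      using periodic_jointly_bounded[OF rc rper] by blast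
    obtain d1 where d1: "d1 > 0" "\<And>s y. s \<in> {0..\<tau>} \<Longrightarrow> \<bar>y - q s\<bar> \<le> d1 \<Longrightarrow> \<bar>\<rho> s y - \<rho> s (q s)\<bar> < e/(2*L1)"
      using uniform_near_curve[OF rc qc, of "e/(2*L1)"] e L1 by auto
    obtain d2 where d2: "d2 > 0" "\<And>s y. s \<in> {0..\<tau>} \<Longrightarrow> \<bar>y - q s\<bar> \<le> d2 \<Longrightarrow> \<bar>v s y - v s (q s)\<bar> < e/(2*L2)"
      using uniform_near_curve[OF vc qc, of "e/(2*L2)"] e L2 by auto
    show "\<exists>d>0. \<forall>\<epsilon>. 0 < \<epsilon> \<and> \<epsilon> \<le> d \<longrightarrow> (\<forall>t\<in>{0<..<\<tau>}. \<bar>De \<epsilon> t - - V t * R t\<bar> \<le> e)"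
    proof (intro exI[of _ "min d1 d2"] conjI allI impI ballI)
      show "min d1 d2 > 0" using d1 d2 by simp
      fix \<epsilon> t assume \<epsilon>: "0 < \<epsilon> \<and> \<epsilon> \<le> min d1 d2" and t: "t \<in> {0<..<\<tau>}"
      then have t': "t \<in> {0..\<tau>}" by simp
      obtain \<zeta> where \<zeta>: "q t < \<zeta>" "\<zeta> < q t + \<epsilon>" "(u t (q t + \<epsilon>) - u t (q t)) / \<epsilon> = v t \<zeta>"
        using difference_quotient[OF ux[OF t']] \<epsilon> by blast
      have 1: "\<bar>\<rho> t (q t + \<epsilon>) - R t\<bar> < e/(2*L1)" unfolding R_def using d1(2)[OF t'] \<epsilon> by auto
      have 2: "\<bar>v t \<zeta> - V t\<bar> < e/(2*L2)" unfolding V_def using d2(2)[OF t'] \<zeta> \<epsilon> by auto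
      have "\<bar>De \<epsilon> t - - V t * R t\<bar> = \<bar>(\<rho> t (q t + \<epsilon>) - R t) * v t \<zeta> + R t * (v t \<zeta> - V t)\<bar>"
        unfolding De_def \<zeta>(3) by (simp add: algebra_simps abs_minus_commute)
      also have "\<dots> \<le> \<bar>\<rho> t (q t + \<epsilon>) - R t\<bar> * \<bar>v t \<zeta>\<bar> + \<bar>R t\<bar> * \<bar>v t \<zeta> - V t\<bar>"
        by (rule order_trans[OF abs_triangle_ineq]) (simp add: abs_mult)
      also have "\<dots> \<le> e/(2*L1) * L1 + L2 * (e/(2*L2))"
        using 1 2 L1 L2(2)[OF t', of "q t"] L2(1) e L1(2)[OF t', of \<zeta>] unfolding R_def
        by (intro add_mono mult_mono) (auto intro: less_imp_le)
      also have "\<dots> = e" using L1 L2 by (simp add: field_simps)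
      finally show "\<bar>De \<epsilon> t - - V t * R t\<bar> \<le> e" .
    qed
  qed
  then show ?thesis by (simp add: R_def[abs_def])
qed

text \<open>Its exponential is the Jacobian of the flow along the trajectory, that is, the solution
  of \<phi>' = V \<phi> with \<phi>(0) = 1.\<close>

definition E where "E t = integral {0..t} V"

lemma E_deriv: "t \<in> {0..\<tau>} \<Longrightarrow> (E has_real_derivative V t) (at t within {0..\<tau>})"
  unfolding E_def[abs_def] using Vc by (intro integral_has_real_derivative)

lemma E_0 [simp]: "E 0 = 0"
  by (simp add: E_def)

lemma R_eq:
  assumes t: "t \<in> {0..\<tau>}" shows "R t = R 0 * exp (- E t)"
proof -
  have "R t = R 0 * exp (integral {0..t} (\<lambda>t. - V t))"
    by (rule integrating_factor(2)[OF R_deriv _ t]) (auto intro!: continuous_intros Vc)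
  then show ?thesis by (simp add: E_def)
qed

text \<open>The quantity \<open>V\<^sup>2 + R\<^sup>2 - 2a\<close> decays at the same rate as \<open>R\<close> when \<open>k = 1\<close>.\<close>

lemma N_eq:
  assumes t: "t \<in> {0..\<tau>}" and k: "k = 1"
  shows "(V t)\<^sup>2 + (R t)\<^sup>2 - 2 * a = ((V 0)\<^sup>2 + (R 0)\<^sup>2 - 2 * a) * exp (- E t)"
proof -
  have "(V t)\<^sup>2 + (R t)\<^sup>2 - 2 * a = ((V 0)\<^sup>2 + (R 0)\<^sup>2 - 2 * a) * exp (integral {0..t} (\<lambda>t. - V t))"
  proof (rule integrating_factor(2)[where P="\<lambda>t. (V t)\<^sup>2 + (R t)\<^sup>2 - 2 * a", OF _ _ t])
    fix t assume t: "t \<in> {0..\<tau>}"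
    show "((\<lambda>t. (V t)\<^sup>2 + (R t)\<^sup>2 - 2 * a) has_real_derivative
       2 * V t * (k / 2 * (R t)\<^sup>2 - 1 / 2 * (V t)\<^sup>2 + a) + 2 * R t * (- V t * R t)) (at t within {0..\<tau>})"
      by (rule derivative_eq_intros V_deriv[OF t] R_deriv[OF t] refl)+ simp
    show "2 * V t * (k / 2 * (R t)\<^sup>2 - 1 / 2 * (V t)\<^sup>2 + a) + 2 * R t * (- V t * R t)
        = - V t * ((V t)\<^sup>2 + (R t)\<^sup>2 - 2 * a)"
      unfolding k by (simp add: power2_eq_square algebra_simps)
  qed (auto intro!: continuous_intros Vc)
  then show ?thesis by (simp add: E_def)
qed

text \<open>Both sides solve the same linear second-order equation with the same initial value and
  slope, and a Gronwall estimate for the difference and its derivative shows that they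
  agree.\<close>

lemma density_formula:
  assumes C: "\<And>t. (C has_real_derivative S t) (at t)" "C 0 = 0"
    and S: "\<And>t. (S has_real_derivative 1 + 2 * a * C t) (at t)" "S 0 = 0"
    and t: "t \<in> {0..\<tau>}"
  shows "exp (E t) = 1 + V 0 * S t + (k / 2 * (R 0)\<^sup>2 + 1 / 2 * (V 0)\<^sup>2 + a) * C t"
proof -
  define P where "P = k / 2 * (R 0)\<^sup>2 + 1 / 2 * (V 0)\<^sup>2 + a"
  \<comment> \<open>The second derivative of exp E, namely (V' + V^2) exp E with V' replaced by its
    equation.\<close>
  define f where "f t = (k / 2 * (R t)\<^sup>2 + 1 / 2 * (V t)\<^sup>2 + a) * exp (E t)" for t
  define d1 where "d1 t = exp (E t) - (1 + V 0 * S t + P * C t)" for t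
  define d2 where "d2 t = V t * exp (E t) - (V 0 * (1 + 2 * a * C t) + P * S t)" for t
  have expE: "((\<lambda>t. exp (E t)) has_real_derivative V t * exp (E t)) (at t within {0..\<tau>})" if "t \<in> {0..\<tau>}" for t
    using E_deriv[OF that] by (auto intro!: derivative_eq_intros)
  note Cw = has_field_derivative_at_within[OF C(1)] and Sw = has_field_derivative_at_within[OF S(1)]
  have fconst: "f t - 2 * a * exp (E t) = P - 2 * a" if t: "t \<in> {0..\<tau>}" for t
  proof -
    have "f t - 2 * a * exp (E t) = (f 0 - 2 * a * exp (E 0)) * exp (integral {0..t} (\<lambda>_. 0))"
    proof (rule integrating_factor(2)[where P="\<lambda>t. f t - 2 * a * exp (E t)", OF _ _ t])
      fix t assume t: "t \<in> {0..\<tau>}"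
      show "((\<lambda>t. f t - 2 * a * exp (E t)) has_real_derivative
         (k * R t * (- V t * R t) + V t * (k / 2 * (R t)\<^sup>2 - 1 / 2 * (V t)\<^sup>2 + a)) * exp (E t)
         + (k / 2 * (R t)\<^sup>2 + 1 / 2 * (V t)\<^sup>2 + a) * (V t * exp (E t)) - 2 * a * (V t * exp (E t))) (at t within {0..\<tau>})"
        unfolding f_def by (rule derivative_eq_intros V_deriv[OF t] R_deriv[OF t] expE[OF t] refl)+ simp
      show "(k * R t * (- V t * R t) + V t * (k / 2 * (R t)\<^sup>2 - 1 / 2 * (V t)\<^sup>2 + a)) * exp (E t)
         + (k / 2 * (R t)\<^sup>2 + 1 / 2 * (V t)\<^sup>2 + a) * (V t * exp (E t)) - 2 * a * (V t * exp (E t))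
         = 0 * (f t - 2 * a * exp (E t))"
        by (simp add: power2_eq_square algebra_simps)
    qed auto
    then show ?thesis by (simp add: f_def P_def)
  qed
  have D1: "(d1 has_real_derivative d2 t) (at t within {0..\<tau>})" if t: "t \<in> {0..\<tau>}" for t
    unfolding d1_def[abs_def] d2_def by (rule derivative_eq_intros expE[OF t] Cw Sw refl)+ simp
  have D2: "(d2 has_real_derivative 2 * a * d1 t) (at t within {0..\<tau>})" if t: "t \<in> {0..\<tau>}" for t
  proof -
    have "(d2 has_real_derivative
      (k / 2 * (R t)\<^sup>2 - 1 / 2 * (V t)\<^sup>2 + a) * exp (E t) + V t * (V t * exp (E t))
      - (V 0 * (2 * a * S t) + P * (1 + 2 * a * C t))) (at t within {0..\<tau>})"
      unfolding d2_def[abs_def] by (rule derivative_eq_intros V_deriv[OF t] expE[OF t] Cw Sw refl)+ simp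
    moreover have "(k / 2 * (R t)\<^sup>2 - 1 / 2 * (V t)\<^sup>2 + a) * exp (E t) + V t * (V t * exp (E t)) = f t"
      by (simp add: f_def power2_eq_square algebra_simps)
    moreover have "f t - (V 0 * (2 * a * S t) + P * (1 + 2 * a * C t)) = 2 * a * d1 t"
      using fconst[OF t] by (simp add: d1_def algebra_simps)
    ultimately show ?thesis by simp
  qed
  \<comment> \<open>The squared length of (d1, d2) has derivative 2 (1 + 2a) d1 d2, at most |1 + 2a|
    times that squared length.\<close>
  have "(d1 t)\<^sup>2 + (d2 t)\<^sup>2 \<le> ((d1 0)\<^sup>2 + (d2 0)\<^sup>2) * exp (integral {0..t} (\<lambda>_. \<bar>1 + 2 * a\<bar>))"
  proof (rule integrating_factor(1)[where P="\<lambda>t. (d1 t)\<^sup>2 + (d2 t)\<^sup>2", OF _ _ t])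
    fix t assume t: "t \<in> {0..\<tau>}"
    show "((\<lambda>t. (d1 t)\<^sup>2 + (d2 t)\<^sup>2) has_real_derivative 2 * d1 t * d2 t + 2 * d2 t * (2 * a * d1 t)) (at t within {0..\<tau>})"
      by (rule derivative_eq_intros D1[OF t] D2[OF t] refl)+ simp
    have "2 * d1 t * d2 t + 2 * d2 t * (2 * a * d1 t) = (1 + 2 * a) * (2 * d1 t * d2 t)" by (simp add: algebra_simps)
    also have "\<dots> \<le> \<bar>1 + 2 * a\<bar> * \<bar>2 * d1 t * d2 t\<bar>" by (metis abs_ge_self abs_mult)
    also have "\<dots> \<le> \<bar>1 + 2 * a\<bar> * ((d1 t)\<^sup>2 + (d2 t)\<^sup>2)"
      using sum_squares_bound[of "\<bar>d1 t\<bar>" "\<bar>d2 t\<bar>"] by (intro mult_left_mono) (auto simp: abs_mult)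
    finally show "2 * d1 t * d2 t + 2 * d2 t * (2 * a * d1 t) \<le> \<bar>1 + 2 * a\<bar> * ((d1 t)\<^sup>2 + (d2 t)\<^sup>2)" .
  qed auto
  moreover have "d1 0 = 0" "d2 0 = 0" using C(2) S(2) by (simp_all add: d1_def d2_def)
  ultimately have "(d1 t)\<^sup>2 + (d2 t)\<^sup>2 \<le> 0" by simp
  then have "d1 t = 0" by (simp add: sum_power2_le_zero_iff)
  then show ?thesis by (simp add: d1_def P_def)
qed

section \<open>A priori bounds for the slope along trajectories\<close>

lemma E_lower:
  assumes st: "0 \<le> s" "s \<le> t" "t \<le> \<tau>" and M: "\<And>r. r \<in> {s..t} \<Longrightarrow> V r \<ge> - M"
  shows "exp (E t) \<ge> exp (E s) * exp (- M * (t - s))"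
proof -
  have i: "V integrable_on {0..t}"
    using st by (intro integrable_continuous_real continuous_on_subset[OF Vc]) auto
  have "E t = E s + integral {s..t} V"
    unfolding E_def using Henstock_Kurzweil_Integration.integral_combine[OF st(1,2) i] by simp
  moreover have "integral {s..t} (\<lambda>_. - M) \<le> integral {s..t} V"
    using i M st by (intro integral_le) (auto intro: integrable_subinterval_real)
  moreover have "integral {s..t} (\<lambda>_. - M) = - M * (t - s)" using st by simp
  ultimately have "E t \<ge> E s + - M * (t - s)" by linarith
  then show ?thesis by (metis exp_add exp_le_cancel_iff)
qed

lemma V_lower_bound_neg:
  assumes k: "k = -1" and t1: "0 \<le> t1" and K: "K > 0" "4 * a \<le> K\<^sup>2" and \<tau>: "t1 + 4 / K \<le> \<tau>"
  shows "V t1 > - K"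
proof -
  have "4 / K > 0" using K by simp
  \<comment> \<open>Here \<sigma> is 1 or -1. For k = -1 the two equations combine into a Riccati
    equation for V + \<sigma> R, and adding the two resulting bounds eliminates R.\<close>
  have *: "V t1 + \<sigma> * R t1 > - K" if \<sigma>: "\<sigma> * \<sigma> = 1" for \<sigma>
  proof (rule Riccati_lower_bound[where p="\<lambda>t. V t + \<sigma> * R t" and b="t1 + 4 / K" and m=a])
    fix t assume t: "t \<in> {t1..t1 + 4 / K}"
    then have t': "t \<in> {0..\<tau>}" using t1 \<tau> by auto
    have "((\<lambda>t. V t + \<sigma> * R t) has_real_derivative
        (k / 2 * (R t)\<^sup>2 - 1 / 2 * (V t)\<^sup>2 + a) + \<sigma> * (- V t * R t)) (at t within {0..\<tau>})"
      by (rule derivative_eq_intros V_deriv[OF t'] R_deriv[OF t'] refl)+ simp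
    then show "((\<lambda>t. V t + \<sigma> * R t) has_real_derivative
        (k / 2 * (R t)\<^sup>2 - 1 / 2 * (V t)\<^sup>2 + a) + \<sigma> * (- V t * R t)) (at t within {t1..t1 + 4 / K})"
      by (rule DERIV_subset) (use t1 \<tau> in auto)
    have "(V t + \<sigma> * R t)\<^sup>2 = (V t)\<^sup>2 + 2 * \<sigma> * V t * R t + (\<sigma> * \<sigma>) * (R t)\<^sup>2"
      by (simp add: power2_eq_square algebra_simps)
    then show "(k / 2 * (R t)\<^sup>2 - 1 / 2 * (V t)\<^sup>2 + a) + \<sigma> * (- V t * R t) \<le> - (V t + \<sigma> * R t)\<^sup>2 / 2 + a"
      unfolding \<sigma> k by (simp add: field_simps)
  qed (use K in auto)
  show ?thesis using *[of 1] *[of "-1"] by simp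
qed

text \<open>V^2 + R^2 - 2a and |R| carry the same factor exp(-E), so the inequality between them at
  time 0 persists. It first gives |R| <= C and then V^2 <= C |R| <= C^2.\<close>

lemma V_bound_pos:
  assumes k: "k = 1" and a: "a \<le> 0" and C: "(V 0)\<^sup>2 + (R 0)\<^sup>2 - 2 * a \<le> C * \<bar>R 0\<bar>" "C \<ge> 0" and t: "t \<in> {0..\<tau>}"
  shows "\<bar>V t\<bar> \<le> C"
proof -
  have "(V t)\<^sup>2 + (R t)\<^sup>2 - 2 * a \<le> (C * \<bar>R 0\<bar>) * exp (- E t)"
    unfolding N_eq[OF t k] by (intro mult_right_mono C) auto
  also have "\<dots> = C * \<bar>R t\<bar>" using R_eq[OF t] by (simp add: abs_mult)
  finally have N: "(V t)\<^sup>2 + (R t)\<^sup>2 \<le> C * \<bar>R t\<bar>" using a by simp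
  then have "(R t)\<^sup>2 \<le> C * \<bar>R t\<bar>" using zero_le_power2[of "V t"] by linarith
  then have "\<bar>R t\<bar> * \<bar>R t\<bar> \<le> C * \<bar>R t\<bar>" by (simp only: power2_eq_square abs_mult_self_eq)
  then have "R t = 0 \<or> \<bar>R t\<bar> \<le> C" unfolding mult_le_cancel_right by linarith
  then have "\<bar>R t\<bar> \<le> C" using C(2) by auto
  then have "C * \<bar>R t\<bar> \<le> C * C" using C(2) by (intro mult_left_mono)
  then have "(V t)\<^sup>2 \<le> C\<^sup>2" using N zero_le_power2[of "R t"] unfolding power2_eq_square[of C] by linarith
  then show ?thesis using C(2) by (metis abs_le_square_iff abs_of_nonneg)
qed

text \<open>R stays zero, so V' <= a < 0 brings V down to -K within time |V 0 + K| / (-a). From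
  there the Riccati bound with m = 0 permits less than 4/K of further existence.\<close>

lemma blowup_bound_pos:
  assumes a: "a < 0" and R0: "R 0 = 0" and K: "K > 0"
  shows "\<tau> < \<bar>V 0 + K\<bar> / (- a) + 4 / K"
proof (rule ccontr)
  assume "\<not> \<tau> < \<bar>V 0 + K\<bar> / (- a) + 4 / K"
  define t1 where "t1 = \<bar>V 0 + K\<bar> / (- a)"
  have t1: "t1 \<ge> 0" unfolding t1_def using a by (intro divide_nonneg_pos) auto
  have "4 / K > 0" using K by simp
  have \<tau>: "t1 + 4 / K \<le> \<tau>" using \<open>\<not> \<tau> < _\<close> by (simp add: t1_def)
  have R: "R t = 0" if "t \<in> {0..\<tau>}" for t using R_eq[OF that] R0 by simp
  have D: "(V has_real_derivative - 1 / 2 * (V t)\<^sup>2 + a) (at t within {0..\<tau>})" if "t \<in> {0..\<tau>}" for t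
    using V_deriv[OF that] R[OF that] by simp
  have "V t1 > - K"
  proof (rule Riccati_lower_bound[where p=V and b="t1 + 4 / K" and m=0 and p'="\<lambda>t. - 1 / 2 * (V t)\<^sup>2 + a"])
    fix t assume t: "t \<in> {t1..t1 + 4 / K}"
    show "(V has_real_derivative - 1 / 2 * (V t)\<^sup>2 + a) (at t within {t1..t1 + 4 / K})"
      by (rule DERIV_subset[OF D]) (use t1 \<tau> t in auto)
    show "- 1 / 2 * (V t)\<^sup>2 + a \<le> - (V t)\<^sup>2 / 2 + 0" using a by simp
  qed (use K in auto)
  moreover have "V t1 - a * t1 \<le> V 0 - a * 0"
  proof -
    have "V t1 - a * t1 \<le> (V 0 - a * 0) * exp (integral {0..t1} (\<lambda>_. 0))"
    proof (rule integrating_factor(1)[where P="\<lambda>t. V t - a * t"])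
      show "((\<lambda>t. V t - a * t) has_real_derivative - 1 / 2 * (V t)\<^sup>2) (at t within {0..\<tau>})" if "t \<in> {0..\<tau>}" for t
        by (rule derivative_eq_intros D[OF that] refl)+ simp
      show "t1 \<in> {0..\<tau>}" using t1 \<tau> \<open>4 / K > 0\<close> unfolding atLeastAtMost_iff by linarith
    qed auto
    then show ?thesis by simp
  qed
  moreover have "a * t1 = - \<bar>V 0 + K\<bar>" using a by (simp add: t1_def)
  ultimately show False by linarith
qed

end

section \<open>Lower bound for global solutions\<close>

lemma set_integral_periods:
  fixes f :: "real \<Rightarrow> real"
  assumes per: "periodic_fun_simple' f" and i: "\<And>a b. set_integrable lborel {a..b} f"
  shows "(LBINT x:{a..a + real m}. f x) = real m * (LBINT x:{0..1}. f x)"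
proof (induction m)
  case 0 then show ?case by (simp add: set_integral_at_point)
next
  case (Suc m)
  have e: "a + real (Suc m) = a + real m + 1" by simp
  have "(LBINT x:{a..a + real (Suc m)}. f x) = (LBINT x:{a..a + real m}. f x) + (LBINT x:{a + real m..a + real m + 1}. f x)"
    unfolding e by (rule set_integral_Icc_combine[OF i]) auto
  then show ?case using Suc set_integral_period[OF per i, of "a + real m"] by (simp add: algebra_simps)
qed

text \<open>For fixed x, the primitive evaluated at x is a bounded functional on L^2 of the circle:
  Cauchy-Schwarz on an interval made of 2n periods, with n at least |x|.\<close>

lemma inv_dx_bound:
  obtains c where "c \<ge> 0"
    "\<And>f. periodic_fun_simple' f \<Longrightarrow> loc_L2 f \<Longrightarrow> \<bar>inv_dx f x\<bar> \<le> c * sqrt (LBINT y:{0..1}. (f y)\<^sup>2)"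
proof -
  obtain n where n: "\<bar>x\<bar> \<le> real n" using real_arch_simple by blast
  have "\<bar>inv_dx f x\<bar> \<le> sqrt (real n * real (2 * n)) * sqrt (LBINT y:{0..1}. (f y)\<^sup>2)"
    if per: "periodic_fun_simple' f" and f: "loc_L2 f" for f
  proof -
    have sq: "periodic_fun_simple' (\<lambda>y. (f y)\<^sup>2)" using periodicD[OF per] by (intro periodicI) simp
    have I: "(LBINT y:{-real n..real n}. (f y)\<^sup>2) = real (2 * n) * (LBINT y:{0..1}. (f y)\<^sup>2)"
      using set_integral_periods[OF sq loc_L2_sq_integrable[OF f], of "- real n" "2 * n"] by simp
    have A: "abs_cont (inv_dx f) f" by (rule abs_cont_inv_dx[OF f])
    have "(inv_dx f x)\<^sup>2 \<le> \<bar>x\<bar> * (LBINT y:{-real n..real n}. (f y)\<^sup>2)"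
      using abs_cont_Hoelder[OF A, of 0 "- real n" "real n" x] abs_cont_Hoelder[OF A, of x "- real n" "real n" 0] n
      by (cases "0 \<le> x") auto
    also have "\<dots> \<le> real n * (LBINT y:{-real n..real n}. (f y)\<^sup>2)"
      using n by (intro mult_right_mono set_integral_nonneg_real) auto
    finally have "(inv_dx f x)\<^sup>2 \<le> real n * real (2 * n) * (LBINT y:{0..1}. (f y)\<^sup>2)" unfolding I by simp
    then have "\<bar>inv_dx f x\<bar> \<le> sqrt (real n * real (2 * n) * (LBINT y:{0..1}. (f y)\<^sup>2))"
      by (intro real_le_rsqrt) simp
    then show ?thesis by (simp add: real_sqrt_mult)
  qed
  moreover have "0 \<le> sqrt (real n * real (2 * n))"
    by (intro real_sqrt_ge_zero mult_nonneg_nonneg of_nat_0_le_iff)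
  ultimately show thesis using that by blast
qed

lemma inv_dx_cong_AE:
  assumes "f \<in> borel_measurable borel" "g \<in> borel_measurable borel" "AE x in lborel. f x = g x"
  shows "inv_dx f x = inv_dx g x"
proof -
  have "(LBINT z:{a..b}. f z) = (LBINT z:{a..b}. g z)" for a b
    by (rule set_lebesgue_integral_cong_AE) (use assms in auto)
  then show ?thesis by (simp add: inv_dx_eq)
qed

lemma inv_dx_diff:
  "loc_L2 f \<Longrightarrow> loc_L2 g \<Longrightarrow> inv_dx (\<lambda>x. f x - g x) x = inv_dx f x - inv_dx g x"
  by (simp add: inv_dx_eq loc_L2_integrable)

lemma inv_dx_cmult: "inv_dx (\<lambda>x. c * f x) x = c * inv_dx f x"
  by (simp add: inv_dx_eq right_diff_distrib)

lemma inv_dx_uminus: "inv_dx (\<lambda>x. - f x) x = - inv_dx f x"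
  using inv_dx_cmult[of "-1" f x] by simp

lemma square_integrableD:
  "square_integrable f \<Longrightarrow> periodic_fun_simple' f" "square_integrable f \<Longrightarrow> f \<in> borel_measurable borel"
  by (auto simp: square_integrable_def)

text \<open>An L^2 limit of difference quotients has no values at points, but its primitive has, and
  taking the primitive at x is continuous in L^2.\<close>

lemma C1_sobolev_deriv_0:
  assumes w: "C1_sobolev_deriv T 0 w w'" and t: "t \<in> time_interval T"
  shows "((\<lambda>s. inv_dx (w s) x) has_real_derivative inv_dx (w' t) x) (at t within time_interval T)"
proof -
  have S: "square_integrable (w s)" "square_integrable (w' s)" if "s \<in> time_interval T" for s
    using w that by (auto simp: C1_sobolev_deriv_def C0_sobolev_def sobolev_def)
  have L: "loc_L2 (w s)" "loc_L2 (w' s)" if "s \<in> time_interval T" for s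
    using S[OF that] by (auto intro: square_integrable_loc_L2)
  have P: "periodic_fun_simple' (w s)" "periodic_fun_simple' (w' s)" if "s \<in> time_interval T" for s
    using S[OF that] by (auto intro: square_integrableD)
  let ?D = "\<lambda>s x. (w s x - w t x) / (s - t) - w' t x"
  have DL: "loc_L2 (?D s)" "periodic_fun_simple' (?D s)" if s: "s \<in> time_interval T" for s
  proof -
    have "loc_L2 (\<lambda>x. 1 / (s - t) * (w s x - w t x) - w' t x)"
      by (intro loc_L2_diff loc_L2_cmult L s t)
    then show "loc_L2 (?D s)" by simp
    show "periodic_fun_simple' (?D s)"
      using periodicD[OF P(1)[OF s]] periodicD[OF P(1)[OF t]] periodicD[OF P(2)[OF t]] by (intro periodicI) simp
  qed
  obtain c where c: "c \<ge> 0"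
    "\<And>f. periodic_fun_simple' f \<Longrightarrow> loc_L2 f \<Longrightarrow> \<bar>inv_dx f x\<bar> \<le> c * sqrt (LBINT y:{0..1}. (f y)\<^sup>2)"
    using inv_dx_bound[of x] by blast
  have A: "((\<lambda>s. c * sobolev_norm 0 (?D s)) \<longlongrightarrow> 0) (at t within time_interval T)"
    using w t by (intro tendsto_mult_right_zero) (auto simp: C1_sobolev_deriv_def)
  have B: "\<forall>\<^sub>F s in at t within time_interval T. norm (inv_dx (?D s) x) \<le> c * sobolev_norm 0 (?D s)"
    unfolding eventually_at_filter
  proof (intro always_eventually allI impI)
    fix s assume s: "s \<in> time_interval T"
    have "square_integrable (?D s)" by (intro square_integrableI DL s)
    then show "norm (inv_dx (?D s) x) \<le> c * sobolev_norm 0 (?D s)"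
      using c(2)[OF DL(2,1)[OF s]] by (simp add: sobolev_norm_0)
  qed
  have 0: "((\<lambda>s. inv_dx (?D s) x) \<longlongrightarrow> 0) (at t within time_interval T)"
    by (rule Lim_null_comparison[OF B A])
  have "((\<lambda>s. (inv_dx (w s) x - inv_dx (w t) x) / (s - t) - inv_dx (w' t) x) \<longlongrightarrow> 0) (at t within time_interval T)"
  proof (rule Lim_transform_eventually[OF 0])
    show "\<forall>\<^sub>F s in at t within time_interval T. inv_dx (?D s) x =
        (inv_dx (w s) x - inv_dx (w t) x) / (s - t) - inv_dx (w' t) x"
      unfolding eventually_at_filter
    proof (intro always_eventually allI impI)
      fix s assume s: "s \<in> time_interval T"
      have "inv_dx (\<lambda>x. 1 / (s - t) * (w s x - w t x) - w' t x) x =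
          1 / (s - t) * (inv_dx (w s) x - inv_dx (w t) x) - inv_dx (w' t) x"
        by (simp only: inv_dx_diff inv_dx_cmult loc_L2_diff loc_L2_cmult L s t)
      then show "inv_dx (?D s) x = (inv_dx (w s) x - inv_dx (w t) x) / (s - t) - inv_dx (w' t) x" by simp
    qed
  qed
  then show ?thesis by (simp add: has_field_derivative_iff LIM_zero_iff)
qed

section \<open>From solutions in Sobolev spaces to the dynamics along trajectories\<close>

lemma HS_solution_classical:
  assumes sol: "HS_solution k h u0 \<rho>0 T u \<rho>" and \<tau>: "0 < \<tau>" "ereal \<tau> < T"
  shows "HS_classical k (HS_const k u0 \<rho>0) \<tau> h u (\<lambda>t. deriv (u t)) \<rho>"
proof -
  let ?I = "time_interval T"
  let ?g = "\<lambda>t y. k / 2 * (\<rho> t y)\<^sup>2 + 1 / 2 * (deriv (u t) y)\<^sup>2 + HS_const k u0 \<rho>0"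
  from sol obtain u_t \<rho>_t where uH: "u \<in> C0_sobolev T 2" and rH: "\<rho> \<in> C0_sobolev T 1"
    and ut: "C1_sobolev_deriv T 1 u u_t" and rt: "C1_sobolev_deriv T 0 \<rho> \<rho>_t"
    and eq1: "\<And>t x. 0 < t \<Longrightarrow> ereal t < T \<Longrightarrow> u_t t x + u t x * deriv (u t) x = inv_dx (?g t) x + h t"
    and eq2: "\<And>t. 0 < t \<Longrightarrow> ereal t < T \<Longrightarrow> AE x in lborel. \<rho>_t t x + weak_deriv 1 (\<lambda>y. \<rho> t y * u t y) x = 0"
    unfolding HS_solution_def by blast
  have I: "{0..\<tau>} \<subseteq> ?I" using \<tau>(2) by (auto simp: time_interval_def intro: le_less_trans[rotated])
  have uS: "u t \<in> sobolev 2" "\<rho> t \<in> sobolev 1" if "t \<in> {0..\<tau>}" for t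
    using uH rH that I by (auto simp: C0_sobolev_def)
  have cont: "continuous_on ({0..\<tau>} \<times> UNIV) F" if "continuous_on (?I \<times> UNIV) F" for F :: "real \<times> real \<Rightarrow> real"
    using that by (rule continuous_on_subset) (use I in auto)
  have at: "at t within ?I = at t" "t \<in> ?I" "ereal t < T" if "0 < t" "t < \<tau>" for t
  proof -
    show "t \<in> ?I" using that I by auto
    then show "ereal t < T" by (simp add: time_interval_def)
    show "at t within ?I = at t"
      by (rule at_within_open_subset[of _ "{0<..<\<tau>}"]) (use that I in auto)
  qed
  show ?thesis
  proof (rule HS_classical.intro)
    show "0 < \<tau>" by fact
    show "continuous_on ({0..\<tau>} \<times> UNIV) (\<lambda>(t, x). u t x)" by (rule cont[OF C0_sobolev_2_continuous(1)[OF uH]])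
    show "continuous_on ({0..\<tau>} \<times> UNIV) (\<lambda>(t, x). deriv (u t) x)" by (rule cont[OF C0_sobolev_2_continuous(2)[OF uH]])
    show "continuous_on ({0..\<tau>} \<times> UNIV) (\<lambda>(t, x). \<rho> t x)" by (rule cont[OF C0_sobolev_1_continuous[OF rH]])
    show "(u t has_real_derivative deriv (u t) x) (at x)" if "t \<in> {0..\<tau>}" for t x
      using sobolev_2D[OF uS(1)[OF that]] by metis
    show "periodic_fun_simple' (u t)" "periodic_fun_simple' (deriv (u t))" "periodic_fun_simple' (\<rho> t)" if "t \<in> {0..\<tau>}" for t
      using sobolev_2D[OF uS(1)[OF that]] sobolev_1D[OF uS(2)[OF that]] by metis+
    fix t x assume t: "0 < t" "t < \<tau>"
    have "((\<lambda>s. u s x) has_real_derivative u_t t x) (at t)"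
      using C1_sobolev_deriv_1[OF ut at(2)[OF t], of x] by (simp add: at(1)[OF t])
    moreover have "u_t t x = inv_dx (?g t) x + h t - u t x * deriv (u t) x"
      using eq1[OF t(1) at(3)[OF t], of x] by simp
    ultimately show "((\<lambda>s. u s x) has_real_derivative inv_dx (?g t) x + h t - u t x * deriv (u t) x) (at t)" by simp
    have M: "((\<lambda>s. inv_dx (\<rho> s) x) has_real_derivative inv_dx (\<rho>_t t) x) (at t)"
      using C1_sobolev_deriv_0[OF rt at(2)[OF t], of x] by (simp add: at(1)[OF t])
    have tt: "t \<in> {0..\<tau>}" using t by simp
    obtain u' where u': "\<And>x. (u t has_real_derivative deriv (u t) x) (at x)" "abs_cont (deriv (u t)) u'"
      "periodic_fun_simple' (u t)" "periodic_fun_simple' (deriv (u t))"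
      using sobolev_2D[OF uS(1)[OF tt]] by metis
    have U: "abs_cont (u t) (deriv (u t))" by (rule abs_cont_C1[OF u'(1) abs_cont_continuous[OF u'(2)]])
    obtain r where r: "abs_cont (\<rho> t) r" "periodic_fun_simple' (\<rho> t)" "periodic_fun_simple' r"
      using sobolev_1D[OF uS(2)[OF tt]] by metis
    \<comment> \<open>The product rule gives this explicit weak derivative of the flux. Integrated
      from 0 to x it returns the flux difference, which becomes the integrated continuity
      equation.\<close>
    let ?w = "\<lambda>x. r x * u t x + \<rho> t x * deriv (u t) x"
    have A: "abs_cont (\<lambda>x. \<rho> t x * u t x) ?w" by (rule abs_cont_mult[OF r(1) U])
    have "has_weak_deriv 1 (\<lambda>x. \<rho> t x * u t x) ?w"
      using periodicD[OF r(2)] periodicD[OF r(3)] periodicD[OF u'(3)] periodicD[OF u'(4)]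
      by (intro abs_cont_has_weak_deriv[OF A] periodicI) simp_all
    from weak_deriv_AE[OF this] eq2[OF t(1) at(3)[OF t]]
    have AE: "AE x in lborel. \<rho>_t t x = - ?w x" by eventually_elim simp
    have "square_integrable (\<rho>_t t)"
      using rt at(2)[OF t] by (auto simp: C1_sobolev_deriv_def C0_sobolev_def sobolev_def)
    from inv_dx_cong_AE[OF square_integrableD(2)[OF this] _ AE]
    have "inv_dx (\<rho>_t t) x = inv_dx (\<lambda>x. - ?w x) x"
      using loc_L2_measurable[OF abs_cont_loc_L2[OF A]] by (simp del: minus_add_distrib)
    also have "\<dots> = - inv_dx ?w x" by (rule inv_dx_uminus)
    also have "inv_dx ?w x = \<rho> t x * u t x - \<rho> t 0 * u t 0"
    proof -
      have W: "abs_cont (inv_dx ?w) ?w" by (rule abs_cont_inv_dx[OF abs_cont_loc_L2[OF A]])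
      have "inv_dx ?w y - inv_dx ?w z = \<rho> t y * u t y - \<rho> t z * u t z" if "z \<le> y" for y z
        unfolding abs_contD[OF A that] by (rule abs_contD[OF W that])
      from this[of 0 x] this[of x 0] show ?thesis by (cases "0 \<le> x") simp_all
    qed
    finally show "((\<lambda>s. inv_dx (\<rho> s) x) has_real_derivative \<rho> t 0 * u t 0 - \<rho> t x * u t x) (at t)"
      using M by simp
  qed
qed

lemma HS_const_pos:
  assumes "u0 \<in> sobolev 2" "\<rho>0 \<in> sobolev 1"
  shows "HS_const 1 u0 \<rho>0 \<le> 0" "HS_const 1 u0 \<rho>0 = 0 \<Longrightarrow> deriv u0 x = 0 \<and> \<rho>0 x = 0"
proof -
  obtain u' where u': "abs_cont (deriv u0) u'" "periodic_fun_simple' (deriv u0)"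
    using sobolev_2D[OF assms(1)] by metis
  obtain r where r: "abs_cont \<rho>0 r" "periodic_fun_simple' \<rho>0" using sobolev_1D[OF assms(2)] by metis
  note c = abs_cont_continuous[OF u'(1)] abs_cont_continuous[OF r(1)]
  have L: "loc_L2 (deriv u0)" "loc_L2 \<rho>0" using c by (auto intro: loc_L2_continuous)
  have eq: "HS_const 1 u0 \<rho>0 = - (1/2) * ((LBINT x:{0..1}. (\<rho>0 x)\<^sup>2) + (LBINT x:{0..1}. (deriv u0 x)\<^sup>2))"
    unfolding HS_const_def using L by (simp add: loc_L2_sq_integrable)
  have nn: "0 \<le> (LBINT x:{0..1}. (f x)\<^sup>2)" for f :: "real \<Rightarrow> real" by (intro set_integral_nonneg_real) auto
  show "HS_const 1 u0 \<rho>0 \<le> 0" unfolding eq using nn[of \<rho>0] nn[of "deriv u0"] by simp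
  assume "HS_const 1 u0 \<rho>0 = 0"
  then have "(LBINT x:{0..1}. (\<rho>0 x)\<^sup>2) = 0" "(LBINT x:{0..1}. (deriv u0 x)\<^sup>2) = 0"
    unfolding eq using nn[of \<rho>0] nn[of "deriv u0"] by auto
  then show "deriv u0 x = 0 \<and> \<rho>0 x = 0"
    using continuous_periodic_zero[OF c(1) u'(2)] continuous_periodic_zero[OF c(2) r(2)] by blast
qed

lemma HS_global_lower_bound:
  assumes k: "k \<in> {1, -1}" and u0: "u0 \<in> sobolev 2" and r0: "\<rho>0 \<in> sobolev 1"
    and sol: "HS_solution k h u0 \<rho>0 \<infinity> u \<rho>"
  shows "\<exists>K. \<forall>t\<ge>0. \<forall>x. deriv (u t) x \<ge> - K"
proof -
  define a where "a = HS_const k u0 \<rho>0"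
  have init: "u 0 = u0" "\<rho> 0 = \<rho>0" using sol by (auto simp: HS_solution_def)
  have cl: "HS_classical k a \<tau> h u (\<lambda>t. deriv (u t)) \<rho>" if "\<tau> > 0" for \<tau>
    unfolding a_def by (rule HS_solution_classical[OF sol that]) simp
  have traj: "\<exists>q. q t1 = y \<and> HS_trajectory k a \<tau> h u (\<lambda>t. deriv (u t)) \<rho> q" if "0 \<le> t1" "t1 < \<tau>" for t1 \<tau> y
  proof -
    have \<tau>: "\<tau> > 0" and t1: "t1 \<in> {0..\<tau>}" using that by simp_all
    obtain q where "q t1 = y" "\<And>t. t \<in> {0..\<tau>} \<Longrightarrow> (q has_real_derivative u t (q t)) (at t within {0..\<tau>})"
      using HS_classical.trajectory_exists[OF cl[OF \<tau>] t1, of y] by blast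
    moreover from this(2) have "HS_trajectory k a \<tau> h u (\<lambda>t. deriv (u t)) \<rho> q"
      by (intro HS_trajectory.intro[OF cl[OF \<tau>]] HS_trajectory_axioms.intro)
    ultimately show ?thesis by blast
  qed
  \<comment> \<open>Chosen so that K^2 >= 4|a|, as the Riccati bound demands, with K positive also
    for a = 0.\<close>
  define K where "K = 2 * sqrt \<bar>a\<bar> + 1"
  have K: "K > 0" unfolding K_def by (simp add: add_nonneg_pos)
  have K4: "4 * a \<le> K\<^sup>2"
  proof -
    have "K\<^sup>2 = 4 * \<bar>a\<bar> + 4 * sqrt \<bar>a\<bar> + 1" by (simp add: K_def power2_eq_square algebra_simps)
    then show ?thesis using real_sqrt_ge_zero[of "\<bar>a\<bar>"] by linarith
  qed
  have K4': "4 / K > 0" using K by simp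
  consider "k = -1" | "k = 1" using k by auto
  then show ?thesis
  proof cases
    case 1
    have "deriv (u t) y > - K" if t: "t \<ge> 0" for t y
    proof -
      \<comment> \<open>The bound at time t uses existence up to t + 4/K: a smaller slope at t would
        blow up before then.\<close>
      obtain q where tr: "q t = y" "HS_trajectory k a (t + 4 / K) h u (\<lambda>t. deriv (u t)) \<rho> q"
        using traj[of t "t + 4 / K" y] t K4' by auto
      interpret HS_trajectory k a "t + 4 / K" h u "\<lambda>t. deriv (u t)" \<rho> q by (rule tr(2))
      show ?thesis using V_lower_bound_neg[OF 1 t K K4 order_refl] tr(1) by (simp add: V_def)
    qed
    then show ?thesis by (meson less_imp_le)
  next
    case 2
    have a0: "a \<le> 0" unfolding a_def 2 by (rule HS_const_pos[OF u0 r0])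
    \<comment> \<open>C bounds the conserved quotient (V^2 + R^2 - 2a) / |R| over all initial
      points. The form without division also covers a = 0, where both the slope and the density
      vanish identically and C = 0 serves.\<close>
    have "\<exists>C\<ge>0. \<forall>x. (deriv u0 x)\<^sup>2 + (\<rho>0 x)\<^sup>2 - 2 * a \<le> C * \<bar>\<rho>0 x\<bar>"
    proof (cases "a = 0")
      case True
      then show ?thesis using HS_const_pos(2)[OF u0 r0] unfolding a_def 2 by (intro exI[of _ 0]) auto
    next
      case False
      then have a: "a < 0" using a0 by simp
      have nz: "\<rho>0 x \<noteq> 0" for x
      proof
        assume z: "\<rho>0 x = 0"
        \<comment> \<open>The time by which a trajectory starting at a zero of the density must have
          blown up.\<close>
        define \<tau> where "\<tau> = \<bar>deriv u0 x + K\<bar> / (- a) + 4 / K"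
        have "\<bar>deriv u0 x + K\<bar> / (- a) \<ge> 0" using a by (intro divide_nonneg_pos) auto
        then have "\<tau> > 0" unfolding \<tau>_def using K4' by linarith
        then obtain q where tr: "q 0 = x" "HS_trajectory k a \<tau> h u (\<lambda>t. deriv (u t)) \<rho> q"
          using traj[of 0 \<tau> x] by auto
        interpret HS_trajectory k a \<tau> h u "\<lambda>t. deriv (u t)" \<rho> q by (rule tr(2))
        have "R 0 = 0" "V 0 = deriv u0 x" using z tr(1) init by (simp_all add: R_def V_def)
        then show False using blowup_bound_pos[OF a _ K] by (simp add: \<tau>_def)
      qed
      obtain u' where u': "abs_cont (deriv u0) u'" "periodic_fun_simple' (deriv u0)"
        using sobolev_2D[OF u0] by metis
      obtain r where r: "abs_cont \<rho>0 r" "periodic_fun_simple' \<rho>0" using sobolev_1D[OF r0] by metis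
      define F where "F x = ((deriv u0 x)\<^sup>2 + (\<rho>0 x)\<^sup>2 - 2 * a) / \<bar>\<rho>0 x\<bar>" for x
      have "continuous_on {0..1} F"
        unfolding F_def using nz by (intro continuous_intros abs_cont_continuous[OF u'(1)] abs_cont_continuous[OF r(1)]) auto
      from continuous_bounded_Icc[OF this] obtain B where B: "B > 0" "\<And>x. x \<in> {0..1} \<Longrightarrow> \<bar>F x\<bar> \<le> B" by auto
      have "periodic_fun_simple' F"
        using periodicD[OF u'(2)] periodicD[OF r(2)] by (intro periodicI) (simp add: F_def)
      then have FB: "F x \<le> B" for x
        using B(2)[of "frac x"] periodic_frac[of F x] frac_lt_1[of x] frac_ge_0[of x] by auto
      have "0 < \<bar>\<rho>0 x\<bar>" for x using nz[of x] by simp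
      from FB[unfolded F_def pos_divide_le_eq[OF this]]
      have "(deriv u0 x)\<^sup>2 + (\<rho>0 x)\<^sup>2 - 2 * a \<le> B * \<bar>\<rho>0 x\<bar>" for x .
      then show ?thesis using B(1) by (intro exI[of _ B]) auto
    qed
    then obtain C where C: "C \<ge> 0" "\<And>x. (deriv u0 x)\<^sup>2 + (\<rho>0 x)\<^sup>2 - 2 * a \<le> C * \<bar>\<rho>0 x\<bar>" by blast
    have "deriv (u t) y \<ge> - C" if t: "t \<ge> 0" for t y
    proof -
      obtain q where tr: "q t = y" "HS_trajectory k a (t + 1) h u (\<lambda>t. deriv (u t)) \<rho> q"
        using traj[of t "t + 1" y] t by auto
      interpret HS_trajectory k a "t + 1" h u "\<lambda>t. deriv (u t)" \<rho> q by (rule tr(2))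
      have "\<bar>V t\<bar> \<le> C"
        by (rule V_bound_pos[OF 2 a0 _ C(1)]) (use C(2)[of "q 0"] t init in \<open>auto simp: V_def R_def\<close>)
      then show ?thesis using tr(1) by (simp add: V_def)
    qed
    then show ?thesis by blast
  qed
qed

section \<open>Time regularity of composed \<open>L\<^sup>2\<close> functions\<close>

text \<open>Along the level curve the time increment at the fixed point p t and the space increment
  cancel. The mean value form of the latter can be solved for the increment of p, since the slope is
  positive.\<close>

lemma implicit_function_derivative:
  fixes A Ax :: "real \<Rightarrow> real \<Rightarrow> real"
  assumes S: "open S" "t \<in> S"
    and At: "((\<lambda>s. A s (p t)) has_real_derivative a) (at t)"
    and Ax: "\<And>s y. s \<in> S \<Longrightarrow> (A s has_real_derivative Ax s y) (at y)"
    and Axc: "continuous_on (S \<times> UNIV) (\<lambda>(s, y). Ax s y)"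
    and pos: "\<And>s y. s \<in> S \<Longrightarrow> Ax s y > 0"
    and p: "isCont p t" and eq: "\<And>s. s \<in> S \<Longrightarrow> A s (p s) = x"
  shows "(p has_real_derivative - a / Ax t (p t)) (at t)"
proof -
  obtain \<xi> where \<xi>: "\<And>s. s \<in> S \<Longrightarrow> A s (p s) - A s (p t) = Ax s (\<xi> s) * (p s - p t)"
    and Axl: "((\<lambda>s. Ax s (\<xi> s)) \<longlongrightarrow> Ax t (p t)) (at t)"
    using mean_value_near_curve[OF S Ax Axc p] by metis
  have evS: "\<forall>\<^sub>F s in at t. s \<in> S" using S by (rule eventually_at_in_open')
  have pt: "Ax t (p t) \<noteq> 0" using pos[OF S(2), of "p t"] by simp
  have "((\<lambda>s. - ((A s (p t) - A t (p t)) / (s - t)) / Ax s (\<xi> s)) \<longlongrightarrow> - a / Ax t (p t)) (at t)"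
    using At unfolding has_field_derivative_iff by (intro tendsto_intros Axl pt)
  then have "((\<lambda>s. (p s - p t) / (s - t)) \<longlongrightarrow> - a / Ax t (p t)) (at t)"
  proof (rule Lim_transform_eventually)
    show "\<forall>\<^sub>F s in at t. - ((A s (p t) - A t (p t)) / (s - t)) / Ax s (\<xi> s) = (p s - p t) / (s - t)"
      using evS
    proof eventually_elim
      case (elim s)
      have "Ax s (\<xi> s) * (p s - p t) = - (A s (p t) - A t (p t))"
        using \<xi>[OF elim] eq[OF elim] eq[OF S(2)] by simp
      moreover have "Ax s (\<xi> s) \<noteq> 0" using pos[OF elim, of "\<xi> s"] by simp
      moreover have "- (d / (s - t)) / b = r / (s - t)" if "b * r = - d" "b \<noteq> 0" for b d r :: real
      proof -
        have d: "d = - (b * r)" using that(1) by simp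
        show ?thesis unfolding d using that(2) by simp
      qed
      ultimately show ?case by blast
    qed
  qed
  then show ?thesis by (simp add: has_field_derivative_iff)
qed

lemma uniform_in_time:
  fixes G :: "real \<Rightarrow> real \<Rightarrow> real"
  assumes G: "continuous_on UNIV (\<lambda>(t, x). G t x)" and "e > 0"
  shows "\<forall>\<^sub>F s in at t. \<forall>x\<in>{a..b}. \<bar>G s x - G t x\<bar> < e"
proof -
  define C where "C = {t-1..t+1} \<times> {a..b}"
  have "compact C" unfolding C_def by (intro compact_Times) auto
  moreover have "continuous_on C (\<lambda>(s, y). G s y)"
    by (rule continuous_on_subset[OF G]) simp
  ultimately have "uniformly_continuous_on C (\<lambda>(s, y). G s y)" by (rule compact_uniformly_continuous[rotated])
  then obtain d where d: "d > 0" "\<And>p p'. p \<in> C \<Longrightarrow> p' \<in> C \<Longrightarrow> dist p' p < d \<Longrightarrow>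
      dist ((\<lambda>(s, y). G s y) p') ((\<lambda>(s, y). G s y) p) < e"
    using \<open>e > 0\<close> unfolding uniformly_continuous_on_def by metis
  show ?thesis
    unfolding eventually_at
  proof (intro exI[of _ "min d 1"] conjI ballI impI)
    show "0 < min d 1" using d by simp
    fix s x assume s: "s \<noteq> t \<and> dist s t < min d 1" and x: "x \<in> {a..b}"
    have "dist (s, x) (t, x) < d" using s by (simp add: dist_Pair_Pair)
    moreover have "(s, x) \<in> C" "(t, x) \<in> C" using s x by (auto simp: C_def dist_real_def)
    ultimately show "\<bar>G s x - G t x\<bar> < e" using d(2)[of "(t, x)" "(s, x)"] by (simp add: dist_real_def)
  qed
qed

lemma joint_slice:
  fixes G :: "real \<Rightarrow> real \<Rightarrow> real"
  assumes "continuous_on UNIV (\<lambda>(t, x). G t x)" shows "continuous_on A (G t)"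
proof -
  have "continuous_on A (\<lambda>x. (\<lambda>(t, x). G t x) (t, x))"
    by (rule continuous_on_compose2[OF assms]) (auto intro!: continuous_intros)
  then show ?thesis by simp
qed

lemma joint_compose:
  fixes G f :: "real \<Rightarrow> real \<Rightarrow> real"
  assumes "continuous_on UNIV (\<lambda>(t, x). G t x)" "continuous_on UNIV (\<lambda>(t, x). f t x)"
  shows "continuous_on UNIV (\<lambda>(t, x). G t (f t x))"
proof -
  have "continuous_on UNIV (\<lambda>p. (\<lambda>(t, x). G t x) (fst p, f (fst p) (snd p)))"
    by (rule continuous_on_compose2[OF assms(1)])
       (use assms(2) in \<open>auto intro!: continuous_intros simp: case_prod_beta\<close>)
  then show ?thesis by (simp add: case_prod_beta)
qed

text \<open>Testing the difference quotient against polynomials \<open>p\<close> and applying the mean value theorem in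
  time gives \<open>\<integral> D p = \<integral> (Z\<^sub>r - Z\<^sub>t) p\<close> for some intermediate \<open>r\<close>. This avoids Fubini and any joint
  measurability of \<open>Z\<close>.\<close>

lemma L2_difference_quotient:
  fixes A At W Z :: "real \<Rightarrow> real \<Rightarrow> real"
  assumes At: "\<And>r x. r \<in> {\<alpha><..<\<beta>} \<Longrightarrow> ((\<lambda>r. A r x) has_real_derivative At r x) (at r)"
    and Atc: "continuous_on UNIV (\<lambda>(r, x). At r x)"
    and W: "\<And>r. r \<in> {\<alpha><..<\<beta>} \<Longrightarrow> abs_cont (A r) (W r)"
    and Z: "\<And>r. r \<in> {\<alpha><..<\<beta>} \<Longrightarrow> abs_cont (At r) (Z r)"
    and st: "s \<in> {\<alpha><..<\<beta>}" "t \<in> {\<alpha><..<\<beta>}" "s \<noteq> t"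
    and \<delta>: "\<And>r. r \<in> {min s t..max s t} \<Longrightarrow> (LBINT x:{0..1}. (Z r x - Z t x)\<^sup>2) \<le> \<delta>"
  shows "(LBINT x:{0..1}. ((W s x - W t x) / (s - t) - Z t x)\<^sup>2) \<le> \<delta>"
proof (rule field_le_epsilon)
  fix e :: real assume e: "e > 0"
  define D where "D x = (W s x - W t x) / (s - t) - Z t x" for x
  have LW: "loc_L2 (W r)" and LZ: "loc_L2 (Z r)" if "r \<in> {\<alpha><..<\<beta>}" for r
    using W[OF that] Z[OF that] by (auto intro: abs_cont_loc_L2)
  have LD: "loc_L2 D"
    using loc_L2_diff[OF loc_L2_cmult[OF loc_L2_diff[OF LW[OF st(1)] LW[OF st(2)]], of "1 / (s - t)"] LZ[OF st(2)]]
    by (simp add: D_def[abs_def])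
  obtain p p' where p: "\<And>x. (p has_real_derivative p' x) (at x)" and p'c: "continuous_on UNIV p'"
    and pc: "continuous_on UNIV p" and De: "(LBINT x:{0..1}. (D x - p x)\<^sup>2) < e"
    by (rule L2_approx_C1[OF LD e, of 0 1]) auto
  have AC: "abs_cont p p'" by (rule abs_cont_C1[OF p p'c])
  have Lp: "loc_L2 p" "loc_L2 p'" using pc p'c by (auto intro: loc_L2_continuous)
  \<comment> \<open>Integration by parts moves the x-derivative from A to p. What remains to be
    differentiated in time is an integral with continuous time derivative, so the Leibniz rule
    applies.\<close>
  define \<Theta> where "\<Theta> r = (LBINT x:{0..1}. W r x * p x)" for r
  define J where "J r = integral {0..1} (\<lambda>x. A r x * p' x)" for r
  have Ac: "continuous_on UNIV (A r)" if "r \<in> {\<alpha><..<\<beta>}" for r by (rule abs_cont_continuous[OF W[OF that]])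
  have toHK: "(LBINT x:{0..1}. f x) = integral {0..1} f" if "continuous_on UNIV f" for f :: "real \<Rightarrow> real"
    by (rule set_borel_integral_eq_integral(2)[OF set_integrable_continuous_UNIV[OF that]])
  have \<Theta>: "\<Theta> r = A r 1 * p 1 - A r 0 * p 0 - J r" if r: "r \<in> {\<alpha><..<\<beta>}" for r
    using abs_cont_integral_by_parts[OF W[OF r] AC, of 0 1]
    unfolding \<Theta>_def J_def toHK[OF continuous_on_mult[OF Ac[OF r] p'c]] by simp
  have dJ: "(J has_real_derivative integral {0..1} (\<lambda>x. At r x * p' x)) (at r)" if r: "r \<in> {\<alpha><..<\<beta>}" for r
  proof -
    have "((\<lambda>r. integral (cbox 0 1) (\<lambda>x. A r x * p' x)) has_real_derivative
        integral (cbox 0 1) (\<lambda>x. At r x * p' x)) (at r within {\<alpha><..<\<beta>})"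
    proof (rule leibniz_rule_field_derivative[OF _ _ _ r])
      show "((\<lambda>r. A r x * p' x) has_real_derivative At r x * p' x) (at r within {\<alpha><..<\<beta>})" if "r \<in> {\<alpha><..<\<beta>}" for r x
        by (rule has_field_derivative_at_within[OF DERIV_cmult_right[OF At[OF that]]])
      show "(\<lambda>x. A r x * p' x) integrable_on cbox 0 1" if "r \<in> {\<alpha><..<\<beta>}" for r
        by (intro integrable_continuous continuous_on_mult continuous_on_subset[OF Ac[OF that]] continuous_on_subset[OF p'c]) auto
      have "continuous_on UNIV (\<lambda>q. At (fst q) (snd q))" using Atc by (simp add: case_prod_beta)
      moreover have "continuous_on UNIV (\<lambda>q :: real \<times> real. p' (snd q))"
        by (rule continuous_on_compose2[OF p'c]) (auto intro: continuous_intros)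
      ultimately have "continuous_on UNIV (\<lambda>(r, x). At r x * p' x)"
        by (simp add: case_prod_beta continuous_on_mult)
      then show "continuous_on ({\<alpha><..<\<beta>} \<times> cbox 0 1) (\<lambda>(r, x). At r x * p' x)"
        by (rule continuous_on_subset) simp
    qed simp
    then show ?thesis using r by (simp add: J_def[abs_def] at_within_open[of r "{\<alpha><..<\<beta>}"])
  qed
  define \<Theta>' where "\<Theta>' r = (LBINT x:{0..1}. Z r x * p x)" for r
  have d\<Theta>: "(\<Theta> has_real_derivative \<Theta>' r) (at r)" if r: "r \<in> {\<alpha><..<\<beta>}" for r
  proof -
    have "((\<lambda>r. A r 1 * p 1 - A r 0 * p 0 - J r) has_real_derivative
       At r 1 * p 1 - At r 0 * p 0 - integral {0..1} (\<lambda>x. At r x * p' x)) (at r)"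
      by (intro DERIV_diff DERIV_cmult_right At[OF r] dJ[OF r])
    moreover have "At r 1 * p 1 - At r 0 * p 0 - integral {0..1} (\<lambda>x. At r x * p' x) = \<Theta>' r"
      using abs_cont_integral_by_parts[OF Z[OF r] AC, of 0 1]
      unfolding \<Theta>'_def toHK[OF continuous_on_mult[OF joint_slice[OF Atc] p'c]] by simp
    ultimately have "((\<lambda>r. A r 1 * p 1 - A r 0 * p 0 - J r) has_real_derivative \<Theta>' r) (at r)" by simp
    then show ?thesis
      by (rule has_field_derivative_transform_within_open[where S="{\<alpha><..<\<beta>}"]) (use r \<Theta> in auto)
  qed
  have lt: "min s t < max s t" using st by auto
  \<comment> \<open>The intermediate time depends on p. This is harmless because \<delta> bounds the
    distance of Z at every time between s and t.\<close>
  have "\<exists>z. min s t < z \<and> z < max s t \<and> \<Theta> (max s t) - \<Theta> (min s t) = (max s t - min s t) * \<Theta>' z"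
    by (rule MVT2[OF lt d\<Theta>]) (use st in auto)
  then obtain r where r: "min s t < r" "r < max s t" "\<Theta> (max s t) - \<Theta> (min s t) = (max s t - min s t) * \<Theta>' r"
    by blast
  have rO: "r \<in> {\<alpha><..<\<beta>}" using r st by auto
  have q: "(\<Theta> s - \<Theta> t) / (s - t) = \<Theta>' r"
    using r(3) st(3) by (cases "s < t") (auto simp: min_def max_def field_simps)
  have "(LBINT x:{0..1}. D x * p x) = (LBINT x:{0..1}. (1 / (s - t)) * (W s x * p x - W t x * p x) - Z t x * p x)"
    by (simp add: D_def left_diff_distrib)
  also have "\<dots> = (\<Theta> s - \<Theta> t) / (s - t) - \<Theta>' t"
    using LW[OF st(1)] LW[OF st(2)] LZ[OF st(2)] Lp
    by (subst set_integral_diff(2)) (auto simp: loc_L2_mult_integrable \<Theta>_def \<Theta>'_def simp del: set_integrable_mult_divide_iff)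
  also have "\<dots> = (LBINT x:{0..1}. (Z r x - Z t x) * p x)"
    unfolding q using LZ[OF rO] LZ[OF st(2)] Lp by (simp add: \<Theta>'_def left_diff_distrib loc_L2_mult_integrable)
  finally have eq: "(LBINT x:{0..1}. D x * p x) = (LBINT x:{0..1}. (Z r x - Z t x) * p x)" .
  have sq: "(LBINT x:{0..1}. (f x - p x)\<^sup>2) = (LBINT x:{0..1}. (f x)\<^sup>2) - 2 * (LBINT x:{0..1}. f x * p x) + (LBINT x:{0..1}. (p x)\<^sup>2)"
    if f: "loc_L2 f" for f
  proof -
    have "(LBINT x:{0..1}. (f x - p x)\<^sup>2) = (LBINT x:{0..1}. ((f x)\<^sup>2 - 2 * (f x * p x)) + (p x)\<^sup>2)"
      by (simp add: power2_diff algebra_simps)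
    also have "\<dots> = (LBINT x:{0..1}. (f x)\<^sup>2) - 2 * (LBINT x:{0..1}. f x * p x) + (LBINT x:{0..1}. (p x)\<^sup>2)"
      using f Lp by (subst set_integral_add(2)) (auto simp: loc_L2_sq_integrable loc_L2_mult_integrable)
    finally show ?thesis .
  qed
  have LZd: "loc_L2 (\<lambda>x. Z r x - Z t x)" by (intro loc_L2_diff LZ rO st)
  \<comment> \<open>By nonnegativity of the square, 2 \<integral> (Z_r - Z_t) p <= |Z_r - Z_t|^2 +
    |p|^2 in L^2 norms. Inserted into |D - p|^2 < e, the terms in p cancel and |D|^2 <= \<delta> + e
    remains.\<close>
  have "0 \<le> (LBINT x:{0..1}. ((Z r x - Z t x) - p x)\<^sup>2)" by (intro set_integral_nonneg_real) auto
  then have "2 * (LBINT x:{0..1}. D x * p x) \<le> (LBINT x:{0..1}. (Z r x - Z t x)\<^sup>2) + (LBINT x:{0..1}. (p x)\<^sup>2)"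
    unfolding sq[OF LZd] eq by simp
  moreover have "(LBINT x:{0..1}. (D x)\<^sup>2) - 2 * (LBINT x:{0..1}. D x * p x) + (LBINT x:{0..1}. (p x)\<^sup>2) < e"
    using De unfolding sq[OF LD] .
  moreover have "(LBINT x:{0..1}. (Z r x - Z t x)\<^sup>2) \<le> \<delta>" using r by (intro \<delta>) auto
  ultimately have "(LBINT x:{0..1}. (D x)\<^sup>2) \<le> \<delta> + e" by linarith
  then show "(LBINT x:{0..1}. ((W s x - W t x) / (s - t) - Z t x)\<^sup>2) \<le> \<delta> + e" by (simp add: D_def)
qed

text \<open>A time-dependent change of variables whose Jacobian has the lower bound 1/M uniformly in
  time and space. Substitution estimates then have a constant independent of time.\<close>

locale moving_frame =
  fixes X Xx :: "real \<Rightarrow> real \<Rightarrow> real" and M :: real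
  assumes Xc: "continuous_on UNIV (\<lambda>(t, x). X t x)"
    and Xd: "\<And>t x. (X t has_real_derivative Xx t x) (at x)"
    and Xxc: "\<And>t. continuous_on UNIV (Xx t)"
    and Xx_pos: "\<And>t x. Xx t x > 0"
    and M: "\<And>t x. 1 \<le> M * Xx t x"
begin

lemma loc_L2_frame:
  assumes "loc_L2 g" "continuous_on UNIV (\<lambda>(t, x). m t x)"
  shows "loc_L2 (\<lambda>x. m t x * g (X t x))"
  by (intro loc_L2_mult_continuous loc_L2_compose(1)[OF assms(1) Xd Xx_pos Xxc] joint_slice[OF assms(2)])

text \<open>Replace g by a continuous \<gamma> close to it in L^2. By substitution the error stays
  small after composition with X s, uniformly for s near t, while the part with \<gamma> converges
  uniformly on the unit interval.\<close>

lemma compose_L2_continuous: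
  fixes m :: "real \<Rightarrow> real \<Rightarrow> real"
  assumes g: "loc_L2 g" and m: "continuous_on UNIV (\<lambda>(t, x). m t x)"
  shows "((\<lambda>s. LBINT x:{0..1}. (m s x * g (X s x) - m t x * g (X t x))\<^sup>2) \<longlongrightarrow> 0) (at t)"
proof (rule tendstoI)
  fix e :: real assume e: "e > 0"
  have cK: "compact ({t-1..t+1} \<times> {0..1::real})" by (intro compact_Times) auto
  have "bounded ((\<lambda>(t, x). X t x) ` ({t-1..t+1} \<times> {0..1}))" "bounded ((\<lambda>(t, x). m t x) ` ({t-1..t+1} \<times> {0..1}))"
    by (intro compact_imp_bounded compact_continuous_image cK continuous_on_subset[OF Xc] continuous_on_subset[OF m] subset_UNIV)+
  then obtain N B where N: "\<And>s x. s \<in> {t-1..t+1} \<Longrightarrow> x \<in> {0..1} \<Longrightarrow> \<bar>X s x\<bar> \<le> N"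
    and B: "\<And>s x. s \<in> {t-1..t+1} \<Longrightarrow> x \<in> {0..1} \<Longrightarrow> \<bar>m s x\<bar> \<le> B"
    unfolding bounded_iff by fastforce
  have M0: "M > 0" using M[of 0 0] Xx_pos[of 0 0] by (smt (verit) mult_nonpos_nonneg)
  \<comment> \<open>The approximation errors enter with total weight 6 B^2 M, which makes them at
    most e/2. The continuous part contributes 4 * e/16, so the sum stays below e.\<close>
  define e1 where "e1 = e / (12 * (B\<^sup>2 * M + 1))"
  have BM: "B\<^sup>2 * M \<ge> 0" using M0 by simp
  have e1: "e1 > 0" "6 * (B\<^sup>2 * M * e1) \<le> e / 2"
  proof -
    show "e1 > 0" unfolding e1_def using e BM by (intro divide_pos_pos) auto
    have "6 * (B\<^sup>2 * M * e1) = (e / 2) * (B\<^sup>2 * M / (B\<^sup>2 * M + 1))" using BM by (simp add: e1_def field_simps)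
    also have "\<dots> \<le> (e / 2) * 1" using e BM by (intro mult_left_mono) (auto simp: divide_le_eq)
    finally show "6 * (B\<^sup>2 * M * e1) \<le> e / 2" by simp
  qed
  obtain \<gamma> where \<gamma>: "continuous_on UNIV \<gamma>" "(LBINT x:{-N..N}. (g x - \<gamma> x)\<^sup>2) < e1"
    using L2_approx[OF g e1(1)] by blast
  have Ld: "loc_L2 (\<lambda>x. g x - \<gamma> x)" by (intro loc_L2_diff g loc_L2_continuous \<gamma>)
  have Gc: "continuous_on UNIV (\<lambda>(t, x). m t x * \<gamma> (X t x))"
  proof -
    have "continuous_on UNIV (\<lambda>p. \<gamma> (X (fst p) (snd p)))"
      by (rule continuous_on_compose2[OF \<gamma>(1)]) (use Xc in \<open>auto simp: case_prod_beta\<close>)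
    then show ?thesis using m by (simp add: case_prod_beta continuous_on_mult)
  qed
  have near: "(LBINT x:{0..1}. (m s x * (g (X s x) - \<gamma> (X s x)))\<^sup>2) \<le> B\<^sup>2 * M * e1" if s: "s \<in> {t-1..t+1}" for s
  proof -
    have L: "loc_L2 (\<lambda>x. g (X s x) - \<gamma> (X s x))" by (rule loc_L2_compose(1)[OF Ld Xd Xx_pos Xxc])
    have "(LBINT x:{0..1}. (m s x * (g (X s x) - \<gamma> (X s x)))\<^sup>2) \<le> (LBINT x:{0..1}. B\<^sup>2 * (g (X s x) - \<gamma> (X s x))\<^sup>2)"
    proof (rule set_integral_mono)
      show "set_integrable lborel {0..1} (\<lambda>x. (m s x * (g (X s x) - \<gamma> (X s x)))\<^sup>2)"
        by (rule loc_L2_sq_integrable[OF loc_L2_mult_continuous[OF L joint_slice[OF m]]])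
      show "set_integrable lborel {0..1} (\<lambda>x. B\<^sup>2 * (g (X s x) - \<gamma> (X s x))\<^sup>2)"
        by (intro set_integrable_mult_right loc_L2_sq_integrable L)
      fix x :: real assume "x \<in> {0..1}"
      from B[OF s this] have "\<bar>m s x\<bar>\<^sup>2 \<le> B\<^sup>2" by (intro power_mono) auto
      then show "(m s x * (g (X s x) - \<gamma> (X s x)))\<^sup>2 \<le> B\<^sup>2 * (g (X s x) - \<gamma> (X s x))\<^sup>2"
        by (simp add: power_mult_distrib mult_right_mono)
    qed
    also have "\<dots> = B\<^sup>2 * (LBINT x:{0..1}. (g (X s x) - \<gamma> (X s x))\<^sup>2)" by simp
    also have "\<dots> \<le> B\<^sup>2 * (M * (LBINT x:{-N..N}. (g x - \<gamma> x)\<^sup>2))"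
    proof (intro mult_left_mono)
      show "(LBINT x:{0..1}. (g (X s x) - \<gamma> (X s x))\<^sup>2) \<le> M * (LBINT x:{-N..N}. (g x - \<gamma> x)\<^sup>2)"
        by (rule loc_L2_compose(2)[OF Ld Xd Xx_pos Xxc]) (use M N[OF s, of 0] N[OF s, of 1] in \<open>auto simp: abs_le_iff\<close>)
    qed simp
    also have "\<dots> \<le> B\<^sup>2 * (M * e1)" using \<gamma>(2) M0 by (intro mult_left_mono) auto
    finally show ?thesis by (simp add: mult.assoc)
  qed
  define \<eta> where "\<eta> = sqrt (e / 16)"
  have \<eta>: "\<eta> > 0" "\<eta>\<^sup>2 = e / 16" using e by (auto simp: \<eta>_def)
  have ev1: "\<forall>\<^sub>F s in at t. s \<in> {t-1..t+1}"
    unfolding eventually_at by (intro exI[of _ 1]) (auto simp: dist_real_def)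
  show "\<forall>\<^sub>F s in at t. dist (LBINT x:{0..1}. (m s x * g (X s x) - m t x * g (X t x))\<^sup>2) 0 < e"
    using ev1 uniform_in_time[OF Gc \<eta>(1), where t=t and a=0 and b=1]
  proof eventually_elim
    case (elim s)
    let ?d = "\<lambda>s x. m s x * (g (X s x) - \<gamma> (X s x))" and ?c = "\<lambda>s x. m s x * \<gamma> (X s x)"
    have Ldd: "loc_L2 (?d r)" for r
      using loc_L2_frame[OF Ld m] by simp
    have Lc: "loc_L2 (?c r)" for r by (rule loc_L2_continuous[OF joint_slice[OF Gc]])
    have L2: "loc_L2 (\<lambda>x. ?c s x - ?c t x)" "loc_L2 (\<lambda>x. - ?d t x)"
      using loc_L2_diff[OF Lc Lc] loc_L2_cmult[OF Ldd, of "-1" t] by simp_all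
    have mid: "(LBINT x:{0..1}. (?c s x - ?c t x)\<^sup>2) \<le> e / 16"
    proof -
      have "(LBINT x:{0..1}. (?c s x - ?c t x)\<^sup>2) \<le> (LBINT x:{0..1::real}. \<eta>\<^sup>2)"
      proof (rule set_integral_mono)
        show "(?c s x - ?c t x)\<^sup>2 \<le> \<eta>\<^sup>2" if "x \<in> {0..1}" for x
          using elim(2) that \<eta>(1) by (metis abs_le_square_iff abs_of_pos less_imp_le)
      qed (use L2(1) in \<open>auto intro: loc_L2_sq_integrable loc_L2_integrable\<close>)
      then show ?thesis by (simp add: set_integral_Icc_const \<eta>(2))
    qed
    have last: "(LBINT x:{0..1}. (- ?d t x)\<^sup>2) \<le> B\<^sup>2 * M * e1" using near[of t] by simp
    have "(LBINT x:{0..1}. (m s x * g (X s x) - m t x * g (X t x))\<^sup>2)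
        = (LBINT x:{0..1}. (?d s x + ((?c s x - ?c t x) + - ?d t x))\<^sup>2)"
      by (simp add: algebra_simps)
    also have "\<dots> \<le> 2 * (LBINT x:{0..1}. (?d s x)\<^sup>2) + 2 * (LBINT x:{0..1}. ((?c s x - ?c t x) + - ?d t x)\<^sup>2)"
      by (rule set_integral_square_add_le[OF Ldd loc_L2_add[OF L2]])
    finally have 1: "(LBINT x:{0..1}. (m s x * g (X s x) - m t x * g (X t x))\<^sup>2)
        \<le> 2 * (LBINT x:{0..1}. (?d s x)\<^sup>2) + 2 * (LBINT x:{0..1}. ((?c s x - ?c t x) + - ?d t x)\<^sup>2)" .
    have 2: "(LBINT x:{0..1}. ((?c s x - ?c t x) + - ?d t x)\<^sup>2)
        \<le> 2 * (LBINT x:{0..1}. (?c s x - ?c t x)\<^sup>2) + 2 * (LBINT x:{0..1}. (- ?d t x)\<^sup>2)"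
      by (rule set_integral_square_add_le[OF L2])
    have "x \<le> 6 * q + 4 * r" if "x \<le> 2 * a + 2 * y" "y \<le> 2 * b + 2 * c" "a \<le> q" "b \<le> r" "c \<le> q"
      for x y a b c q r :: real using that by simp
    from this[OF 1 2 near[OF elim(1)] mid last]
    have "(LBINT x:{0..1}. (m s x * g (X s x) - m t x * g (X t x))\<^sup>2) < e" using e1(2) e by simp
    then show ?case
      using set_integral_nonneg_real[of "{0..1}" "\<lambda>x. (m s x * g (X s x) - m t x * g (X t x))\<^sup>2"] by (simp add: dist_real_def)
  qed
qed

text \<open>The common shape of the highest x-derivatives occurring below: a continuous part and two
  L^2 functions transported by the frame with continuous coefficients. The two functions will be
  u_0'' and \<rho>_0'.\<close>

definition frame_path where
  "frame_path m0 m1 g1 m2 g2 t x = m0 t x + m1 t x * g1 (X t x) + m2 t x * g2 (X t x)"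

lemma frame_path_continuous:
  fixes m0 m1 m2 :: "real \<Rightarrow> real \<Rightarrow> real"
  assumes g: "loc_L2 g1" "loc_L2 g2" and m: "continuous_on UNIV (\<lambda>(t, x). m0 t x)"
    "continuous_on UNIV (\<lambda>(t, x). m1 t x)" "continuous_on UNIV (\<lambda>(t, x). m2 t x)"
  shows "((\<lambda>s. LBINT x:{0..1}. (frame_path m0 m1 g1 m2 g2 s x - frame_path m0 m1 g1 m2 g2 t x)\<^sup>2) \<longlongrightarrow> 0) (at t)"
    and "loc_L2 (frame_path m0 m1 g1 m2 g2 t)"
proof -
  have L: "loc_L2 (m0 r)" "loc_L2 (\<lambda>x. m1 r x * g1 (X r x))" "loc_L2 (\<lambda>x. m2 r x * g2 (X r x))" for r
    using m(1) by (auto intro: loc_L2_continuous joint_slice loc_L2_frame g m)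
  show "loc_L2 (frame_path m0 m1 g1 m2 g2 t)"
    unfolding frame_path_def[abs_def] by (intro loc_L2_add L)
  let ?I = "\<lambda>f. LBINT x:{0..1}. (f x :: real)\<^sup>2"
  let ?d0 = "\<lambda>s x. m0 s x - m0 t x" and ?d1 = "\<lambda>s x. m1 s x * g1 (X s x) - m1 t x * g1 (X t x)"
    and ?d2 = "\<lambda>s x. m2 s x * g2 (X s x) - m2 t x * g2 (X t x)"
  have l0: "((\<lambda>s. ?I (?d0 s)) \<longlongrightarrow> 0) (at t)"
    using compose_L2_continuous[of "\<lambda>_. 1" m0 t] m(1) by simp
  have "((\<lambda>s. 2 * (2 * ?I (?d0 s) + 2 * ?I (?d1 s)) + 2 * ?I (?d2 s)) \<longlongrightarrow> 2 * (2 * 0 + 2 * 0) + 2 * 0) (at t)"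
    by (intro tendsto_intros l0 compose_L2_continuous g m)
  then have lim: "((\<lambda>s. 2 * (2 * ?I (?d0 s) + 2 * ?I (?d1 s)) + 2 * ?I (?d2 s)) \<longlongrightarrow> 0) (at t)" by simp
  show "((\<lambda>s. LBINT x:{0..1}. (frame_path m0 m1 g1 m2 g2 s x - frame_path m0 m1 g1 m2 g2 t x)\<^sup>2) \<longlongrightarrow> 0) (at t)"
  proof (rule Lim_null_comparison[OF _ lim], intro always_eventually allI)
    fix s
    have e: "frame_path m0 m1 g1 m2 g2 s x - frame_path m0 m1 g1 m2 g2 t x = (?d0 s x + ?d1 s x) + ?d2 s x" for x
      by (simp add: frame_path_def)
    have Ld: "loc_L2 (?d0 s)" "loc_L2 (?d1 s)" "loc_L2 (?d2 s)" by (intro loc_L2_diff L)+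
    have 1: "?I (\<lambda>x. (?d0 s x + ?d1 s x) + ?d2 s x) \<le> 2 * ?I (\<lambda>x. ?d0 s x + ?d1 s x) + 2 * ?I (?d2 s)"
      by (intro set_integral_square_add_le loc_L2_add Ld)
    have 2: "?I (\<lambda>x. ?d0 s x + ?d1 s x) \<le> 2 * ?I (?d0 s) + 2 * ?I (?d1 s)"
      by (intro set_integral_square_add_le Ld)
    have "x \<le> 2 * (2 * a + 2 * b) + 2 * c" if "x \<le> 2 * y + 2 * c" "y \<le> 2 * a + 2 * b" for x y a b c :: real
      using that by simp
    from this[OF 1 2]
    have "?I (\<lambda>x. (?d0 s x + ?d1 s x) + ?d2 s x) \<le> 2 * (2 * ?I (?d0 s) + 2 * ?I (?d1 s)) + 2 * ?I (?d2 s)" .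
    moreover have "?I (\<lambda>x. (?d0 s x + ?d1 s x) + ?d2 s x) \<ge> 0" by (intro set_integral_nonneg_real) auto
    ultimately show "norm (LBINT x:{0..1}. (frame_path m0 m1 g1 m2 g2 s x - frame_path m0 m1 g1 m2 g2 t x)\<^sup>2)
      \<le> 2 * (2 * ?I (?d0 s) + 2 * ?I (?d1 s)) + 2 * ?I (?d2 s)" unfolding e by simp
  qed
qed

end

lemma L2_difference_quotient_tendsto:
  fixes A At W Z :: "real \<Rightarrow> real \<Rightarrow> real"
  assumes At: "\<And>r x. r \<in> {\<alpha><..<\<beta>} \<Longrightarrow> ((\<lambda>r. A r x) has_real_derivative At r x) (at r)"
    and Atc: "continuous_on UNIV (\<lambda>(r, x). At r x)"
    and W: "\<And>r. r \<in> {\<alpha><..<\<beta>} \<Longrightarrow> abs_cont (A r) (W r)"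
    and Z: "\<And>r. r \<in> {\<alpha><..<\<beta>} \<Longrightarrow> abs_cont (At r) (Z r)"
    and t: "t \<in> {\<alpha><..<\<beta>}"
    and Zc: "((\<lambda>s. LBINT x:{0..1}. (Z s x - Z t x)\<^sup>2) \<longlongrightarrow> 0) (at t)"
  shows "((\<lambda>s. LBINT x:{0..1}. ((W s x - W t x) / (s - t) - Z t x)\<^sup>2) \<longlongrightarrow> 0) (at t)"
proof (rule tendstoI)
  fix e :: real assume e: "e > 0"
  have "\<forall>\<^sub>F s in at t. (LBINT x:{0..1}. (Z s x - Z t x)\<^sup>2) < e/2"
    using Zc e by (intro order_tendstoD) auto
  then obtain d where d: "d > 0" "\<And>s. s \<noteq> t \<Longrightarrow> dist s t < d \<Longrightarrow> (LBINT x:{0..1}. (Z s x - Z t x)\<^sup>2) < e/2"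
    unfolding eventually_at by auto
  have "\<forall>\<^sub>F s in at t. s \<in> {\<alpha><..<\<beta>}" using t by (intro eventually_at_in_open') auto
  moreover have "\<forall>\<^sub>F s in at t. s \<noteq> t \<and> dist s t < d" unfolding eventually_at using d(1) by blast
  ultimately show "\<forall>\<^sub>F s in at t. dist (LBINT x:{0..1}. ((W s x - W t x) / (s - t) - Z t x)\<^sup>2) 0 < e"
  proof eventually_elim
    case (elim s)
    \<comment> \<open>Continuity at t controls Z at all times between s and t, since they are no
      farther from t than s is.\<close>
    have "(LBINT x:{0..1}. ((W s x - W t x) / (s - t) - Z t x)\<^sup>2) \<le> e/2"
    proof (rule L2_difference_quotient[OF At Atc W Z elim(1) t])
      fix r assume r: "r \<in> {min s t..max s t}"
      show "(LBINT x:{0..1}. (Z r x - Z t x)\<^sup>2) \<le> e/2"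
      proof (cases "r = t")
        case False
        have "dist r t < d" using r elim(2) by (auto simp: dist_real_def min_def max_def split: if_splits)
        then show ?thesis using d(2)[OF False] by simp
      qed (use e in simp)
    qed (use elim in auto)
    then show ?case
      using e set_integral_nonneg_real[of "{0..1}" "\<lambda>x. ((W s x - W t x) / (s - t) - Z t x)\<^sup>2"] by (simp add: dist_real_def)
  qed
qed

section \<open>The solution defined by the explicit flow\<close>

lemma periodic_bounded:
  fixes f :: "real \<Rightarrow> real"
  assumes f: "continuous_on UNIV f" and per: "periodic_fun_simple' f"
  shows "\<exists>B\<ge>0. \<forall>x. \<bar>f x\<bar> \<le> B"
proof -
  have "continuous_on {0..1} f" by (rule continuous_on_subset[OF f]) simp
  from continuous_bounded_Icc[OF this] obtain B where B: "B > 0" "\<And>x. x \<in> {0..1} \<Longrightarrow> \<bar>f x\<bar> \<le> B" by auto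
  have "\<bar>f x\<bar> \<le> B" for x
    using B(2)[of "frac x"] periodic_frac[OF per, of x] frac_lt_1[of x] frac_ge_0[of x] by simp
  then show ?thesis using B(1) by (intro exI[of _ B]) auto
qed

lemma continuous_snd: "continuous_on UNIV f \<Longrightarrow> continuous_on A (\<lambda>p. f (snd p))" for f :: "real \<Rightarrow> real"
  by (rule continuous_on_compose2[of UNIV f], assumption) (simp_all add: continuous_on_snd)

lemma continuous_fst: "continuous_on UNIV f \<Longrightarrow> continuous_on A (\<lambda>p. f (fst p))" for f :: "real \<Rightarrow> real"
  by (rule continuous_on_compose2[of UNIV f], assumption) (simp_all add: continuous_on_fst)

text \<open>\<open>Cc\<close> and \<open>Sc\<close> stand for \<open>C\<close> and \<open>S = C'\<close>, frozen outside \<open>[\<alpha>,\<beta>]\<close>, so that all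
  functions below are defined and continuous for all times although the equation holds only on
  \<open>(\<alpha>,\<beta>)\<close>.\<close>

locale HS_flow =
  fixes k a \<alpha> \<beta> Mh MC \<mu> :: real and hh Cc Sc u0 v0 w0 \<rho>0 r0 :: "real \<Rightarrow> real"
  assumes \<alpha>\<beta>: "\<alpha> < 0" "0 < \<beta>"
    and hhc: "continuous_on UNIV hh" and hhb: "\<And>t. \<bar>hh t\<bar> \<le> Mh"
    and Ccc: "continuous_on UNIV Cc" and Scc: "continuous_on UNIV Sc"
    and Cd: "\<And>t. t \<in> {\<alpha><..<\<beta>} \<Longrightarrow> (Cc has_real_derivative Sc t) (at t)"
    and Sd: "\<And>t. t \<in> {\<alpha><..<\<beta>} \<Longrightarrow> (Sc has_real_derivative 1 + 2 * a * Cc t) (at t)"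
    and C0: "Cc 0 = 0" and S0: "Sc 0 = 0"
    and SC: "\<And>t. (Sc t)\<^sup>2 = 2 * Cc t + 2 * a * (Cc t)\<^sup>2"
    and Cb: "\<And>t. \<bar>Cc t\<bar> \<le> MC" and Sb: "\<And>t. \<bar>Sc t\<bar> \<le> MC"
    and u0d: "\<And>x. (u0 has_real_derivative v0 x) (at x)"
    and v0a: "abs_cont v0 w0" and r0a: "abs_cont \<rho>0 r0"
    and per: "periodic_fun_simple' u0" "periodic_fun_simple' v0" "periodic_fun_simple' w0"
      "periodic_fun_simple' \<rho>0" "periodic_fun_simple' r0"
    and P_mean: "(LBINT x:{0..1}. k / 2 * (\<rho>0 x)\<^sup>2 + 1 / 2 * (v0 x)\<^sup>2 + a) = 0"
    and \<mu>: "\<mu> > 0" "\<And>t x. \<mu> \<le> 1 + v0 x * Sc t + (k / 2 * (\<rho>0 x)\<^sup>2 + 1 / 2 * (v0 x)\<^sup>2 + a) * Cc t"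
begin

text \<open>\<open>Q t\<close> is an antiderivative of the Jacobian \<open>\<phi> t\<close>. The suffixes 1 and 2 stand for the first and the second
  time derivative.\<close>

definition P where "P x = k / 2 * (\<rho>0 x)\<^sup>2 + 1 / 2 * (v0 x)\<^sup>2 + a"
definition B where "B = inv_dx P"
definition U where "U x = u0 x - u0 0"
definition \<phi> where "\<phi> t x = 1 + v0 x * Sc t + P x * Cc t"
definition \<phi>1 where "\<phi>1 t x = v0 x * (1 + 2 * a * Cc t) + P x * Sc t"
definition \<phi>2 where "\<phi>2 t x = v0 x * (2 * a * Sc t) + P x * (1 + 2 * a * Cc t)"
definition Q where "Q t x = x + U x * Sc t + B x * Cc t"
definition Q1 where "Q1 t x = U x * (1 + 2 * a * Cc t) + B x * Sc t"
definition Q2 where "Q2 t x = U x * (2 * a * Sc t) + B x * (1 + 2 * a * Cc t)"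

section \<open>Regularity and bounds of the explicit Jacobian and its antiderivatives\<close>

lemma v0c: "continuous_on A v0" and \<rho>0c: "continuous_on A \<rho>0"
  by (rule abs_cont_continuous[OF v0a], rule abs_cont_continuous[OF r0a])

lemma Pc: "continuous_on A P"
  unfolding P_def[abs_def] by (intro continuous_intros v0c \<rho>0c)

lemma Bd: "(B has_real_derivative P x) (at x)"
  unfolding B_def by (intro abs_cont_has_derivative abs_cont_inv_dx loc_L2_continuous Pc)

lemma Ud: "(U has_real_derivative v0 x) (at x)"
  unfolding U_def[abs_def] using u0d by (auto intro!: derivative_eq_intros)

lemma Bc: "continuous_on A B" and Uc: "continuous_on A U"
  by (rule DERIV_continuous_on[OF has_field_derivative_at_within[OF Bd]],
      rule DERIV_continuous_on[OF has_field_derivative_at_within[OF Ud]])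

lemma Pper: "periodic_fun_simple' P"
  using periodicD[OF per(2)] periodicD[OF per(4)] by (intro periodicI) (simp add: P_def)

text \<open>P has mean zero by the choice of a. Hence Q t advances by exactly 1 over a period, and
  the flow descends to the circle.\<close>

lemma Bper: "periodic_fun_simple' B"
  unfolding B_def
  by (rule abs_cont_periodic[OF abs_cont_inv_dx[OF loc_L2_continuous[OF Pc]] Pper])
     (use P_mean in \<open>simp add: P_def\<close>)

lemma Uper: "periodic_fun_simple' U"
  using periodicD[OF per(1)] by (intro periodicI) (simp add: U_def)

lemmas space_cont = continuous_snd[OF v0c] continuous_snd[OF Pc] continuous_snd[OF Bc] continuous_snd[OF Uc] continuous_snd[OF \<rho>0c]
lemmas time_cont = continuous_fst[OF Ccc] continuous_fst[OF Scc]

lemma joint_cont: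
  "continuous_on UNIV (\<lambda>(t, x). \<phi> t x)" "continuous_on UNIV (\<lambda>(t, x). \<phi>1 t x)" "continuous_on UNIV (\<lambda>(t, x). \<phi>2 t x)"
  "continuous_on UNIV (\<lambda>(t, x). Q t x)" "continuous_on UNIV (\<lambda>(t, x). Q1 t x)" "continuous_on UNIV (\<lambda>(t, x). Q2 t x)"
  unfolding \<phi>_def \<phi>1_def \<phi>2_def Q_def Q1_def Q2_def case_prod_beta
  by (intro continuous_intros space_cont time_cont)+

lemma Qd: "(Q t has_real_derivative \<phi> t x) (at x)"
  unfolding Q_def[abs_def] \<phi>_def by (auto intro!: derivative_eq_intros Ud Bd)

lemma Q1d: "(Q1 t has_real_derivative \<phi>1 t x) (at x)"
  unfolding Q1_def[abs_def] \<phi>1_def by (auto intro!: derivative_eq_intros Ud Bd)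

lemma Q2d: "(Q2 t has_real_derivative \<phi>2 t x) (at x)"
  unfolding Q2_def[abs_def] \<phi>2_def by (auto intro!: derivative_eq_intros Ud Bd)

lemma \<phi>_ge: "\<mu> \<le> \<phi> t x"
  using \<mu>(2) by (simp add: \<phi>_def P_def)

lemma \<phi>_pos: "\<phi> t x > 0"
  using \<phi>_ge[of t x] \<mu>(1) by simp

lemma \<phi>_per: "\<phi> t (x + 1) = \<phi> t x" "\<phi>1 t (x + 1) = \<phi>1 t x" "\<phi>2 t (x + 1) = \<phi>2 t x"
    "Q t (x + 1) = Q t x + 1" "Q1 t (x + 1) = Q1 t x" "Q2 t (x + 1) = Q2 t x"
  using periodicD[OF per(2)] periodicD[OF Pper] periodicD[OF Bper] periodicD[OF Uper]
  by (simp_all add: \<phi>_def \<phi>1_def \<phi>2_def Q_def Q1_def Q2_def)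

lemma MC0: "MC \<ge> 0"
  using Cb[of 0] by simp

lemma mode_bound:
  assumes "\<And>x. \<bar>f x\<bar> \<le> F" "\<And>x. \<bar>g x\<bar> \<le> G" "\<And>t. \<bar>p t\<bar> \<le> p'" "\<And>t. \<bar>q t\<bar> \<le> q'"
  shows "\<bar>f x * p t + g x * q t\<bar> \<le> F * p' + G * (q' :: real)"
proof -
  have "\<bar>f x * p t\<bar> \<le> F * p'"
    unfolding abs_mult using assms(1)[of x] assms(3)[of t] order_trans[OF abs_ge_zero assms(1)[of x]]
    by (intro mult_mono) auto
  moreover have "\<bar>g x * q t\<bar> \<le> G * q'"
    unfolding abs_mult using assms(2)[of x] assms(4)[of t] order_trans[OF abs_ge_zero assms(2)[of x]]
    by (intro mult_mono) auto
  ultimately show ?thesis using abs_triangle_ineq[of "f x * p t" "g x * q t"] by linarith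
qed

lemma bounds:
  obtains K where "K > 0" "\<And>t x. \<bar>\<phi> t x\<bar> \<le> K" "\<And>t x. \<bar>\<phi>2 t x\<bar> \<le> K" "\<And>t x. \<bar>Q t x - x\<bar> \<le> K" "\<And>t x. \<bar>Q2 t x\<bar> \<le> K"
proof -
  obtain bv where bv: "\<And>x. \<bar>v0 x\<bar> \<le> bv" using periodic_bounded[OF v0c per(2)] by blast
  obtain bP where bP: "\<And>x. \<bar>P x\<bar> \<le> bP" using periodic_bounded[OF Pc Pper] by blast
  obtain bB where bB: "\<And>x. \<bar>B x\<bar> \<le> bB" using periodic_bounded[OF Bc Bper] by blast
  obtain bU where bU: "\<And>x. \<bar>U x\<bar> \<le> bU" using periodic_bounded[OF Uc Uper] by blast
  define L where "L = 1 + 2 * \<bar>a\<bar> * MC"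
  have aC: "\<bar>1 + 2 * a * Cc t\<bar> \<le> L" for t
  proof -
    have "\<bar>2 * a * Cc t\<bar> \<le> 2 * \<bar>a\<bar> * MC" unfolding abs_mult using Cb[of t] by (intro mult_mono) auto
    then show ?thesis unfolding L_def by linarith
  qed
  have aS: "\<bar>2 * a * Sc t\<bar> \<le> L" for t
  proof -
    have "\<bar>2 * a * Sc t\<bar> \<le> 2 * \<bar>a\<bar> * MC" unfolding abs_mult using Sb[of t] by (intro mult_mono) auto
    then show ?thesis unfolding L_def by linarith
  qed
  define K where "K = 1 + (bv * MC + bP * MC) + (bv * L + bP * L) + (bU * MC + bB * MC) + (bU * L + bB * L)"
  have L0: "L \<ge> 0" using MC0 by (simp add: L_def)
  have b0: "bv \<ge> 0" "bP \<ge> 0" "bB \<ge> 0" "bU \<ge> 0"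
    using order_trans[OF abs_ge_zero bv] order_trans[OF abs_ge_zero bP] order_trans[OF abs_ge_zero bB] order_trans[OF abs_ge_zero bU] by auto
  have n: "0 \<le> bv * MC + bP * MC" "0 \<le> bv * L + bP * L" "0 \<le> bU * MC + bB * MC" "0 \<le> bU * L + bB * L"
    using b0 L0 MC0 by simp_all
  show thesis
  proof
    show "K > 0" unfolding K_def using n by linarith
    fix t x
    have "\<bar>v0 x * Sc t + P x * Cc t\<bar> \<le> bv * MC + bP * MC" by (rule mode_bound[OF bv bP Sb Cb])
    then show "\<bar>\<phi> t x\<bar> \<le> K" unfolding \<phi>_def K_def using n by linarith
    have "\<bar>\<phi>2 t x\<bar> \<le> bv * L + bP * L" unfolding \<phi>2_def by (rule mode_bound[OF bv bP aS aC])
    then show "\<bar>\<phi>2 t x\<bar> \<le> K" unfolding K_def using n by linarith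
    have "\<bar>U x * Sc t + B x * Cc t\<bar> \<le> bU * MC + bB * MC" by (rule mode_bound[OF bU bB Sb Cb])
    then show "\<bar>Q t x - x\<bar> \<le> K" unfolding Q_def K_def using n by linarith
    have "\<bar>Q2 t x\<bar> \<le> bU * L + bB * L" unfolding Q2_def by (rule mode_bound[OF bU bB aS aC])
    then show "\<bar>Q2 t x\<bar> \<le> K" unfolding K_def using n by linarith
  qed
qed

text \<open>The Jacobian is at least \<mu>. This gives injectivity and, more precisely, an inverse
  with Lipschitz constant 1/\<mu>.\<close>

lemma Q_expand: "\<mu> * \<bar>x - y\<bar> \<le> \<bar>Q t x - Q t y\<bar>"
proof -
  have less: "\<mu> * (y - x) \<le> Q t y - Q t x" if "x < y" for x y
  proof -
    from MVT2[OF that Qd] obtain z where "Q t y - Q t x = (y - x) * \<phi> t z" by blast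
    then show ?thesis using \<phi>_ge[of t z] that by (simp add: mult.commute)
  qed
  show ?thesis
    using less[of x y] less[of y x] by (cases x y rule: linorder_cases) simp_all
qed

lemma Q_inj: "Q t x = Q t y \<Longrightarrow> x = y"
  using Q_expand[of x y t] \<mu>(1) by (simp add: mult_le_0_iff)

section \<open>Inverse of the spatial map and the translation of the flow\<close>

definition Y where "Y t y = (SOME x. Q t x = y)"

lemma QY: "Q t (Y t y) = y"
  unfolding Y_def
proof (rule someI_ex)
  obtain K where K: "\<And>x. \<bar>Q t x - x\<bar> \<le> K" using bounds by metis
  have "\<exists>x\<ge>y - K. x \<le> y + K \<and> Q t x = y"
  proof (rule IVT')
    show "Q t (y - K) \<le> y" "y \<le> Q t (y + K)" using K[of "y - K"] K[of "y + K"] by linarith+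
    show "y - K \<le> y + K" using K[of y] by linarith
    show "continuous_on {y - K..y + K} (Q t)" by (rule joint_slice[OF joint_cont(4)])
  qed
  then show "\<exists>x. Q t x = y" by blast
qed

lemma YQ: "Y t (Q t x) = x"
  by (rule Q_inj[OF QY])

lemma Y_dist: "\<bar>Y s z - x\<bar> \<le> \<bar>z - Q s x\<bar> / \<mu>"
  using Q_expand[of "Y s z" x s] \<mu>(1) unfolding QY by (simp add: pos_le_divide_eq mult.commute)

text \<open>The distance of Y s z from Y t y is at most |z - Q s (Y t y)| / \<mu>, and this majorant
  is continuous in (s, z) and vanishes at (t, y).\<close>

lemma Yc: "continuous_on UNIV (\<lambda>(t, y). Y t y)"
proof -
  have "isCont (\<lambda>p. Y (fst p) (snd p)) (t, y)" for t y
  proof -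
    have c: "isCont (\<lambda>p. Q (fst p) (Y t y)) (t, y)"
    proof -
      have "continuous_on UNIV (\<lambda>p :: real \<times> real. (\<lambda>(t, x). Q t x) (fst p, Y t y))"
        by (rule continuous_on_compose2[OF joint_cont(4)]) (auto intro!: continuous_intros)
      then show ?thesis by (simp add: continuous_on_eq_continuous_at)
    qed
    have "((\<lambda>p. \<bar>snd p - Q (fst p) (Y t y)\<bar> / \<mu>) \<longlongrightarrow> \<bar>snd (t, y) - Q (fst (t, y)) (Y t y)\<bar> / \<mu>) (at (t, y))"
      using c \<mu>(1) unfolding isCont_def by (intro tendsto_intros) auto
    then have lim: "((\<lambda>p. \<bar>snd p - Q (fst p) (Y t y)\<bar> / \<mu>) \<longlongrightarrow> 0) (at (t, y))" by (simp add: QY)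
    have "((\<lambda>p. Y (fst p) (snd p) - Y t y) \<longlongrightarrow> 0) (at (t, y))"
      by (rule Lim_null_comparison[OF _ lim]) (simp add: Y_dist)
    then show ?thesis by (simp add: isCont_def LIM_zero_iff)
  qed
  then have "continuous_on UNIV (\<lambda>p. Y (fst p) (snd p))"
    by (metis continuous_at_imp_continuous_on surj_pair)
  then show ?thesis by (simp add: case_prod_beta)
qed

text \<open>The flow is \<open>c t + Q t x\<close>, whose velocity must equal \<open>hh\<close> plus the integral from \<open>0\<close> of the right-hand
  side. Since \<open>0\<close> is reached from the label \<open>Y t (- c t)\<close>, this determines \<open>c\<close> through an ordinary differential
  equation for \<open>(c, d)\<close> with \<open>d = c'\<close>.\<close>

definition cd :: "real \<Rightarrow> real \<times> real" where
  "cd = (SOME y. y 0 = (0, u0 0) \<and>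
     (\<forall>t. (y has_vector_derivative (snd (y t), hh t - Q2 t (Y t (- fst (y t))))) (at t)))"
definition c where "c t = fst (cd t)"
definition d where "d t = snd (cd t)"

lemma cd: "cd 0 = (0, u0 0)"
    "(cd has_vector_derivative (snd (cd t), hh t - Q2 t (Y t (- fst (cd t))))) (at t)"
proof -
  obtain K where K: "K > 0" "\<And>t x. \<bar>\<phi>2 t x\<bar> \<le> K" "\<And>t x. \<bar>Q2 t x\<bar> \<le> K" using bounds by metis
  have "\<exists>y. y 0 = (0, u0 0) \<and>
     (\<forall>t. (y has_vector_derivative (\<lambda>t z. (snd z, hh t - Q2 t (Y t (- fst z)))) t (y t)) (at t))"
  proof (rule Picard_Lindeloef)
    have cY: "continuous_on UNIV (\<lambda>(t, x). Q2 t (Y t x))" by (rule joint_compose[OF joint_cont(6) Yc])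
    have "continuous_on UNIV (\<lambda>p :: real \<times> real \<times> real. (\<lambda>(t, x). Q2 t (Y t x)) (fst p, - fst (snd p)))"
      by (rule continuous_on_compose2[OF cY]) (auto intro!: continuous_intros)
    then have "continuous_on UNIV (\<lambda>p :: real \<times> real \<times> real. Q2 (fst p) (Y (fst p) (- fst (snd p))))" by simp
    moreover have "continuous_on UNIV (\<lambda>p :: real \<times> real \<times> real. hh (fst p))"
      by (rule continuous_on_compose2[OF hhc]) (auto intro!: continuous_intros)
    ultimately show "continuous_on UNIV (\<lambda>(t, z :: real \<times> real). (snd z, hh t - Q2 t (Y t (- fst z))))"
      unfolding case_prod_beta by (intro continuous_intros)
    show "norm ((snd z, hh t - Q2 t (Y t (- fst z))) - (snd z', hh t - Q2 t (Y t (- fst z'))))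
        \<le> (1 + K / \<mu>) * norm (z - z')" for t and z z' :: "real \<times> real"
    proof -
      \<comment> \<open>Q2 has slope at most K and Y has Lipschitz constant 1/\<mu>, which gives the
        global Lipschitz bound for the field.\<close>
      have "\<bar>Q2 t (Y t (- fst z)) - Q2 t (Y t (- fst z'))\<bar> \<le> K * \<bar>Y t (- fst z) - Y t (- fst z')\<bar>"
        using field_differentiable_bound[of UNIV "Q2 t" "\<phi>2 t" K "Y t (- fst z)" "Y t (- fst z')"] Q2d K(2) by simp
      also have "\<dots> \<le> K * (\<bar>fst z - fst z'\<bar> / \<mu>)"
        using Y_dist[of t "- fst z" "Y t (- fst z')"] K(1) unfolding QY
        by (intro mult_left_mono) (simp_all add: abs_minus_commute)
      finally have 1: "\<bar>Q2 t (Y t (- fst z)) - Q2 t (Y t (- fst z'))\<bar> \<le> K / \<mu> * \<bar>fst z - fst z'\<bar>" by simp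
      have 2: "\<bar>fst z - fst z'\<bar> \<le> norm (z - z')" "\<bar>snd z - snd z'\<bar> \<le> norm (z - z')"
        using norm_fst_le[of "fst z - fst z'" "snd z - snd z'"] norm_snd_le[of "snd z - snd z'" "fst z - fst z'"]
        by (simp_all add: minus_prod_def)
      have "norm ((snd z, hh t - Q2 t (Y t (- fst z))) - (snd z', hh t - Q2 t (Y t (- fst z'))))
         \<le> \<bar>snd z - snd z'\<bar> + \<bar>Q2 t (Y t (- fst z)) - Q2 t (Y t (- fst z'))\<bar>"
        using norm_Pair_le[of "snd z - snd z'" "- (Q2 t (Y t (- fst z)) - Q2 t (Y t (- fst z')))"] by (simp add: abs_minus_commute)
      also have "\<dots> \<le> norm (z - z') + K / \<mu> * norm (z - z')"
        using 1 2 K(1) \<mu>(1) by (intro add_mono order_trans[OF 1] mult_left_mono) auto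
      finally show ?thesis by (simp add: distrib_right)
    qed
    show "norm (snd (0, u0 0), hh t - Q2 t (Y t (- fst (0 :: real, u0 0)))) \<le> \<bar>u0 0\<bar> + (Mh + K)" for t
    proof -
      have "norm (u0 0, hh t - Q2 t (Y t 0)) \<le> \<bar>u0 0\<bar> + \<bar>hh t - Q2 t (Y t 0)\<bar>"
        using norm_Pair_le[of "u0 0" "hh t - Q2 t (Y t 0)"] by simp
      also have "\<bar>hh t - Q2 t (Y t 0)\<bar> \<le> Mh + K" using hhb[of t] K(3)[of t "Y t 0"] by linarith
      finally show ?thesis by simp
    qed
  qed
  from someI_ex[OF this] show "cd 0 = (0, u0 0)"
    "(cd has_vector_derivative (snd (cd t), hh t - Q2 t (Y t (- fst (cd t))))) (at t)"
    by (auto simp: cd_def)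
qed

lemma c0: "c 0 = 0" and d0: "d 0 = u0 0"
  using cd(1) by (simp_all add: c_def d_def)

lemma c_deriv: "(c has_real_derivative d t) (at t)"
  and d_deriv: "(d has_real_derivative hh t - Q2 t (Y t (- c t))) (at t)"
proof -
  have "((\<lambda>t. fst (cd t)) has_vector_derivative fst (snd (cd t), hh t - Q2 t (Y t (- fst (cd t))))) (at t)"
    "((\<lambda>t. snd (cd t)) has_vector_derivative snd (snd (cd t), hh t - Q2 t (Y t (- fst (cd t))))) (at t)"
    using bounded_linear.has_vector_derivative[OF bounded_linear_fst cd(2)]
      bounded_linear.has_vector_derivative[OF bounded_linear_snd cd(2)] by auto
  then show "(c has_real_derivative d t) (at t)" "(d has_real_derivative hh t - Q2 t (Y t (- c t))) (at t)"
    by (simp_all add: c_def[abs_def] d_def[abs_def] has_real_derivative_iff_has_vector_derivative)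
qed

lemma cc: "continuous_on A c" and dc: "continuous_on A d"
  by (rule DERIV_continuous_on[OF has_field_derivative_at_within[OF c_deriv]],
      rule DERIV_continuous_on[OF has_field_derivative_at_within[OF d_deriv]])

text \<open>The label map: the particle found at x at time t started from X t x.\<close>

definition X where "X t x = Y t (x - c t)"

lemma QX: "c t + Q t (X t x) = x"
  by (simp add: X_def QY)

lemma X_unique: "c t + Q t y = x \<Longrightarrow> X t x = y"
  using YQ[of t y] by (auto simp: X_def)

lemma X_cont: "continuous_on UNIV (\<lambda>(t, x). X t x)"
proof -
  have "continuous_on UNIV (\<lambda>p. (\<lambda>(t, x). Y t x) (fst p, snd p - c (fst p)))"
    by (rule continuous_on_compose2[OF Yc]) (auto intro!: continuous_intros continuous_fst[OF cc])
  then show ?thesis by (simp add: X_def case_prod_beta)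
qed

lemma X_per: "X t (x + 1) = X t x + 1"
  by (rule X_unique) (use QX[of t x] in \<open>simp add: \<phi>_per\<close>)

lemma X_x: "(X t has_real_derivative inverse (\<phi> t (X t x))) (at x)"
proof (rule DERIV_inverse_function[where f="\<lambda>y. c t + Q t y" and a="x - 1" and b="x + 1"])
  show "((\<lambda>y. c t + Q t y) has_real_derivative \<phi> t (X t x)) (at (X t x))"
    using Qd by (auto intro!: derivative_eq_intros)
  show "isCont (X t) x" using joint_slice[OF X_cont, of UNIV t] by (simp add: continuous_on_eq_continuous_at)
  show "\<phi> t (X t x) \<noteq> 0" using \<phi>_pos[of t "X t x"] by simp
qed (auto simp: QX)

lemma inverse_cont:
  "continuous_on UNIV (\<lambda>(t, x). f t x) \<Longrightarrow> (\<And>t x. f t x \<noteq> 0) \<Longrightarrow> continuous_on UNIV (\<lambda>(t, x). inverse (f t x))"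
  for f :: "real \<Rightarrow> real \<Rightarrow> real"
  by (simp add: case_prod_beta continuous_on_inverse)

definition ip where "ip t x = inverse (\<phi> t (X t x))"

lemma ip_pos: "ip t x > 0"
  using \<phi>_pos by (simp add: ip_def)

lemma \<phi>Xc: "continuous_on UNIV (\<lambda>(t, x). \<phi> t (X t x))" "continuous_on UNIV (\<lambda>(t, x). \<phi>1 t (X t x))"
   "continuous_on UNIV (\<lambda>(t, x). \<phi>2 t (X t x))" "continuous_on UNIV (\<lambda>(t, x). Q1 t (X t x))"
   "continuous_on UNIV (\<lambda>(t, x). Q2 t (X t x))"
  by (intro joint_compose[OF _ X_cont] joint_cont)+

lemma ipc: "continuous_on UNIV (\<lambda>(t, x). ip t x)"
  unfolding ip_def using \<phi>_pos by (intro inverse_cont \<phi>Xc) (auto simp: less_imp_neq[THEN not_sym])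

definition KK where "KK = (SOME K. \<forall>t x. \<phi> t x \<le> K)"

lemma KK: "\<phi> t x \<le> KK"
proof -
  obtain K where "\<And>t x. \<bar>\<phi> t x\<bar> \<le> K" using bounds by metis
  then have "\<exists>K. \<forall>t x. \<phi> t x \<le> K" by (meson abs_le_D1)
  from someI_ex[OF this] show ?thesis by (simp add: KK_def)
qed

text \<open>The Jacobian of the label map is 1/\<phi>, so an upper bound on \<phi> is the uniform
  lower Jacobian bound of the frame.\<close>

sublocale moving_frame X ip KK
proof
  show "1 \<le> KK * ip t x" for t x
    using KK[of t "X t x"] \<phi>_pos[of t "X t x"] by (simp add: ip_def divide_inverse[symmetric] pos_le_divide_eq)
  show "continuous_on UNIV (ip t)" for t by (rule joint_slice[OF ipc])
qed (use X_cont X_x ip_pos in \<open>simp_all add: ip_def\<close>)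

text \<open>Quantities along the flow pulled back by the label map: the velocity, its slope
  \<phi>'/\<phi>, the density prescribed by conservation of mass, and \<phi>''/\<phi>. In
  \<open>ut\<close> the value of \<open>Q2\<close> at the label of 0 is subtracted, so that the
  primitive vanishes at x = 0.\<close>

definition u where "u t x = d t + Q1 t (X t x)"
definition v where "v t x = \<phi>1 t (X t x) * ip t x"
definition \<rho> where "\<rho> t x = \<rho>0 (X t x) * ip t x"
definition G where "G t x = \<phi>2 t (X t x) * ip t x"
definition ut where "ut t x = hh t - Q2 t (X t 0) + Q2 t (X t x) - u t x * v t x"

lemma ip_per: "ip t (x + 1) = ip t x"
  by (simp add: ip_def X_per \<phi>_per)

lemma solution_per: "u t (x + 1) = u t x" "v t (x + 1) = v t x" "\<rho> t (x + 1) = \<rho> t x" "G t (x + 1) = G t x"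
    "ut t (x + 1) = ut t x"
  using periodicD[OF per(4)] by (simp_all add: u_def v_def \<rho>_def G_def ut_def X_per \<phi>_per ip_per)

lemma compose_X_cont:
  fixes f :: "real \<Rightarrow> real"
  assumes "continuous_on UNIV f" shows "continuous_on UNIV (\<lambda>(t, x). f (X t x))"
  unfolding case_prod_beta
  by (rule continuous_on_compose2[OF assms Xc[unfolded case_prod_beta]]) simp

lemma solution_cont: "continuous_on UNIV (\<lambda>(t, x). u t x)" "continuous_on UNIV (\<lambda>(t, x). v t x)"
    "continuous_on UNIV (\<lambda>(t, x). \<rho> t x)" "continuous_on UNIV (\<lambda>(t, x). G t x)" "continuous_on UNIV (\<lambda>(t, x). ut t x)"
proof -
  note C = \<phi>Xc[unfolded case_prod_beta] ipc[unfolded case_prod_beta] compose_X_cont[OF \<rho>0c, unfolded case_prod_beta]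
  have "continuous_on UNIV (\<lambda>p :: real \<times> real. (\<lambda>(t, x). Q2 t (X t x)) (fst p, 0))"
    by (rule continuous_on_compose2[OF \<phi>Xc(5)]) (auto intro!: continuous_intros)
  then have Q20: "continuous_on UNIV (\<lambda>p :: real \<times> real. Q2 (fst p) (X (fst p) 0))" by simp
  show u: "continuous_on UNIV (\<lambda>(t, x). u t x)"
    unfolding u_def case_prod_beta by (rule continuous_on_add[OF continuous_fst[OF dc] C(4)])
  show v: "continuous_on UNIV (\<lambda>(t, x). v t x)"
    unfolding v_def case_prod_beta by (rule continuous_on_mult[OF C(2) C(6)])
  show "continuous_on UNIV (\<lambda>(t, x). \<rho> t x)"
    unfolding \<rho>_def case_prod_beta by (rule continuous_on_mult[OF C(7) C(6)])
  show "continuous_on UNIV (\<lambda>(t, x). G t x)"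
    unfolding G_def case_prod_beta by (rule continuous_on_mult[OF C(3) C(6)])
  show "continuous_on UNIV (\<lambda>(t, x). ut t x)"
    unfolding ut_def case_prod_beta
    by (rule continuous_on_diff[OF continuous_on_add[OF continuous_on_diff[OF continuous_fst[OF hhc] Q20] C(5)]
        continuous_on_mult[OF u[unfolded case_prod_beta] v[unfolded case_prod_beta]]])
qed

lemma u_x: "(u t has_real_derivative v t x) (at x)"
proof -
  have "((\<lambda>x. Q1 t (X t x)) has_real_derivative \<phi>1 t (X t x) * ip t x) (at x)"
    by (rule DERIV_chain2[where f="Q1 t" and g="X t", OF Q1d Xd])
  then show ?thesis unfolding u_def[abs_def] v_def by (auto intro!: derivative_eq_intros)
qed

text \<open>Labels are constant along the flow, hence X_t + u X_x = 0.\<close>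

lemma X_t:
  assumes t: "t \<in> {\<alpha><..<\<beta>}"
  shows "((\<lambda>s. X s x) has_real_derivative - u t x * ip t x) (at t)"
proof -
  have "((\<lambda>s. X s x) has_real_derivative - (u t x) / \<phi> t (X t x)) (at t)"
  proof (rule implicit_function_derivative[where A="\<lambda>s y. c s + Q s y" and Ax=\<phi> and S="{\<alpha><..<\<beta>}" and x=x and p="\<lambda>s. X s x"])
    show "((\<lambda>s. c s + Q s (X t x)) has_real_derivative u t x) (at t)"
      unfolding Q_def u_def Q1_def by (auto intro!: derivative_eq_intros c_deriv Cd[OF t] Sd[OF t])
    show "((\<lambda>y. c s + Q s y) has_real_derivative \<phi> s y) (at y)" for s y
      using Qd by (auto intro!: derivative_eq_intros)
    show "continuous_on ({\<alpha><..<\<beta>} \<times> UNIV) (\<lambda>(s, y). \<phi> s y)" by (rule continuous_on_subset[OF joint_cont(1)]) simp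
    have "continuous_on UNIV (\<lambda>s. (\<lambda>(t, x). X t x) (s, x))"
      by (rule continuous_on_compose2[OF Xc]) (auto intro!: continuous_intros)
    then show "isCont (\<lambda>s. X s x) t" by (simp add: continuous_on_eq_continuous_at)
  qed (use t \<phi>_pos QX in auto)
  then show ?thesis by (simp add: ip_def divide_inverse)
qed

lemma u_t:
  assumes t: "t \<in> {\<alpha><..<\<beta>}"
  shows "((\<lambda>s. u s x) has_real_derivative ut t x) (at t)"
proof -
  have "((\<lambda>s. d s + Q1 s (X s x)) has_real_derivative (hh t - Q2 t (Y t (- c t)) + Q2 t (X t x)) + \<phi>1 t (X t x) * (- u t x * ip t x)) (at t)"
  proof (rule joint_chain_rule[where A="\<lambda>s y. d s + Q1 s y" and Ax=\<phi>1 and S="{\<alpha><..<\<beta>}" and p="\<lambda>s. X s x"])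
    show "((\<lambda>s. d s + Q1 s (X t x)) has_real_derivative hh t - Q2 t (Y t (- c t)) + Q2 t (X t x)) (at t)"
      unfolding Q1_def Q2_def[of t "X t x"]
      by (rule derivative_eq_intros d_deriv Cd[OF t] Sd[OF t] refl)+ simp
    show "((\<lambda>y. d s + Q1 s y) has_real_derivative \<phi>1 s y) (at y)" for s y
      using Q1d by (auto intro!: derivative_eq_intros)
    show "continuous_on ({\<alpha><..<\<beta>} \<times> UNIV) (\<lambda>(s, y). \<phi>1 s y)" by (rule continuous_on_subset[OF joint_cont(2)]) simp
  qed (use t X_t in auto)
  moreover have "hh t - Q2 t (Y t (- c t)) + Q2 t (X t x) + \<phi>1 t (X t x) * (- u t x * ip t x) = ut t x"
    by (simp add: ut_def v_def X_def)
  ultimately show ?thesis by (simp add: u_def[abs_def])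
qed

lemma initial: "X 0 x = x" "u 0 x = u0 x" "\<rho> 0 x = \<rho>0 x"
proof -
  show X: "X 0 x = x" by (rule X_unique) (simp add: c0 Q_def C0 S0)
  show "u 0 x = u0 x" "\<rho> 0 x = \<rho>0 x" by (simp_all add: u_def \<rho>_def ip_def X d0 Q1_def U_def \<phi>_def C0 S0)
qed

text \<open>\<phi> \<phi>'' - \<phi>'^2 / 2 - a \<phi>^2 is conserved. Expanding it leaves the
  initial value plus a multiple of the relation between S and C recorded in \<open>SC\<close>, which
  is itself a first integral of S' = 1 + 2aC.\<close>

lemma \<phi>_first_integral: "\<phi> t x * \<phi>2 t x = k / 2 * (\<rho>0 x)\<^sup>2 + 1 / 2 * (\<phi>1 t x)\<^sup>2 + a * (\<phi> t x)\<^sup>2"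
proof -
  have "\<phi> t x * \<phi>2 t x - 1 / 2 * (\<phi>1 t x)\<^sup>2 - a * (\<phi> t x)\<^sup>2
     = (P x - a - (v0 x)\<^sup>2 / 2) + ((Sc t)\<^sup>2 - 2 * Cc t - 2 * a * (Cc t)\<^sup>2) * (a * (v0 x)\<^sup>2 - (P x)\<^sup>2 / 2)"
    unfolding \<phi>_def \<phi>1_def \<phi>2_def by (simp add: algebra_simps power2_eq_square)
  then show ?thesis using SC[of t] by (simp add: P_def)
qed

text \<open>The first integral of \<phi>, divided by \<phi>^2 and pulled back by the label map, is
  the integrand on the right of the first equation.\<close>

lemma G_eq: "G t x = k / 2 * (\<rho> t x)\<^sup>2 + 1 / 2 * (v t x)\<^sup>2 + a"
proof -
  have i: "\<phi> t (X t x) * ip t x = 1" using \<phi>_pos[of t "X t x"] by (simp add: ip_def)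
  have "G t x = (\<phi> t (X t x) * ip t x) * (\<phi>2 t (X t x) * ip t x)" by (simp add: i G_def)
  also have "\<dots> = (\<phi> t (X t x) * \<phi>2 t (X t x)) * (ip t x)\<^sup>2" by (simp add: power2_eq_square mult_ac)
  also have "\<dots> = k / 2 * (\<rho> t x)\<^sup>2 + 1 / 2 * (v t x)\<^sup>2 + a * (\<phi> t (X t x) * ip t x)\<^sup>2"
    unfolding \<phi>_first_integral by (simp add: \<rho>_def v_def power_mult_distrib algebra_simps)
  finally show ?thesis by (simp add: i)
qed

lemma momentum: "ut t x + u t x * v t x = inv_dx (G t) x + hh t"
proof -
  have Gc: "continuous_on A (G t)" for A by (rule joint_slice[OF solution_cont(4)])
  have "((\<lambda>x. Q2 t (X t x)) has_real_derivative G t x) (at x)" for x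
    using DERIV_chain2[OF Q2d Xd] by (simp add: G_def ip_def)
  then have A: "abs_cont (\<lambda>x. Q2 t (X t x)) (G t)" by (rule abs_cont_C1) (rule Gc)
  have I: "abs_cont (inv_dx (G t)) (G t)" by (intro abs_cont_inv_dx loc_L2_continuous Gc)
  have "inv_dx (G t) y - inv_dx (G t) z = Q2 t (X t y) - Q2 t (X t z)" if "z \<le> y" for y z
    unfolding abs_contD[OF A that] by (rule abs_contD[OF I that])
  from this[of 0 x] this[of x 0] have "inv_dx (G t) x = Q2 t (X t x) - Q2 t (X t 0)" by (cases "0 \<le> x") simp_all
  then show ?thesis by (simp add: ut_def)
qed

end

section \<open>Criteria for continuity and differentiability in Sobolev norms\<close>

lemma abs_cont_cong:
  assumes "abs_cont f g" "\<And>x. f x = f' x" "\<And>x. g x = g' x" shows "abs_cont f' g'"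
proof -
  have "f = f'" "g = g'" using assms(2,3) by auto
  then show ?thesis using assms(1) by simp
qed

lemma C0_sobolev_0I:
  assumes L: "\<And>t. loc_L2 (w t)" "\<And>t. periodic_fun_simple' (w t)"
    and lim: "\<And>t. t \<in> time_interval T \<Longrightarrow> ((\<lambda>s. LBINT x:{0..1}. (w s x - w t x)\<^sup>2) \<longlongrightarrow> 0) (at t)"
  shows "w \<in> C0_sobolev T 0"
  unfolding C0_sobolev_def
proof (intro CollectI conjI ballI)
  have sq: "square_integrable (w t)" for t by (intro square_integrableI L)
  show "w t \<in> sobolev 0" for t
    unfolding sobolev_def using sq[of t] has_weak_deriv_0[OF sq[of t]] by auto
  fix t assume t: "t \<in> time_interval T"
  have eq: "sobolev_norm 0 (\<lambda>x. w s x - w t x) = sqrt (LBINT x:{0..1}. (w s x - w t x)\<^sup>2)" for s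
    by (intro sobolev_norm_0 square_integrableI loc_L2_diff periodic_diff L)
  have "((\<lambda>s. sqrt (LBINT x:{0..1}. (w s x - w t x)\<^sup>2)) \<longlongrightarrow> sqrt 0) (at t)"
    by (intro tendsto_real_sqrt lim t)
  then show "((\<lambda>s. sobolev_norm 0 (\<lambda>x. w s x - w t x)) \<longlongrightarrow> 0) (at t within time_interval T)"
    unfolding eq by (auto intro: tendsto_within_subset)
qed

lemma C0_sobolev_1I:
  assumes w: "\<And>t. abs_cont (w t) (w' t)" "\<And>t. periodic_fun_simple' (w t)" "\<And>t. periodic_fun_simple' (w' t)"
    and lim: "\<And>t. t \<in> time_interval T \<Longrightarrow> ((\<lambda>s. LBINT x:{0..1}. (w s x - w t x)\<^sup>2) \<longlongrightarrow> 0) (at t)"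
      "\<And>t. t \<in> time_interval T \<Longrightarrow> ((\<lambda>s. LBINT x:{0..1}. (w' s x - w' t x)\<^sup>2) \<longlongrightarrow> 0) (at t)"
  shows "w \<in> C0_sobolev T 1"
  unfolding C0_sobolev_def
proof (intro CollectI conjI ballI)
  show "w t \<in> sobolev 1" for t by (rule sobolev_1I[OF w])
  fix t assume t: "t \<in> time_interval T"
  have eq: "sobolev_norm 1 (\<lambda>x. w s x - w t x) =
      sqrt ((LBINT x:{0..1}. (w s x - w t x)\<^sup>2) + (LBINT x:{0..1}. (w' s x - w' t x)\<^sup>2))" for s
    by (intro sobolev_norm_1 abs_cont_diff periodic_diff w)
  have "((\<lambda>s. sqrt ((LBINT x:{0..1}. (w s x - w t x)\<^sup>2) + (LBINT x:{0..1}. (w' s x - w' t x)\<^sup>2))) \<longlongrightarrow> sqrt (0 + 0)) (at t)"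
    by (intro tendsto_real_sqrt tendsto_add lim t)
  then show "((\<lambda>s. sobolev_norm 1 (\<lambda>x. w s x - w t x)) \<longlongrightarrow> 0) (at t within time_interval T)"
    unfolding eq by (auto intro: tendsto_within_subset)
qed

lemma C0_sobolev_2I:
  assumes d: "\<And>t x. (w t has_real_derivative w' t x) (at x)" and w: "\<And>t. abs_cont (w' t) (w'' t)"
    "\<And>t. periodic_fun_simple' (w t)" "\<And>t. periodic_fun_simple' (w' t)" "\<And>t. periodic_fun_simple' (w'' t)"
    and lim: "\<And>t. t \<in> time_interval T \<Longrightarrow> ((\<lambda>s. LBINT x:{0..1}. (w s x - w t x)\<^sup>2) \<longlongrightarrow> 0) (at t)"
      "\<And>t. t \<in> time_interval T \<Longrightarrow> ((\<lambda>s. LBINT x:{0..1}. (w' s x - w' t x)\<^sup>2) \<longlongrightarrow> 0) (at t)"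
      "\<And>t. t \<in> time_interval T \<Longrightarrow> ((\<lambda>s. LBINT x:{0..1}. (w'' s x - w'' t x)\<^sup>2) \<longlongrightarrow> 0) (at t)"
  shows "w \<in> C0_sobolev T 2"
  unfolding C0_sobolev_def
proof (intro CollectI conjI ballI)
  show "w t \<in> sobolev 2" for t by (rule sobolev_2I(1)[OF d w])
  fix t assume t: "t \<in> time_interval T"
  have eq: "sobolev_norm 2 (\<lambda>x. w s x - w t x) =
      sqrt ((LBINT x:{0..1}. (w s x - w t x)\<^sup>2) + (LBINT x:{0..1}. (w' s x - w' t x)\<^sup>2) + (LBINT x:{0..1}. (w'' s x - w'' t x)\<^sup>2))" for s
    by (intro sobolev_norm_2 abs_cont_diff periodic_diff w DERIV_diff d)
  have "((\<lambda>s. sqrt ((LBINT x:{0..1}. (w s x - w t x)\<^sup>2) + (LBINT x:{0..1}. (w' s x - w' t x)\<^sup>2) + (LBINT x:{0..1}. (w'' s x - w'' t x)\<^sup>2)))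
      \<longlongrightarrow> sqrt (0 + 0 + 0)) (at t)"
    by (intro tendsto_real_sqrt tendsto_add lim t)
  then show "((\<lambda>s. sobolev_norm 2 (\<lambda>x. w s x - w t x)) \<longlongrightarrow> 0) (at t within time_interval T)"
    unfolding eq by (auto intro: tendsto_within_subset)
qed

lemma C1_sobolev_deriv_0I:
  assumes C: "w \<in> C0_sobolev T 0" "wt \<in> C0_sobolev T 0"
    and L: "\<And>t. loc_L2 (w t)" "\<And>t. periodic_fun_simple' (w t)" "\<And>t. loc_L2 (wt t)" "\<And>t. periodic_fun_simple' (wt t)"
    and lim: "\<And>t. t \<in> time_interval T \<Longrightarrow> ((\<lambda>s. LBINT x:{0..1}. ((w s x - w t x) / (s - t) - wt t x)\<^sup>2) \<longlongrightarrow> 0) (at t)"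
  shows "C1_sobolev_deriv T 0 w wt"
  unfolding C1_sobolev_deriv_def
proof (intro conjI C ballI)
  fix t assume t: "t \<in> time_interval T"
  have eq: "sobolev_norm 0 (\<lambda>x. (w s x - w t x) / (s - t) - wt t x) = sqrt (LBINT x:{0..1}. ((w s x - w t x) / (s - t) - wt t x)\<^sup>2)" for s
  proof (intro sobolev_norm_0 square_integrableI)
    have "loc_L2 (\<lambda>x. (1 / (s - t)) * (w s x - w t x) - wt t x)" by (intro loc_L2_diff loc_L2_cmult L)
    then show "loc_L2 (\<lambda>x. (w s x - w t x) / (s - t) - wt t x)" by simp
    show "periodic_fun_simple' (\<lambda>x. (w s x - w t x) / (s - t) - wt t x)"
      using periodicD[OF L(2)] periodicD[OF L(4)] by (intro periodicI) simp
  qed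
  have "((\<lambda>s. sqrt (LBINT x:{0..1}. ((w s x - w t x) / (s - t) - wt t x)\<^sup>2)) \<longlongrightarrow> sqrt 0) (at t)"
    by (intro tendsto_real_sqrt lim t)
  then show "((\<lambda>s. sobolev_norm 0 (\<lambda>x. (w s x - w t x) / (s - t) - wt t x)) \<longlongrightarrow> 0) (at t within time_interval T)"
    unfolding eq by (auto intro: tendsto_within_subset)
qed

text \<open>By Hoelder continuity, convergence of the difference quotient at a single point and convergence of
  its \<open>x\<close>-derivative in \<open>L\<^sup>2\<close> imply convergence in \<open>H\<^sup>1\<close>.\<close>

lemma C1_sobolev_deriv_1I:
  assumes C: "w \<in> C0_sobolev T 1" "wt \<in> C0_sobolev T 1"
    and w: "\<And>t. abs_cont (w t) (w' t)" "\<And>t. periodic_fun_simple' (w t)" "\<And>t. periodic_fun_simple' (w' t)"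
    and wt: "\<And>t. abs_cont (wt t) (wt' t)" "\<And>t. periodic_fun_simple' (wt t)" "\<And>t. periodic_fun_simple' (wt' t)"
    and d: "\<And>t. t \<in> time_interval T \<Longrightarrow> ((\<lambda>s. w s 0) has_real_derivative wt t 0) (at t)"
    and lim: "\<And>t. t \<in> time_interval T \<Longrightarrow> ((\<lambda>s. LBINT x:{0..1}. ((w' s x - w' t x) / (s - t) - wt' t x)\<^sup>2) \<longlongrightarrow> 0) (at t)"
  shows "C1_sobolev_deriv T 1 w wt"
  unfolding C1_sobolev_deriv_def
proof (intro conjI C ballI)
  fix t assume t: "t \<in> time_interval T"
  let ?D = "\<lambda>s x. (w s x - w t x) / (s - t) - wt t x"
  let ?D' = "\<lambda>s x. (w' s x - w' t x) / (s - t) - wt' t x"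
  let ?I = "\<lambda>f. LBINT x:{0..1}. (f x :: real)\<^sup>2"
  have A: "abs_cont (?D s) (?D' s)" for s
    by (rule abs_cont_cong[OF abs_cont_diff[OF abs_cont_cmult[OF abs_cont_diff[OF w(1)[of s] w(1)[of t]], of "1 / (s - t)"] wt(1)[of t]]]) simp_all
  have per: "periodic_fun_simple' (?D s)" "periodic_fun_simple' (?D' s)" for s
    using periodicD[OF w(2)] periodicD[OF wt(2)] periodicD[OF w(3)] periodicD[OF wt(3)]
    by (intro periodicI, simp)+
  have L: "loc_L2 (?D s)" for s by (intro loc_L2_continuous abs_cont_continuous[OF A])
  have nn: "0 \<le> ?I f" for f :: "real \<Rightarrow> real" by (intro set_integral_nonneg_real) auto
  have bound: "?I (?D s) \<le> 2 * (?D s 0)\<^sup>2 + 2 * ?I (?D' s)" for s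
  proof -
    have "?I (?D s) \<le> (LBINT x:{0..1::real}. 2 * (?D s 0)\<^sup>2 + 2 * ?I (?D' s))"
    proof (rule set_integral_mono)
      fix x :: real assume x: "x \<in> {0..1}"
      have "(?D s x - ?D s 0)\<^sup>2 \<le> (x - 0) * ?I (?D' s)" by (rule abs_cont_Hoelder[OF A]) (use x in auto)
      also have "\<dots> \<le> 1 * ?I (?D' s)" using x nn by (intro mult_right_mono) auto
      finally have "(?D s x - ?D s 0)\<^sup>2 \<le> ?I (?D' s)" by simp
      moreover have "y\<^sup>2 \<le> 2 * z\<^sup>2 + 2 * (y - z)\<^sup>2" for y z :: real
        using zero_le_power2[of "y - 2 * z"] by (simp add: power2_eq_square algebra_simps)
      ultimately show "(?D s x)\<^sup>2 \<le> 2 * (?D s 0)\<^sup>2 + 2 * ?I (?D' s)"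
        by (smt (verit))
    qed (use loc_L2_sq_integrable[OF L] in \<open>auto simp: loc_L2_integrable\<close>)
    then show ?thesis by (simp add: set_integral_Icc_const)
  qed
  have D0: "((\<lambda>s. ?D s 0) \<longlongrightarrow> 0) (at t)"
    using d[OF t] by (simp add: has_field_derivative_iff LIM_zero)
  have "((\<lambda>s. 2 * (?D s 0)\<^sup>2 + 2 * ?I (?D' s)) \<longlongrightarrow> 2 * 0\<^sup>2 + 2 * 0) (at t)"
    by (intro tendsto_intros D0 lim t)
  then have lim2: "((\<lambda>s. 2 * (?D s 0)\<^sup>2 + 2 * ?I (?D' s)) \<longlongrightarrow> 0) (at t)" by simp
  have lim0: "((\<lambda>s. ?I (?D s)) \<longlongrightarrow> 0) (at t)"
    by (rule Lim_null_comparison[OF _ lim2], intro always_eventually allI) (use bound nn in simp)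
  have eq: "sobolev_norm 1 (?D s) = sqrt (?I (?D s) + ?I (?D' s))" for s
    by (rule sobolev_norm_1[OF A per])
  have "((\<lambda>s. sqrt (?I (?D s) + ?I (?D' s))) \<longlongrightarrow> sqrt (0 + 0)) (at t)"
    by (intro tendsto_real_sqrt tendsto_add lim0 lim t)
  then show "((\<lambda>s. sobolev_norm 1 (?D s)) \<longlongrightarrow> 0) (at t within time_interval T)"
    unfolding eq by (auto intro: tendsto_within_subset)
qed

section \<open>Sobolev regularity of the constructed solution\<close>

context HS_flow begin

definition Px where "Px x = k * \<rho>0 x * r0 x + v0 x * w0 x"
definition \<phi>x where "\<phi>x t x = w0 x * Sc t + Px x * Cc t"
definition \<phi>1x where "\<phi>1x t x = w0 x * (1 + 2 * a * Cc t) + Px x * Sc t"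

lemma P_ac: "abs_cont P Px"
  by (rule abs_cont_cong[OF abs_cont_add[OF abs_cont_add[OF
        abs_cont_cmult[OF abs_cont_mult[OF r0a r0a], of "k / 2"]
        abs_cont_cmult[OF abs_cont_mult[OF v0a v0a], of "1 / 2"]] abs_cont_const[of a]]])
     (simp_all add: P_def Px_def power2_eq_square)

lemma \<phi>_ac: "abs_cont (\<phi> t) (\<phi>x t)"
  by (rule abs_cont_cong[OF abs_cont_add[OF abs_cont_add[OF abs_cont_const[of 1]
        abs_cont_cmult[OF v0a, of "Sc t"]] abs_cont_cmult[OF P_ac, of "Cc t"]]])
     (simp_all add: \<phi>_def \<phi>x_def)

lemma \<phi>1_ac: "abs_cont (\<phi>1 t) (\<phi>1x t)"
  by (rule abs_cont_cong[OF abs_cont_add[OF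
        abs_cont_cmult[OF v0a, of "1 + 2 * a * Cc t"] abs_cont_cmult[OF P_ac, of "Sc t"]]])
     (simp_all add: \<phi>1_def \<phi>1x_def)

text \<open>The quotients \<phi>'/\<phi> and \<rho>_0/\<phi> are differentiated in x and composed
  with the label map. \<open>a1\<close> and \<open>b1\<close> collect the factors of u_0'', while
  \<open>a2\<close> and \<open>b2\<close> collect those of \<rho>_0'.\<close>

definition a1 where "a1 t x = ((1 + 2 * a * Cc t + v0 (X t x) * Sc t) * ip t x
  - \<phi>1 t (X t x) * (Sc t + v0 (X t x) * Cc t) * (ip t x)\<^sup>2) * ip t x"
definition a2 where "a2 t x = (k * \<rho>0 (X t x) * Sc t * ip t x
  - \<phi>1 t (X t x) * (k * \<rho>0 (X t x) * Cc t) * (ip t x)\<^sup>2) * ip t x"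
definition b1 where "b1 t x = (- \<rho>0 (X t x) * (Sc t + v0 (X t x) * Cc t) * (ip t x)\<^sup>2) * ip t x"
definition b2 where "b2 t x = (ip t x - \<rho>0 (X t x) * (k * \<rho>0 (X t x) * Cc t) * (ip t x)\<^sup>2) * ip t x"

definition vx where "vx = frame_path (\<lambda>_ _. 0) a1 w0 a2 r0"
definition rx where "rx = frame_path (\<lambda>_ _. 0) b1 w0 b2 r0"
text \<open>These are u_tx = G - v^2 - u v_x and \<rho>_t = -\<rho> v - u \<rho>_x, with the
  coefficients of v_x and \<rho>_x inserted.\<close>

definition utx where "utx = frame_path (\<lambda>t x. G t x - (v t x)\<^sup>2) (\<lambda>t x. - u t x * a1 t x) w0 (\<lambda>t x. - u t x * a2 t x) r0"
definition rt where "rt = frame_path (\<lambda>t x. - \<rho> t x * v t x) (\<lambda>t x. - u t x * b1 t x) w0 (\<lambda>t x. - u t x * b2 t x) r0"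

lemma coefficient_cont:
  "continuous_on UNIV (\<lambda>(t, x). a1 t x)" "continuous_on UNIV (\<lambda>(t, x). a2 t x)"
  "continuous_on UNIV (\<lambda>(t, x). b1 t x)" "continuous_on UNIV (\<lambda>(t, x). b2 t x)"
proof -
  note C = \<phi>Xc(2)[unfolded case_prod_beta] ipc[unfolded case_prod_beta] compose_X_cont[OF \<rho>0c, unfolded case_prod_beta]
    compose_X_cont[OF v0c, unfolded case_prod_beta] time_cont
  show "continuous_on UNIV (\<lambda>(t, x). a1 t x)" "continuous_on UNIV (\<lambda>(t, x). a2 t x)"
    "continuous_on UNIV (\<lambda>(t, x). b1 t x)" "continuous_on UNIV (\<lambda>(t, x). b2 t x)"
    unfolding a1_def a2_def b1_def b2_def case_prod_beta
    by (intro continuous_on_mult continuous_on_add continuous_on_diff continuous_on_power continuous_on_minus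
        continuous_on_const C)+
qed

lemma coefficient_per: "a1 t (x + 1) = a1 t x" "a2 t (x + 1) = a2 t x" "b1 t (x + 1) = b1 t x" "b2 t (x + 1) = b2 t x"
  using periodicD[OF per(2)] periodicD[OF per(4)]
  by (simp_all add: a1_def a2_def b1_def b2_def X_per \<phi>_per ip_per)

lemma path_per: "vx t (x + 1) = vx t x" "rx t (x + 1) = rx t x" "utx t (x + 1) = utx t x" "rt t (x + 1) = rt t x"
  using periodicD[OF per(3)] periodicD[OF per(5)]
  by (simp_all add: vx_def rx_def utx_def rt_def frame_path_def coefficient_per solution_per X_per)

lemma inverse_\<phi>_ac: "abs_cont (\<lambda>x. inverse (\<phi> t x)) (\<lambda>x. - \<phi>x t x * (inverse (\<phi> t x))\<^sup>2)"
  by (rule abs_cont_inverse[OF \<phi>_ac \<phi>_pos])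

lemma v_ac: "abs_cont (v t) (vx t)"
  by (rule abs_cont_cong[OF abs_cont_compose[OF abs_cont_mult[OF \<phi>1_ac[of t] inverse_\<phi>_ac[of t]] Xd[of t] Xx_pos[of t] Xxc[of t]]])
     (simp_all add: v_def vx_def frame_path_def a1_def a2_def ip_def[symmetric] \<phi>x_def \<phi>1x_def Px_def algebra_simps)

lemma \<rho>_ac: "abs_cont (\<rho> t) (rx t)"
  by (rule abs_cont_cong[OF abs_cont_compose[OF abs_cont_mult[OF r0a inverse_\<phi>_ac[of t]] Xd[of t] Xx_pos[of t] Xxc[of t]]])
     (simp_all add: \<rho>_def rx_def frame_path_def b1_def b2_def ip_def[symmetric] \<phi>x_def Px_def algebra_simps)

lemma u_ac: "abs_cont (u t) (v t)"
  by (rule abs_cont_C1[OF u_x abs_cont_continuous[OF v_ac]])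

lemma Q2X_ac: "abs_cont (\<lambda>x. Q2 t (X t x)) (G t)"
proof (rule abs_cont_C1)
  show "((\<lambda>x. Q2 t (X t x)) has_real_derivative G t x) (at x)" for x
    using DERIV_chain2[OF Q2d Xd] by (simp add: G_def ip_def)
  show "continuous_on UNIV (G t)" by (rule joint_slice[OF solution_cont(4)])
qed

lemma ut_ac: "abs_cont (ut t) (utx t)"
  by (rule abs_cont_cong[OF abs_cont_diff[OF abs_cont_add[OF abs_cont_const[of "hh t - Q2 t (X t 0)"] Q2X_ac] abs_cont_mult[OF u_ac v_ac]]])
     (simp_all add: ut_def utx_def vx_def frame_path_def power2_eq_square algebra_simps)

lemma flux_ac: "abs_cont (\<lambda>x. \<rho> t x * u t x) (\<lambda>x. rx t x * u t x + \<rho> t x * v t x)"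
  by (rule abs_cont_mult[OF \<rho>_ac u_ac])

lemma rt_eq: "rt t x = - (rx t x * u t x + \<rho> t x * v t x)"
  by (simp add: rt_def rx_def frame_path_def algebra_simps)

lemma joint_L2_continuous:
  fixes w :: "real \<Rightarrow> real \<Rightarrow> real"
  assumes "continuous_on UNIV (\<lambda>(t, x). w t x)"
  shows "((\<lambda>s. LBINT x:{0..1}. (w s x - w t x)\<^sup>2) \<longlongrightarrow> 0) (at t)"
  using compose_L2_continuous[of "\<lambda>_. 1" w t] assms by simp

lemma joint_mult: "continuous_on UNIV (\<lambda>(t, x). f t x) \<Longrightarrow> continuous_on UNIV (\<lambda>(t, x). g t x) \<Longrightarrow>
   continuous_on UNIV (\<lambda>(t, x). f t x * g t x)" 
  and joint_minus: "continuous_on UNIV (\<lambda>(t, x). f t x) \<Longrightarrow> continuous_on UNIV (\<lambda>(t, x). - f t x)"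
  and joint_diff: "continuous_on UNIV (\<lambda>(t, x). f t x) \<Longrightarrow> continuous_on UNIV (\<lambda>(t, x). g t x) \<Longrightarrow>
   continuous_on UNIV (\<lambda>(t, x). f t x - g t x)" for f g :: "real \<Rightarrow> real \<Rightarrow> real"
  by (simp_all add: case_prod_beta continuous_on_mult continuous_on_minus continuous_on_diff)

lemma path_L2_continuous:
  "((\<lambda>s. LBINT x:{0..1}. (vx s x - vx t x)\<^sup>2) \<longlongrightarrow> 0) (at t)" "loc_L2 (vx t)"
  "((\<lambda>s. LBINT x:{0..1}. (rx s x - rx t x)\<^sup>2) \<longlongrightarrow> 0) (at t)" "loc_L2 (rx t)"
  "((\<lambda>s. LBINT x:{0..1}. (utx s x - utx t x)\<^sup>2) \<longlongrightarrow> 0) (at t)" "loc_L2 (utx t)"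
  "((\<lambda>s. LBINT x:{0..1}. (rt s x - rt t x)\<^sup>2) \<longlongrightarrow> 0) (at t)" "loc_L2 (rt t)"
proof -
  note L = abs_cont_loc_L2[OF v0a] abs_cont_loc_L2[OF r0a]
  have z: "continuous_on UNIV (\<lambda>(t :: real, x :: real). 0 :: real)" by (simp add: case_prod_beta)
  note s = solution_cont coefficient_cont
  have v2: "continuous_on UNIV (\<lambda>(t, x). (v t x)\<^sup>2)" unfolding power2_eq_square by (intro joint_mult s)
  show "((\<lambda>s. LBINT x:{0..1}. (vx s x - vx t x)\<^sup>2) \<longlongrightarrow> 0) (at t)" "loc_L2 (vx t)"
    unfolding vx_def by (rule frame_path_continuous[OF L z s(6,7)])+
  show "((\<lambda>s. LBINT x:{0..1}. (rx s x - rx t x)\<^sup>2) \<longlongrightarrow> 0) (at t)" "loc_L2 (rx t)"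
    unfolding rx_def by (rule frame_path_continuous[OF L z s(8,9)])+
  show "((\<lambda>s. LBINT x:{0..1}. (utx s x - utx t x)\<^sup>2) \<longlongrightarrow> 0) (at t)" "loc_L2 (utx t)"
    unfolding utx_def
    by (rule frame_path_continuous[OF L joint_diff[OF s(4) v2] joint_mult[OF joint_minus[OF s(1)] s(6)] joint_mult[OF joint_minus[OF s(1)] s(7)]])+
  show "((\<lambda>s. LBINT x:{0..1}. (rt s x - rt t x)\<^sup>2) \<longlongrightarrow> 0) (at t)" "loc_L2 (rt t)"
    unfolding rt_def
    by (rule frame_path_continuous[OF L joint_mult[OF joint_minus[OF s(3)] s(2)] joint_mult[OF joint_minus[OF s(1)] s(8)] joint_mult[OF joint_minus[OF s(1)] s(9)]])+
qed

lemma in_domain: "t \<in> time_interval (ereal \<beta>) \<Longrightarrow> t \<in> {\<alpha><..<\<beta>}"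
  using \<alpha>\<beta> by (auto simp: time_interval_def)

lemma u_C0: "u \<in> C0_sobolev T 2"
  by (rule C0_sobolev_2I[where w'=v and w''=vx])
     (auto intro!: u_x v_ac periodicI solution_per path_per joint_L2_continuous solution_cont path_L2_continuous)

lemma \<rho>_C0: "\<rho> \<in> C0_sobolev T 1"
  by (rule C0_sobolev_1I[where w'=rx])
     (auto intro!: \<rho>_ac periodicI solution_per path_per joint_L2_continuous solution_cont path_L2_continuous)

lemma u_C1: "C1_sobolev_deriv (ereal \<beta>) 1 u ut"
proof (rule C1_sobolev_deriv_1I[where w'=v and wt'=utx])
  show "u \<in> C0_sobolev (ereal \<beta>) 1"
    by (rule C0_sobolev_1I[where w'=v])
       (auto intro!: u_ac periodicI solution_per joint_L2_continuous solution_cont)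
  show "ut \<in> C0_sobolev (ereal \<beta>) 1"
    by (rule C0_sobolev_1I[where w'=utx])
       (auto intro!: ut_ac periodicI solution_per path_per joint_L2_continuous solution_cont path_L2_continuous)
  fix t assume t: "t \<in> time_interval (ereal \<beta>)"
  show "((\<lambda>s. u s 0) has_real_derivative ut t 0) (at t)" by (rule u_t[OF in_domain[OF t]])
  \<comment> \<open>v is the x-derivative of u, which is differentiable in time at every point, so
    convergence of the L^2 difference quotients reduces to L^2 continuity of u_tx.\<close>
  show "((\<lambda>s. LBINT x:{0..1}. ((v s x - v t x) / (s - t) - utx t x)\<^sup>2) \<longlongrightarrow> 0) (at t)"
    by (rule L2_difference_quotient_tendsto[where A=u and At=ut, OF u_t solution_cont(5) u_ac ut_ac in_domain[OF t] path_L2_continuous(5)])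
qed (auto intro!: u_ac ut_ac periodicI solution_per path_per)

lemma \<rho>_C1: "C1_sobolev_deriv (ereal \<beta>) 0 \<rho> rt"
proof (rule C1_sobolev_deriv_0I)
  have L: "loc_L2 (\<rho> t)" for t by (intro loc_L2_continuous abs_cont_continuous[OF \<rho>_ac])
  show "loc_L2 (\<rho> t)" for t by (rule L)
  show "\<rho> \<in> C0_sobolev (ereal \<beta>) 0"
    by (rule C0_sobolev_0I) (auto intro!: L periodicI solution_per joint_L2_continuous solution_cont)
  show "rt \<in> C0_sobolev (ereal \<beta>) 0"
    by (rule C0_sobolev_0I) (auto intro!: periodicI path_per path_L2_continuous)
  fix t assume t: "t \<in> time_interval (ereal \<beta>)"
  have dR: "(inv_dx \<rho>0 has_real_derivative \<rho>0 x) (at x)" for x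
    by (intro abs_cont_has_derivative abs_cont_inv_dx loc_L2_continuous \<rho>0c)
  \<comment> \<open>\<rho> is the x-derivative of the primitive of \<rho>_0 at the label X. This
    primitive is differentiable in time with derivative -\<rho> u, so the difference quotient
    criterion applies one level up.\<close>
  show "((\<lambda>s. LBINT x:{0..1}. ((\<rho> s x - \<rho> t x) / (s - t) - rt t x)\<^sup>2) \<longlongrightarrow> 0) (at t)"
  proof (rule L2_difference_quotient_tendsto[where A="\<lambda>t x. inv_dx \<rho>0 (X t x)" and At="\<lambda>t x. - (\<rho> t x * u t x)",
        OF _ _ _ _ in_domain[OF t] path_L2_continuous(7)])
    show "((\<lambda>r. inv_dx \<rho>0 (X r x)) has_real_derivative - (\<rho> r x * u r x)) (at r)" if "r \<in> {\<alpha><..<\<beta>}" for r x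
    proof -
      have "((\<lambda>r. inv_dx \<rho>0 (X r x)) has_real_derivative \<rho>0 (X r x) * (- u r x * ip r x)) (at r)"
        by (rule DERIV_chain2[OF dR X_t[OF that]])
      then show ?thesis by (simp add: \<rho>_def mult_ac)
    qed
    show "continuous_on UNIV (\<lambda>(r, x). - (\<rho> r x * u r x))" by (intro joint_minus joint_mult solution_cont)
    show "abs_cont (\<lambda>x. inv_dx \<rho>0 (X r x)) (\<rho> r)" for r
    proof (rule abs_cont_C1)
      show "((\<lambda>x. inv_dx \<rho>0 (X r x)) has_real_derivative \<rho> r x) (at x)" for x
        unfolding \<rho>_def by (rule DERIV_chain2[where f="inv_dx \<rho>0" and g="X r", OF dR Xd])
    qed (rule abs_cont_continuous[OF \<rho>_ac])
    show "abs_cont (\<lambda>x. - (\<rho> r x * u r x)) (rt r)" for r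
      by (rule abs_cont_cong[OF abs_cont_cmult[OF flux_ac, of "-1"]]) (simp_all add: rt_eq)
  qed
qed (auto intro!: periodicI solution_per path_per path_L2_continuous)

theorem HS_solution:
  assumes hh: "\<And>t. 0 < t \<Longrightarrow> t < \<beta> \<Longrightarrow> hh t = h t" and a: "a = HS_const k u0 \<rho>0"
  shows "HS_solution k h u0 \<rho>0 (ereal \<beta>) u \<rho>"
  unfolding HS_solution_def
proof (intro conjI u_C0 \<rho>_C0, goal_cases)
  case 4
  show ?case
  proof (rule exI[of _ ut], rule exI[of _ rt], intro conjI allI impI u_C1 \<rho>_C1)
  fix t assume t: "0 < t \<and> ereal t < ereal \<beta>"
  have du: "deriv (u t) = v t" using u_x by (intro ext DERIV_imp_deriv)
  show "ut t x + u t x * deriv (u t) x =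
     inv_dx (\<lambda>y. k / 2 * (\<rho> t y)\<^sup>2 + 1 / 2 * (deriv (u t) y)\<^sup>2 + HS_const k u0 \<rho>0) x + h t" for x
    using momentum[of t x] hh t unfolding du a[symmetric] G_eq[symmetric] by simp
  have "has_weak_deriv 1 (\<lambda>x. \<rho> t x * u t x) (\<lambda>x. rx t x * u t x + \<rho> t x * v t x)"
    by (rule abs_cont_has_weak_deriv[OF flux_ac]) (auto intro!: periodicI simp: solution_per path_per)
  from weak_deriv_AE[OF this]
  show "AE x in lborel. rt t x + weak_deriv 1 (\<lambda>y. \<rho> t y * u t y) x = 0"
    by eventually_elim (simp add: rt_eq)
qed
qed (use \<alpha>\<beta> initial in auto)

end

section \<open>Extension of solutions\<close>

text \<open>C solves C'' = 1 + 2aC with zero data: t^2/2 for a = 0, and otherwise (cosh(t sqrt(2a))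
  - 1)/(2a) or its trigonometric counterpart. Solving the equation abstractly treats all signs of a
  together, and the quadratic relation is the energy of the equation.\<close>

lemma density_modes:
  obtains C S :: "real \<Rightarrow> real" where "C 0 = 0" "S 0 = 0"
    "\<And>t. (C has_real_derivative S t) (at t)" "\<And>t. (S has_real_derivative 1 + 2 * a * C t) (at t)"
    "\<And>t. (S t)\<^sup>2 = 2 * C t + 2 * a * (C t)\<^sup>2"
proof -
  have "\<exists>y :: real \<Rightarrow> real \<times> real. y 0 = (0, 0) \<and>
      (\<forall>t. (y has_vector_derivative (\<lambda>t z. (snd z, 1 + 2 * a * fst z)) t (y t)) (at t))"
  proof (rule Picard_Lindeloef)
    show "continuous_on UNIV (\<lambda>(t :: real, z :: real \<times> real). (snd z, 1 + 2 * a * fst z))"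
      unfolding case_prod_beta by (intro continuous_intros)
    show "norm ((snd z, 1 + 2 * a * fst z) - (snd z', 1 + 2 * a * fst z')) \<le> (1 + 2 * \<bar>a\<bar>) * norm (z - z')"
      for z z' :: "real \<times> real"
    proof -
      have "norm ((snd z, 1 + 2 * a * fst z) - (snd z', 1 + 2 * a * fst z'))
          \<le> \<bar>snd z - snd z'\<bar> + \<bar>2 * a * (fst z - fst z')\<bar>"
        using norm_Pair_le[of "snd z - snd z'" "2 * a * (fst z - fst z')"] by (simp add: right_diff_distrib)
      also have "\<dots> \<le> norm (z - z') + 2 * \<bar>a\<bar> * norm (z - z')"
        using norm_fst_le[of "fst z - fst z'" "snd z - snd z'"] norm_snd_le[of "snd z - snd z'" "fst z - fst z'"]
        by (intro add_mono) (auto simp: minus_prod_def abs_mult intro!: mult_left_mono)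
      finally show ?thesis by (simp add: distrib_right)
    qed
    show "norm (snd (0 :: real, 0 :: real), 1 + 2 * a * fst (0 :: real, 0 :: real)) \<le> 1" for t :: real
      by (simp add: norm_Pair)
  qed
  then obtain y :: "real \<Rightarrow> real \<times> real" where y: "y 0 = (0, 0)"
    "\<And>t. (y has_vector_derivative (snd (y t), 1 + 2 * a * fst (y t))) (at t)" by auto
  define C S where "C t = fst (y t)" and "S t = snd (y t)" for t
  have C: "(C has_real_derivative S t) (at t)" and S: "(S has_real_derivative 1 + 2 * a * C t) (at t)" for t
    using bounded_linear.has_vector_derivative[OF bounded_linear_fst y(2)[of t]]
      bounded_linear.has_vector_derivative[OF bounded_linear_snd y(2)[of t]]
    by (simp_all add: C_def[abs_def] S_def[abs_def] has_real_derivative_iff_has_vector_derivative)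
  have 0: "C 0 = 0" "S 0 = 0" using y(1) by (simp_all add: C_def S_def)
  have "\<forall>t. ((\<lambda>t. (S t)\<^sup>2 - 2 * C t - 2 * a * (C t)\<^sup>2) has_real_derivative 0) (at t)"
  proof
    fix t
    have "((\<lambda>t. (S t)\<^sup>2 - 2 * C t - 2 * a * (C t)\<^sup>2) has_real_derivative
        2 * S t * (1 + 2 * a * C t) - 2 * S t - 2 * a * (2 * C t * S t)) (at t)"
      by (rule derivative_eq_intros C S refl)+ simp
    then show "((\<lambda>t. (S t)\<^sup>2 - 2 * C t - 2 * a * (C t)\<^sup>2) has_real_derivative 0) (at t)"
      by (simp add: algebra_simps)
  qed
  then have "(S t)\<^sup>2 - 2 * C t - 2 * a * (C t)\<^sup>2 = (S 0)\<^sup>2 - 2 * C 0 - 2 * a * (C 0)\<^sup>2" for t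
    by (rule DERIV_isconst_all)
  then have "(S t)\<^sup>2 = 2 * C t + 2 * a * (C t)\<^sup>2" for t
    unfolding 0 by (simp add: algebra_simps)
  with 0 C S that show thesis by blast
qed

text \<open>By compactness and periodicity the Jacobian has a positive minimum up to T0. Uniform
  continuity keeps it above half of that a little longer, and the explicit flow gives a solution on
  the longer interval.\<close>

lemma HS_solution_extends:
  fixes h u0 \<rho>0 :: "real \<Rightarrow> real"
  assumes h: "continuous_on {0..} h" and u0: "u0 \<in> sobolev 2" and r0: "\<rho>0 \<in> sobolev 1"
    and a: "a = HS_const k u0 \<rho>0" and T0: "T0 > 0"
    and modes: "C 0 = 0" "S 0 = 0" "\<And>t. (C has_real_derivative S t) (at t)"
      "\<And>t. (S has_real_derivative 1 + 2 * a * C t) (at t)" "\<And>t. (S t)\<^sup>2 = 2 * C t + 2 * a * (C t)\<^sup>2"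
    and pos: "\<And>t x. t \<in> {0..T0} \<Longrightarrow>
      0 < 1 + deriv u0 x * S t + (k / 2 * (\<rho>0 x)\<^sup>2 + 1 / 2 * (deriv u0 x)\<^sup>2 + a) * C t"
  shows "\<exists>\<beta>>T0. \<exists>u \<rho>. HS_solution k h u0 \<rho>0 (ereal \<beta>) u \<rho>"
proof -
  obtain w0 where w0: "\<And>x. (u0 has_real_derivative deriv u0 x) (at x)" "abs_cont (deriv u0) w0"
    "periodic_fun_simple' u0" "periodic_fun_simple' (deriv u0)" "periodic_fun_simple' w0"
    using sobolev_2D[OF u0] by blast
  obtain s0 where s0: "abs_cont \<rho>0 s0" "periodic_fun_simple' \<rho>0" "periodic_fun_simple' s0"
    using sobolev_1D[OF r0] by blast
  define F where "F t x = 1 + deriv u0 x * S t + (k / 2 * (\<rho>0 x)\<^sup>2 + 1 / 2 * (deriv u0 x)\<^sup>2 + a) * C t" for t x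
  have Cc: "continuous_on A C" and Sc: "continuous_on A S" for A
    by (rule DERIV_continuous_on[OF has_field_derivative_at_within[OF modes(3)]],
        rule DERIV_continuous_on[OF has_field_derivative_at_within[OF modes(4)]])
  have Fc: "continuous_on UNIV (\<lambda>(t, x). F t x)"
    unfolding F_def case_prod_beta
    by (intro continuous_intros continuous_snd[OF abs_cont_continuous[OF w0(2)]]
        continuous_snd[OF abs_cont_continuous[OF s0(1)]] continuous_fst[OF Cc] continuous_fst[OF Sc])
  have Fper: "F t (x + 1) = F t x" for t x
    using periodicD[OF w0(4)] periodicD[OF s0(2)] by (simp add: F_def)
  define Z where "Z = {0..T0} \<times> {0..1::real}"
  have "compact Z" "Z \<noteq> {}" using T0 unfolding Z_def by (auto intro!: compact_Times)
  moreover have "continuous_on Z (\<lambda>(t, x). F t x)" by (rule continuous_on_subset[OF Fc]) simp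
  ultimately obtain z where z: "z \<in> Z" "\<And>y. y \<in> Z \<Longrightarrow> (case z of (t, x) \<Rightarrow> F t x) \<le> (case y of (t, x) \<Rightarrow> F t x)"
    using continuous_attains_inf by metis
  define m where "m = F (fst z) (snd z)"
  have m: "m > 0" using z(1) pos[of "fst z" "snd z"] unfolding m_def F_def Z_def by auto
  have mF: "m \<le> F t x" if "t \<in> {0..T0}" "x \<in> {0..1}" for t x
    using z(2)[of "(t, x)"] that by (simp add: Z_def m_def case_prod_beta)
  \<comment> \<open>Enlarged by 1 on each side in time, so that it contains all times within
    \<delta> <= 1 of \<open>{0..T0}\<close>.\<close>
  define Z' where "Z' = {-1..T0+1} \<times> {0..1::real}"
  have "compact Z'" unfolding Z'_def by (intro compact_Times) auto
  moreover have "continuous_on Z' (\<lambda>(t, x). F t x)" by (rule continuous_on_subset[OF Fc]) simp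
  ultimately have "uniformly_continuous_on Z' (\<lambda>(t, x). F t x)" by (rule compact_uniformly_continuous[rotated])
  then obtain e where e: "e > 0" "\<And>p p'. p \<in> Z' \<Longrightarrow> p' \<in> Z' \<Longrightarrow> dist p' p < e \<Longrightarrow>
      dist ((\<lambda>(t, x). F t x) p') ((\<lambda>(t, x). F t x) p) < m / 2"
    using m unfolding uniformly_continuous_on_def by (metis half_gt_zero)
  define \<delta> where "\<delta> = min (e / 2) 1"
  have \<delta>: "\<delta> > 0" "\<delta> < e" "\<delta> \<le> 1" using e(1) by (auto simp: \<delta>_def)
  define \<beta> where "\<beta> = T0 + \<delta>"
  \<comment> \<open>Each time is compared with its nearest point t' in \<open>{0..T0}\<close>. The
    margin below 0 makes the initial time interior, as the two-sided time derivatives in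
    \<open>HS_flow\<close> require.\<close>
  have Flow: "m / 2 \<le> F t x" if t: "t \<in> {-\<delta>..\<beta>}" for t x
  proof -
    define t' where "t' = max 0 (min T0 t)"
    have fr: "frac x \<in> {0..1}" using frac_lt_1[of x] frac_ge_0[of x] by auto
    have t': "t' \<in> {0..T0}" "\<bar>t - t'\<bar> \<le> \<delta>" using t T0 \<delta> by (auto simp: t'_def \<beta>_def)
    have "dist (t, frac x) (t', frac x) < e" using t'(2) \<delta> by (simp add: dist_Pair_Pair dist_real_def)
    moreover have "(t, frac x) \<in> Z'" "(t', frac x) \<in> Z'" using fr t t' \<delta> by (auto simp: Z'_def \<beta>_def)
    ultimately have "\<bar>F t (frac x) - F t' (frac x)\<bar> < m / 2"
      using e(2)[of "(t', frac x)" "(t, frac x)"] by (simp add: dist_real_def)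
    moreover have "F t (frac x) = F t x" using Fper by (intro periodic_frac periodicI)
    ultimately show ?thesis using mF[OF t'(1) fr] by linarith
  qed
  define cl where "cl t = max (-\<delta>) (min \<beta> t)" for t
  have cl: "cl t \<in> {-\<delta>..\<beta>}" for t using \<delta> T0 by (auto simp: cl_def \<beta>_def)
  have clc: "continuous_on UNIV cl" unfolding cl_def by (intro continuous_intros)
  have cl_id: "cl t = t" if "t \<in> {-\<delta>..\<beta>}" for t using that by (simp add: cl_def)
  obtain MC where MC: "\<And>t. t \<in> {-\<delta>..\<beta>} \<Longrightarrow> \<bar>C t\<bar> \<le> MC" "\<And>t. t \<in> {-\<delta>..\<beta>} \<Longrightarrow> \<bar>S t\<bar> \<le> MC"
  proof -
    obtain B1 where B1: "\<forall>t\<in>{-\<delta>..\<beta>}. \<bar>C t\<bar> \<le> B1" using continuous_bounded_Icc[OF Cc] by meson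
    obtain B2 where B2: "\<forall>t\<in>{-\<delta>..\<beta>}. \<bar>S t\<bar> \<le> B2" using continuous_bounded_Icc[OF Sc] by meson
    show thesis by (rule that[of "max B1 B2"]) (use B1 B2 in \<open>auto intro: max.coboundedI1 max.coboundedI2\<close>)
  qed
  \<comment> \<open>The forcing is given for nonnegative times only. Clamping makes it continuous
    and bounded on the line without changing it on the interval of the solution.\<close>
  define ch where "ch t = max 0 (min \<beta> t)" for t :: real
  define hh where "hh t = h (ch t)" for t
  have ch: "ch t \<in> {0..\<beta>}" for t using \<delta> T0 by (auto simp: ch_def \<beta>_def)
  have "continuous_on {0..\<beta>} h" by (rule continuous_on_subset[OF h]) auto
  from continuous_bounded_Icc[OF this] obtain Mh where Mh: "\<forall>t\<in>{0..\<beta>}. \<bar>h t\<bar> \<le> Mh" by meson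
  have chc: "continuous_on UNIV ch" unfolding ch_def by (intro continuous_intros)
  have loc: "(f has_real_derivative D) (at t) \<Longrightarrow> ((\<lambda>t. f (cl t)) has_real_derivative D) (at t)"
    if "t \<in> {-\<delta><..<\<beta>}" for f t D
    by (rule has_field_derivative_transform_within_open[where S="{-\<delta><..<\<beta>}"]) (use that cl_id in auto)
  interpret HS_flow k a "-\<delta>" \<beta> Mh MC "m / 2" hh "\<lambda>t. C (cl t)" "\<lambda>t. S (cl t)" u0 "deriv u0" w0 \<rho>0 s0
  proof
    show "- \<delta> < 0" "0 < \<beta>" using \<delta> T0 by (auto simp: \<beta>_def)
    show "continuous_on UNIV hh"
      unfolding hh_def by (rule continuous_on_compose2[OF h chc]) (use ch in auto)
    show "\<bar>hh t\<bar> \<le> Mh" for t unfolding hh_def using Mh ch by blast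
    show "continuous_on UNIV (\<lambda>t. C (cl t))" "continuous_on UNIV (\<lambda>t. S (cl t))"
      by (rule continuous_on_compose2[OF Cc clc subset_UNIV], rule continuous_on_compose2[OF Sc clc subset_UNIV])
    show "((\<lambda>t. C (cl t)) has_real_derivative S (cl t)) (at t)"
      "((\<lambda>t. S (cl t)) has_real_derivative 1 + 2 * a * C (cl t)) (at t)" if "t \<in> {-\<delta><..<\<beta>}" for t
    proof -
      have "cl t = t" using that by (intro cl_id) auto
      then show "((\<lambda>t. C (cl t)) has_real_derivative S (cl t)) (at t)"
        "((\<lambda>t. S (cl t)) has_real_derivative 1 + 2 * a * C (cl t)) (at t)"
        using loc[OF that modes(3)] loc[OF that modes(4)] by simp_all
    qed
    show "C (cl 0) = 0" "S (cl 0) = 0"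
      using modes(1,2) cl_id[of 0] \<delta> T0 by (simp_all add: \<beta>_def)
    show "(S (cl t))\<^sup>2 = 2 * C (cl t) + 2 * a * (C (cl t))\<^sup>2" for t by (rule modes(5))
    show "\<bar>C (cl t)\<bar> \<le> MC" "\<bar>S (cl t)\<bar> \<le> MC" for t using MC cl by blast+
    show "m / 2 \<le> 1 + deriv u0 x * S (cl t) + (k / 2 * (\<rho>0 x)\<^sup>2 + 1 / 2 * (deriv u0 x)\<^sup>2 + a) * C (cl t)" for t x
      using Flow[OF cl] unfolding F_def .
    have L: "loc_L2 \<rho>0" "loc_L2 (deriv u0)"
      using abs_cont_continuous[OF s0(1)] abs_cont_continuous[OF w0(2)] by (auto intro: loc_L2_continuous)
    have eq: "(LBINT x:{0..1}. k / 2 * (\<rho>0 x)\<^sup>2 + 1 / 2 * (deriv u0 x)\<^sup>2 + a)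
        = k / 2 * (LBINT x:{0..1}. (\<rho>0 x)\<^sup>2) + 1 / 2 * (LBINT x:{0..1}. (deriv u0 x)\<^sup>2) + a"
      using L by (simp add: loc_L2_sq_integrable loc_L2_integrable set_integral_Icc_const)
    have "a = - (1 / 2) * (k * (LBINT x:{0..1}. (\<rho>0 x)\<^sup>2) + (LBINT x:{0..1}. (deriv u0 x)\<^sup>2))"
      unfolding a HS_const_def using L by (simp add: loc_L2_sq_integrable)
    then have "k / 2 * (LBINT x:{0..1}. (\<rho>0 x)\<^sup>2) + 1 / 2 * (LBINT x:{0..1}. (deriv u0 x)\<^sup>2) + a = 0"
      by (simp add: algebra_simps)
    with eq show "(LBINT x:{0..1}. k / 2 * (\<rho>0 x)\<^sup>2 + 1 / 2 * (deriv u0 x)\<^sup>2 + a) = 0" by (rule trans)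
  qed (use w0 s0 m periodicD[OF w0(3)] periodicD[OF w0(4)] periodicD[OF w0(5)] periodicD[OF s0(2)] periodicD[OF s0(3)] in auto)
  have "hh t = h t" if "0 < t" "t < \<beta>" for t using that by (simp add: hh_def ch_def)
  from HS_solution[OF this a] \<delta>(1) show ?thesis unfolding \<beta>_def by (intro exI[of _ "T0 + \<delta>"]) auto
qed

text \<open>Before T0 the explicit expression F is the exponential of the integral of u_x along a
  trajectory. It is therefore positive, and from time s on it can shrink at most by the factor
  exp(-M T0).\<close>

lemma HS_solution_extends_if_bounded_below:
  fixes h u0 \<rho>0 :: "real \<Rightarrow> real" and u \<rho> :: "real \<Rightarrow> real \<Rightarrow> real"
  assumes h: "continuous_on {0..} h" and u0: "u0 \<in> sobolev 2" and r0: "\<rho>0 \<in> sobolev 1"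
    and sol: "HS_solution k h u0 \<rho>0 (ereal T0) u \<rho>"
    and low: "s < T0" "\<And>t x. s \<le> t \<Longrightarrow> t < T0 \<Longrightarrow> deriv (u t) x \<ge> - M" and s: "0 \<le> s" and M: "M \<ge> 0"
  shows "\<exists>\<beta>>T0. \<exists>u \<rho>. HS_solution k h u0 \<rho>0 (ereal \<beta>) u \<rho>"
proof -
  define a where "a = HS_const k u0 \<rho>0"
  obtain C S where modes: "C 0 = 0" "S 0 = 0" "\<And>t. (C has_real_derivative S t) (at t)"
      "\<And>t. (S has_real_derivative 1 + 2 * a * C t) (at t)" "\<And>t. (S t)\<^sup>2 = 2 * C t + 2 * a * (C t)\<^sup>2"
    using density_modes[of a] by metis
  define F where "F t x = 1 + deriv u0 x * S t + (k / 2 * (\<rho>0 x)\<^sup>2 + 1 / 2 * (deriv u0 x)\<^sup>2 + a) * C t" for t x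
  have init: "u 0 = u0" "\<rho> 0 = \<rho>0" using sol by (auto simp: HS_solution_def)
  have Fexp: "F r x > 0 \<and> (r \<ge> s \<longrightarrow> F s x * exp (- M * T0) \<le> F r x)" if r: "0 \<le> r" "r < T0" for r x
  proof -
    \<comment> \<open>The dynamics along trajectories lives on closed intervals, so one ending
      strictly before T0 is chosen for each r.\<close>
    obtain \<tau> where \<tau>: "r < \<tau>" "s < \<tau>" "\<tau> < T0"
      using r low(1) by (metis dense max_less_iff_conj)
    have \<tau>0: "\<tau> > 0" using r \<tau> by simp
    have cl: "HS_classical k a \<tau> h u (\<lambda>t. deriv (u t)) \<rho>"
      unfolding a_def by (rule HS_solution_classical[OF sol \<tau>0]) (use \<tau> in simp)
    obtain q where tr: "q 0 = x" "\<And>t. t \<in> {0..\<tau>} \<Longrightarrow> (q has_real_derivative u t (q t)) (at t within {0..\<tau>})"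
      using HS_classical.trajectory_exists[OF cl, of 0 x] \<tau>0 by (metis atLeastAtMost_iff less_imp_le order_refl)
    interpret HS_trajectory k a \<tau> h u "\<lambda>t. deriv (u t)" \<rho> q
      by (intro HS_trajectory.intro[OF cl] HS_trajectory_axioms.intro tr(2))
    have eq: "exp (E t) = F t x" if "t \<in> {0..\<tau>}" for t
      using density_formula[OF modes(3,1,4,2) that] by (simp add: F_def V_def R_def tr(1) init)
    have "F s x * exp (- M * T0) \<le> F r x" if "r \<ge> s"
    proof -
      have "F s x * exp (- M * (r - s)) \<le> F r x"
        using E_lower[OF s that, of M] r s \<tau> low(2) that by (simp add: V_def eq)
      \<comment> \<open>The decay factor is made independent of r in preparation for the limit r ->
        T0.\<close>
      moreover have "F s x * exp (- M * T0) \<le> F s x * exp (- M * (r - s))"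
      proof (intro mult_left_mono)
        have "M * (r - s) \<le> M * T0" using M r s by (intro mult_left_mono) auto
        then show "exp (- M * T0) \<le> exp (- M * (r - s))" by simp
        show "0 \<le> F s x" using eq[of s] s \<tau> by (metis atLeastAtMost_iff exp_ge_zero less_imp_le)
      qed
      ultimately show ?thesis by linarith
    qed
    moreover have "F r x > 0" using eq[of r] r \<tau> by (metis atLeastAtMost_iff exp_gt_zero less_imp_le)
    ultimately show ?thesis by blast
  qed
  have T0: "T0 > 0" using low(1) s by simp
  have "F t x > 0" if t: "t \<in> {0..T0}" for t x
  proof (cases "t = T0")
    case False then show ?thesis using Fexp[of t x] t by simp
  next
    case True
    \<comment> \<open>F is explicit in t and thus continuous across T0, even though the given
      solution ends there. The lower bound survives in the limit.\<close>
    have "isCont (\<lambda>t. F t x) T0"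
      unfolding F_def using DERIV_isCont[OF modes(3)] DERIV_isCont[OF modes(4)] by (intro continuous_intros) auto
    then have "((\<lambda>t. F t x) \<longlongrightarrow> F T0 x) (at_left T0)"
      unfolding isCont_def by (rule tendsto_within_subset) simp
    moreover have "\<forall>\<^sub>F r in at_left T0. F s x * exp (- M * T0) \<le> F r x"
      unfolding eventually_at_left_field
      by (intro exI[of _ s]) (use low(1) s Fexp in auto)
    ultimately have "F s x * exp (- M * T0) \<le> F T0 x"
      by (intro tendsto_lowerbound) auto
    moreover have "F s x * exp (- M * T0) > 0" using Fexp[OF s low(1), of x] by simp
    ultimately have "F T0 x > 0" by linarith
    then show ?thesis using True by simp
  qed
  then show ?thesis
    unfolding F_def by (intro HS_solution_extends[OF h u0 r0 a_def T0 modes])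
qed

theorem theorem3p5:
  fixes k :: real and h u0 \<rho>0 :: "real \<Rightarrow> real"
    and u \<rho> :: "real \<Rightarrow> real \<Rightarrow> real" and T :: ereal
  assumes "k \<in> {1, -1}"
    and "continuous_on {0..} h"
    and "u0 \<in> sobolev 2"
    and "\<rho>0 \<in> sobolev 1"
    and "T = max_existence_time k h u0 \<rho>0"
    and "HS_solution k h u0 \<rho>0 T u \<rho>"
  shows "blows_up_in_finite_time k h u0 \<rho>0 \<longleftrightarrow>
         Liminf (tends_to_time T) (\<lambda>t. INF x. ereal (deriv (u t) x)) = -\<infinity>"
proof
  have T: "T > 0" using assms(6) by (simp add: HS_solution_def)
  {
    assume "blows_up_in_finite_time k h u0 \<rho>0"
    then have "T < \<infinity>" by (simp add: blows_up_in_finite_time_def assms(5))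
    with T obtain T0 where T0: "T = ereal T0" by (cases T) auto
    then have T0p: "T0 > 0" using T by simp
    show "Liminf (tends_to_time T) (\<lambda>t. INF x. ereal (deriv (u t) x)) = -\<infinity>"
    proof (rule ccontr)
      assume "Liminf (tends_to_time T) (\<lambda>t. INF x. ereal (deriv (u t) x)) \<noteq> -\<infinity>"
      then obtain r where r: "ereal r < Liminf (tends_to_time T) (\<lambda>t. INF x. ereal (deriv (u t) x))"
        by (metis ereal_dense2 ereal_infty_less(2) ereal_less_eq(2) linorder_not_less order_le_less)
      from less_LiminfD[OF this]
      obtain Q where Q: "eventually Q (at_left (ereal T0))"
        "\<And>t. Q (ereal t) \<Longrightarrow> ereal r < (INF x. ereal (deriv (u t) x))"
        unfolding tends_to_time_def T0 eventually_filtercomap by blast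
      obtain b where b: "b < ereal T0" "\<And>y. b < y \<Longrightarrow> y < ereal T0 \<Longrightarrow> Q y"
        using Q(1) eventually_at_left[of "-\<infinity>" "ereal T0"] by auto
      \<comment> \<open>The threshold b may be negative or -\<infinity>, so s is chosen above both b
        and 0.\<close>
      obtain s where s: "0 \<le> s" "s < T0" "b < ereal s"
      proof -
        have "max b 0 < ereal T0" using b(1) T0p by simp
        then obtain s where "max b 0 < ereal s" "ereal s < ereal T0" using ereal_dense2 by blast
        then show thesis by (intro that[of s]) auto
      qed
      \<comment> \<open>The bound r is weakened to -|r| because the extension lemma expects a bound
        of the form -M with M >= 0.\<close>
      have "deriv (u t) x \<ge> - \<bar>r\<bar>" if "s \<le> t" "t < T0" for t x
      proof -
        have "b < ereal t" using s(3) that(1) by (meson ereal_less_eq(3) less_le_trans)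
        then have "ereal r < (INF x. ereal (deriv (u t) x))" using that by (intro Q(2) b(2)) auto
        also have "\<dots> \<le> ereal (deriv (u t) x)" by (rule INF_lower) simp
        finally show ?thesis by simp
      qed
      from HS_solution_extends_if_bounded_below[OF assms(2,3,4) assms(6)[unfolded T0] s(2) this s(1)]
      obtain \<beta> v \<sigma> where \<beta>: "\<beta> > T0" "HS_solution k h u0 \<rho>0 (ereal \<beta>) v \<sigma>" by auto
      then have "ereal \<beta> \<le> T" unfolding assms(5) max_existence_time_def by (intro Sup_upper) blast
      then show False using \<beta>(1) T0 by simp
    qed
  next
    assume inf: "Liminf (tends_to_time T) (\<lambda>t. INF x. ereal (deriv (u t) x)) = -\<infinity>"
    have "T \<noteq> \<infinity>"
    proof
      assume T: "T = \<infinity>"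
      obtain K where K: "\<And>t x. t \<ge> 0 \<Longrightarrow> deriv (u t) x \<ge> - K"
        using HS_global_lower_bound[OF assms(1,3,4) assms(6)[unfolded T]] by blast
      have "eventually (\<lambda>y. 0 < y) (at_left (\<infinity> :: ereal))"
        by (subst eventually_at_left[of 0]) (auto intro!: exI[of _ 0])
      then have "\<forall>\<^sub>F t in tends_to_time T. t > 0"
        unfolding tends_to_time_def T eventually_filtercomap by (intro exI[of _ "\<lambda>y. 0 < y"]) auto
      then have "\<forall>\<^sub>F t in tends_to_time T. ereal (- K) \<le> (INF x. ereal (deriv (u t) x))"
        by eventually_elim (intro INF_greatest, use K in auto)
      then have "ereal (- K) \<le> Liminf (tends_to_time T) (\<lambda>t. INF x. ereal (deriv (u t) x))"
        by (rule Liminf_bounded)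
      then show False using inf by simp
    qed
    then show "blows_up_in_finite_time k h u0 \<rho>0"
      using T by (cases T) (auto simp: blows_up_in_finite_time_def simp flip: assms(5))
  }
qed

end
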